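(* Let $f\colon B\to M$ be a smooth map between smooth manifolds, and let $L$ be a Dirac structure on $M$ such that $f^!L$ is smooth. Then $\mathfrak{B}L$ is a Dirac structure on $B$. Further, $\mathfrak{B}L$ and $f^!L$ induce the same singular foliation, i.e. $\mathcal{F}_{\mathfrak{B}L}=\mathcal{F}_{f^!L}$.
   Context: Subscript $c$ means "compactly supported". **Dirac structures.** A Dirac structure on $M$ is a (smooth) vector subbundle $L\subset TM\oplus T^*M$ which is maximal isotropic for the canonical symmetric pairing and involutive for the Courant bracket $[(X,\xi),(X',\xi')]=([X,X'],\mathcal{L}_X\xi'-\iota_{X'}\mathrm{d}\xi)$. It is a Lie algebroid with anchor $\mathrm{pr}_{TM}|_L$ and bracket the restriction of the Courant bracket. **$\mathfrak{B}L$.** $\mathfrak{B}L:=\{(X,f^*\eta):X\in T_xB,\ \eta\in T^*_{f(x)}M,\ (f_*X,\eta)\in L_{f(x)},\ x\in B\}\subset TB\oplus T^*B$; this is in general only a pointwise collection of maximal isotropic subspaces. **Pullback Lie algebroid.** For a Lie algebroid $A$ over $M$ with anchor $\rho$, $f^!A:=\{(a,v)\in f^*A\oplus TB:\rho(a)=f_*v\}$. "$f^!A$ is smooth" means that the fibers of $f^!A\to B$ have constant rank; equivalently the subspaces $\rho(A_{f(x)})+f_*(T_xB)$ have constant rank for $x\in B$; equivalently $f^!A$ is a vector subbundle of $f^*A\oplus TB$. In that case $f^!A$ is a Lie algebroid over $B$ with anchor $(a,v)\mapsto v$ (and bracket determined by the bracket of $A$, the Lie bracket of vector fields on $B$ and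 the Leibniz rule). $f^!L$ denotes this construction applied to the Lie algebroid underlying $L$. **Induced singular foliation.** For a Lie algebroid $A$ with anchor $\rho$ over a manifold, $\mathcal{F}_A:=\rho(\Gamma_c(A))$, a submodule of the compactly supported vector fields; for a Dirac structure $L$, $\mathcal{F}_L$ is that of the underlying Lie algebroid, i.e. $\mathcal{F}_L=\mathrm{pr}_{TM}(\Gamma_c(L))$. *)

theory Defs
  imports "HOL-Analysis.Analysis"
begin

section \<open>Smooth functions between Euclidean spaces\<close>

text \<open>Finite-dimensional Euclidean spaces. In contrast to the class \<^class>\<open>euclidean_space\<close>, the
  zero space is admitted, so that manifolds of dimension 0 are covered.\<close>

class fd_euclidean = real_inner +
  assumes fd_euclidean_finite: "\<exists>S::'a set. finite S \<and> (\<forall>x. \<exists>c. x = (\<Sum>b\<in>S. c b *\<^sub>R b))"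

lemma fd_euclidean_finite_span: "\<exists>S::'a::fd_euclidean set. finite S \<and> span S = UNIV"
proof -
  obtain S :: "'a set" where S: "finite S" "\<forall>x. \<exists>c. x = (\<Sum>b\<in>S. c b *\<^sub>R b)"
    using fd_euclidean_finite by blast
  have "x \<in> span S" for x
    using S by (auto simp: span_finite)
  with S(1) show ?thesis by blast
qed

instance euclidean_space \<subseteq> fd_euclidean
proof
  show "\<exists>S::'a set. finite S \<and> (\<forall>x. \<exists>c. x = (\<Sum>b\<in>S. c b *\<^sub>R b))"
    by (intro exI[of _ Basis] conjI finite_Basis allI exI) (rule euclidean_representation[symmetric])
qed

text \<open>\<open>Ck_on k S f\<close> and \<open>smooth_on S f\<close> are meant for open \<open>S\<close> and a finite-dimensional domain type,
  where continuity of all iterated directional derivatives up to order \<open>k\<close> is \<open>C\<^sup>k\<close>.\<close>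

primrec Ck_on :: "nat \<Rightarrow> 'a::real_normed_vector set \<Rightarrow> ('a \<Rightarrow> 'b::real_normed_vector) \<Rightarrow> bool" where
  "Ck_on 0 S f \<longleftrightarrow> continuous_on S f"
| "Ck_on (Suc k) S f \<longleftrightarrow>
     (\<forall>x\<in>S. f differentiable (at x)) \<and> (\<forall>v. Ck_on k S (\<lambda>x. frechet_derivative f (at x) v))"

definition smooth_on :: "'a::real_normed_vector set \<Rightarrow> ('a \<Rightarrow> 'b::real_normed_vector) \<Rightarrow> bool" where
  "smooth_on S f \<longleftrightarrow> (\<forall>k. Ck_on k S f)"


section \<open>Manifolds and smooth maps\<close>

text \<open>A manifold is a whole Hausdorff, second countable type \<open>'m\<close> together with a smooth atlas with
  values in the model space \<open>'e\<close>. The second component of a chart is relevant only on the first one,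
  the chart domain.\<close>

type_synonym ('m, 'e) chart = "'m set \<times> ('m \<Rightarrow> 'e)"

definition chart_inv :: "('m, 'e) chart \<Rightarrow> 'e \<Rightarrow> 'm" where
  "chart_inv c = inv_into (fst c) (snd c)"

definition smooth_atlas ::
  "('m::{t2_space, second_countable_topology}, 'e::fd_euclidean) chart set \<Rightarrow> bool" where
  "smooth_atlas A \<longleftrightarrow>
     (\<Union>c\<in>A. fst c) = UNIV \<and>
     (\<forall>c\<in>A. open (fst c) \<and> open (snd c ` fst c) \<and>
        homeomorphism (fst c) (snd c ` fst c) (snd c) (chart_inv c)) \<and>
     (\<forall>c\<in>A. \<forall>d\<in>A. smooth_on (snd c ` (fst c \<inter> fst d)) (snd d \<circ> chart_inv c))"

definition smooth_map ::
  "('n::topological_space, 'u::real_normed_vector) chart set \<Rightarrow>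
   ('m::topological_space, 'e::real_normed_vector) chart set \<Rightarrow> ('n \<Rightarrow> 'm) \<Rightarrow> bool" where
  "smooth_map AN A f \<longleftrightarrow>
     continuous_on UNIV f \<and>
     (\<forall>c\<in>AN. \<forall>d\<in>A. smooth_on (snd c ` (fst c \<inter> f -` fst d)) (snd d \<circ> f \<circ> chart_inv c))"


section \<open>Tangent and cotangent vectors\<close>

text \<open>For every point \<open>p\<close> a chart \<open>chart_at A p\<close> around \<open>p\<close> is selected. A tangent vector at \<open>p\<close>,
  i.e. a family of vectors in \<open>'e\<close>, one for each chart around \<open>p\<close>, that are related by the derivatives
  of the transition maps, is determined by its member for the selected chart, and is represented by
  that member. Thus the tangent space at \<open>p\<close> is \<open>'e\<close>, the cotangent space is its dual, and these
  identifications need not depend continuously on \<open>p\<close>: smoothness of sections is always expressed by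
  transporting to one fixed chart.\<close>

definition chart_at :: "('m, 'e) chart set \<Rightarrow> 'm \<Rightarrow> ('m, 'e) chart" where
  "chart_at A p = (SOME c. c \<in> A \<and> p \<in> fst c)"

type_synonym 'e gtangent = "'e \<times> ('e \<Rightarrow>\<^sub>L real)"  \<comment> \<open>fibre of \<open>TM \<oplus> T\<^sup>*M\<close>\<close>

definition trans_deriv ::
  "('m, 'e::real_normed_vector) chart \<Rightarrow> ('m, 'e) chart \<Rightarrow> 'm \<Rightarrow> 'e \<Rightarrow>\<^sub>L 'e" where
  "trans_deriv c d p = Blinfun (frechet_derivative (snd d \<circ> chart_inv c) (at (snd c p)))"

definition vec_in_chart ::
  "('m, 'e::real_normed_vector) chart set \<Rightarrow> ('m, 'e) chart \<Rightarrow> 'm \<Rightarrow> 'e \<Rightarrow> 'e" where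
  "vec_in_chart A d p v = blinfun_apply (trans_deriv (chart_at A p) d p) v"

definition covec_in_chart ::
  "('m, 'e::real_normed_vector) chart set \<Rightarrow> ('m, 'e) chart \<Rightarrow> 'm \<Rightarrow> ('e \<Rightarrow>\<^sub>L real) \<Rightarrow> ('e \<Rightarrow>\<^sub>L real)" where
  "covec_in_chart A d p \<xi> = \<xi> o\<^sub>L trans_deriv d (chart_at A p) p"

definition tangent_map ::
  "('n, 'u::real_normed_vector) chart set \<Rightarrow> ('m, 'e::real_normed_vector) chart set \<Rightarrow>
   ('n \<Rightarrow> 'm) \<Rightarrow> 'n \<Rightarrow> 'u \<Rightarrow>\<^sub>L 'e" where
  "tangent_map AN A f x =
     Blinfun (frechet_derivative (snd (chart_at A (f x)) \<circ> f \<circ> chart_inv (chart_at AN x))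
       (at (snd (chart_at AN x) x)))"

text \<open>Local representatives of vector fields and 1-forms in a chart.\<close>

definition vec_rep ::
  "('m, 'e::real_normed_vector) chart set \<Rightarrow> ('m, 'e) chart \<Rightarrow> ('m \<Rightarrow> 'e) \<Rightarrow> 'e \<Rightarrow> 'e" where
  "vec_rep A c X = (\<lambda>y. vec_in_chart A c (chart_inv c y) (X (chart_inv c y)))"

definition form_rep ::
  "('m, 'e::real_normed_vector) chart set \<Rightarrow> ('m, 'e) chart \<Rightarrow>
   ('m \<Rightarrow> 'e \<Rightarrow>\<^sub>L real) \<Rightarrow> 'e \<Rightarrow> ('e \<Rightarrow>\<^sub>L real)" where
  "form_rep A c \<xi> = (\<lambda>y. covec_in_chart A c (chart_inv c y) (\<xi> (chart_inv c y)))"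

definition smooth_vector_field_on ::
  "('m, 'e::real_normed_vector) chart set \<Rightarrow> 'm set \<Rightarrow> ('m \<Rightarrow> 'e) \<Rightarrow> bool" where
  "smooth_vector_field_on A U X \<longleftrightarrow> (\<forall>c\<in>A. smooth_on (snd c ` (fst c \<inter> U)) (vec_rep A c X))"

definition smooth_form_on ::
  "('m, 'e::real_normed_vector) chart set \<Rightarrow> 'm set \<Rightarrow> ('m \<Rightarrow> 'e \<Rightarrow>\<^sub>L real) \<Rightarrow> bool" where
  "smooth_form_on A U \<xi> \<longleftrightarrow> (\<forall>c\<in>A. smooth_on (snd c ` (fst c \<inter> U)) (form_rep A c \<xi>))"

text \<open>Smooth sections of \<open>TM \<oplus> T\<^sup>*M\<close> over an open set \<open>U\<close>.\<close>

definition smooth_gsection_on ::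
  "('m, 'e::real_normed_vector) chart set \<Rightarrow> 'm set \<Rightarrow> ('m \<Rightarrow> 'e gtangent) \<Rightarrow> bool" where
  "smooth_gsection_on A U s \<longleftrightarrow>
     smooth_vector_field_on A U (fst \<circ> s) \<and> smooth_form_on A U (snd \<circ> s)"

text \<open>Smooth sections of the pullback bundle \<open>f\<^sup>*(TM \<oplus> T\<^sup>*M)\<close> over the source of \<open>f\<close>.\<close>

definition smooth_gsection_along ::
  "('n, 'u::real_normed_vector) chart set \<Rightarrow> ('m, 'e::real_normed_vector) chart set \<Rightarrow>
   ('n \<Rightarrow> 'm) \<Rightarrow> ('n \<Rightarrow> 'e gtangent) \<Rightarrow> bool" where
  "smooth_gsection_along AN A f a \<longleftrightarrow>
     (\<forall>c\<in>AN. \<forall>d\<in>A.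
        smooth_on (snd c ` (fst c \<inter> f -` fst d))
          (\<lambda>y. let x = chart_inv c y in vec_in_chart A d (f x) (fst (a x))) \<and>
        smooth_on (snd c ` (fst c \<inter> f -` fst d))
          (\<lambda>y. let x = chart_inv c y in covec_in_chart A d (f x) (snd (a x))))"


section \<open>The Courant bracket\<close>

text \<open>The following operations are given at \<open>p\<close> by their classical coordinate expressions in the chart
  \<open>chart_at A p\<close>, in which the representatives at \<open>p\<close> are the elements themselves:
  \<open>[X,Y]\<^sup>i = X\<^sup>j \<partial>\<^sub>j Y\<^sup>i - Y\<^sup>j \<partial>\<^sub>j X\<^sup>i\<close>,
  \<open>(L\<^sub>X \<xi>)\<^sub>i = X\<^sup>j \<partial>\<^sub>j \<xi>\<^sub>i + \<xi>\<^sub>j \<partial>\<^sub>i X\<^sup>j\<close> and \<open>(d\<xi>)(u,v) = u\<^sup>i v\<^sup>j (\<partial>\<^sub>i \<xi>\<^sub>j - \<partial>\<^sub>j \<xi>\<^sub>i)\<close>.\<close>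

definition lie_bracket ::
  "('m, 'e::real_normed_vector) chart set \<Rightarrow> ('m \<Rightarrow> 'e) \<Rightarrow> ('m \<Rightarrow> 'e) \<Rightarrow> 'm \<Rightarrow> 'e" where
  "lie_bracket A X Y p =
     (let c = chart_at A p; y = snd c p in
        frechet_derivative (vec_rep A c Y) (at y) (X p)
        - frechet_derivative (vec_rep A c X) (at y) (Y p))"

definition lie_derivative ::
  "('m, 'e::real_normed_vector) chart set \<Rightarrow> ('m \<Rightarrow> 'e) \<Rightarrow> ('m \<Rightarrow> 'e \<Rightarrow>\<^sub>L real) \<Rightarrow> 'm \<Rightarrow> ('e \<Rightarrow>\<^sub>L real)" where
  "lie_derivative A X \<xi> p =
     (let c = chart_at A p; y = snd c p in
        frechet_derivative (form_rep A c \<xi>) (at y) (X p)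
        + (\<xi> p o\<^sub>L Blinfun (frechet_derivative (vec_rep A c X) (at y))))"

definition ext_derivative ::
  "('m, 'e::real_normed_vector) chart set \<Rightarrow> ('m \<Rightarrow> 'e \<Rightarrow>\<^sub>L real) \<Rightarrow> 'm \<Rightarrow> 'e \<Rightarrow> 'e \<Rightarrow> real" where
  "ext_derivative A \<xi> p u v =
     (let c = chart_at A p; y = snd c p in
        blinfun_apply (frechet_derivative (form_rep A c \<xi>) (at y) u) v
        - blinfun_apply (frechet_derivative (form_rep A c \<xi>) (at y) v) u)"

definition courant_bracket ::
  "('m, 'e::real_normed_vector) chart set \<Rightarrow> ('m \<Rightarrow> 'e gtangent) \<Rightarrow> ('m \<Rightarrow> 'e gtangent) \<Rightarrow>
   'm \<Rightarrow> 'e gtangent" where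
  "courant_bracket A s t p =
     (lie_bracket A (fst \<circ> s) (fst \<circ> t) p,
      lie_derivative A (fst \<circ> s) (snd \<circ> t) p
      - Blinfun (\<lambda>v. ext_derivative A (snd \<circ> s) p (fst (t p)) v))"


section \<open>Dirac structures\<close>

definition pairing :: "'e::real_normed_vector gtangent \<Rightarrow> 'e gtangent \<Rightarrow> real" where
  "pairing a b = blinfun_apply (snd a) (fst b) + blinfun_apply (snd b) (fst a)"

definition isotropic :: "'e::real_normed_vector gtangent set \<Rightarrow> bool" where
  "isotropic V \<longleftrightarrow> subspace V \<and> (\<forall>a\<in>V. \<forall>b\<in>V. pairing a b = 0)"

definition maximal_isotropic :: "'e::real_normed_vector gtangent set \<Rightarrow> bool" where
  "maximal_isotropic V \<longleftrightarrow> isotropic V \<and> (\<forall>W. isotropic W \<and> V \<subseteq> W \<longrightarrow> W = V)"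

text \<open>A collection of subspaces is a smooth vector subbundle of rank \<open>k\<close> if it has smooth local frames.\<close>

definition smooth_subbundle ::
  "('m::topological_space, 'e::real_normed_vector) chart set \<Rightarrow> ('m \<Rightarrow> 'e gtangent set) \<Rightarrow> bool" where
  "smooth_subbundle A L \<longleftrightarrow>
     (\<exists>k::nat. \<forall>p. \<exists>U s. open U \<and> p \<in> U \<and>
        (\<forall>i<k. smooth_gsection_on A U (s i)) \<and>
        (\<forall>q\<in>U. inj_on (\<lambda>i. s i q) {..<k} \<and> independent ((\<lambda>i. s i q) ` {..<k}) \<and>
           span ((\<lambda>i. s i q) ` {..<k}) = L q))"

definition sections ::
  "('m, 'e::real_normed_vector) chart set \<Rightarrow> ('m \<Rightarrow> 'e gtangent set) \<Rightarrow> ('m \<Rightarrow> 'e gtangent) set" where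
  "sections A L = {s. smooth_gsection_on A UNIV s \<and> (\<forall>p. s p \<in> L p)}"

definition dirac_structure ::
  "('m::topological_space, 'e::real_normed_vector) chart set \<Rightarrow> ('m \<Rightarrow> 'e gtangent set) \<Rightarrow> bool" where
  "dirac_structure A L \<longleftrightarrow>
     smooth_subbundle A L \<and>
     (\<forall>p. maximal_isotropic (L p)) \<and>
     (\<forall>s\<in>sections A L. \<forall>t\<in>sections A L. courant_bracket A s t \<in> sections A L)"

definition compactly_supported :: "('m::topological_space \<Rightarrow> 'v::zero) \<Rightarrow> bool" where
  "compactly_supported s \<longleftrightarrow> compact (closure {p. s p \<noteq> 0})"

text \<open>The foliation \<open>F\<^sub>L = pr\<^sub>T\<^sub>M(\<Gamma>\<^sub>c(L))\<close>.\<close>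

definition dirac_foliation ::
  "('m::topological_space, 'e::real_normed_vector) chart set \<Rightarrow> ('m \<Rightarrow> 'e gtangent set) \<Rightarrow>
   ('m \<Rightarrow> 'e) set" where
  "dirac_foliation A L = (\<lambda>s. fst \<circ> s) ` {s \<in> sections A L. compactly_supported s}"


section \<open>Pullbacks along a smooth map\<close>

definition dirac_pullback ::
  "('n, 'u::real_normed_vector) chart set \<Rightarrow> ('m, 'e::real_normed_vector) chart set \<Rightarrow>
   ('n \<Rightarrow> 'm) \<Rightarrow> ('m \<Rightarrow> 'e gtangent set) \<Rightarrow> 'n \<Rightarrow> 'u gtangent set" where
  "dirac_pullback AN A f L x =
     {(X, \<eta> o\<^sub>L tangent_map AN A f x) | X \<eta>. (blinfun_apply (tangent_map AN A f x) X, \<eta>) \<in> L (f x)}"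

text \<open>The fibres of \<open>f\<^sup>!L\<close>; the anchor of \<open>L\<close> is \<^const>\<open>fst\<close>.\<close>

definition algebroid_pullback ::
  "('n, 'u::real_normed_vector) chart set \<Rightarrow> ('m, 'e::real_normed_vector) chart set \<Rightarrow>
   ('n \<Rightarrow> 'm) \<Rightarrow> ('m \<Rightarrow> 'e gtangent set) \<Rightarrow> 'n \<Rightarrow> ('e gtangent \<times> 'u) set" where
  "algebroid_pullback AN A f L x =
     {(a, v). a \<in> L (f x) \<and> fst a = blinfun_apply (tangent_map AN A f x) v}"

definition algebroid_pullback_smooth ::
  "('n, 'u::real_normed_vector) chart set \<Rightarrow> ('m, 'e::real_normed_vector) chart set \<Rightarrow>
   ('n \<Rightarrow> 'm) \<Rightarrow> ('m \<Rightarrow> 'e gtangent set) \<Rightarrow> bool" where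
  "algebroid_pullback_smooth AN A f L \<longleftrightarrow> (\<exists>k. \<forall>x. dim (algebroid_pullback AN A f L x) = k)"

definition algebroid_pullback_sections ::
  "('n, 'u::real_normed_vector) chart set \<Rightarrow> ('m, 'e::real_normed_vector) chart set \<Rightarrow>
   ('n \<Rightarrow> 'm) \<Rightarrow> ('m \<Rightarrow> 'e gtangent set) \<Rightarrow> ('n \<Rightarrow> 'e gtangent \<times> 'u) set" where
  "algebroid_pullback_sections AN A f L =
     {\<sigma>. smooth_gsection_along AN A f (fst \<circ> \<sigma>) \<and> smooth_vector_field_on AN UNIV (snd \<circ> \<sigma>) \<and>
         (\<forall>x. \<sigma> x \<in> algebroid_pullback AN A f L x)}"

text \<open>The foliation induced by \<open>f\<^sup>!L\<close>, whose anchor is \<open>(a, v) \<mapsto> v\<close>.\<close>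

definition algebroid_pullback_foliation ::
  "('n::topological_space, 'u::real_normed_vector) chart set \<Rightarrow>
   ('m, 'e::real_normed_vector) chart set \<Rightarrow>
   ('n \<Rightarrow> 'm) \<Rightarrow> ('m \<Rightarrow> 'e gtangent set) \<Rightarrow> ('n \<Rightarrow> 'u) set" where
  "algebroid_pullback_foliation AN A f L =
     (\<lambda>\<sigma>. snd \<circ> \<sigma>) ` {\<sigma> \<in> algebroid_pullback_sections AN A f L. compactly_supported \<sigma>}"

end

theory Submission
  imports Defs
begin

text \<open>The map \<open>f\<^sup>!L \<rightarrow> BL\<close>, \<open>((f\<^sub>*X, \<eta>), X) \<mapsto> (X, f\<^sup>*\<eta>)\<close>, is fibrewise onto, and pulling back preserves maximal
  isotropy by linear algebra. Since \<open>f\<^sup>!L\<close> is the kernel of a smooth family of linear maps of constant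
  rank, local smooth sections of \<open>f\<^sup>!L\<close> pass through each of its points; their images provide local frames
  of \<open>BL\<close> together with smooth local lifts of the sections of \<open>BL\<close>. Glueing the lifts of a compactly
  supported section with bump functions gives the equality of the foliations.

  For sections \<open>s\<^sub>i = (X\<^sub>i, f\<^sup>*\<eta>\<^sub>i)\<close> with lifts \<open>a\<^sub>i = (f\<^sub>*X\<^sub>i, \<eta>\<^sub>i)\<close> one finds in coordinates
  \<open>\<langle>[s\<^sub>1, s\<^sub>2], s\<^sub>3\<rangle> = \<langle>D\<^sub>X\<^sub>1 a\<^sub>2, a\<^sub>3\<rangle> - \<langle>D\<^sub>X\<^sub>2 a\<^sub>1, a\<^sub>3\<rangle> + \<langle>D\<^sub>X\<^sub>3 a\<^sub>1, a\<^sub>2\<rangle>\<close>. Expand the \<open>a\<^sub>i\<close> in a frame of \<open>L\<close>: the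
  derivatives of the coefficients drop out because \<open>L\<close> is isotropic, and the rest vanishes because \<open>L\<close> is
  involutive. Applied to a transition map, the same formula shows that the coordinate expression of the
  Courant bracket does not depend on the chart.\<close>


section \<open>Finite-dimensional inner product spaces\<close>

text \<open>Two features of the setting shape the argument. Involutivity of \<open>L\<close> is a
  statement about global sections, while the bracket is computed with a local frame of
  \<open>L\<close>; the local frame is therefore multiplied by a bump function, which makes its
  members global sections of \<open>L\<close> that still form a frame near the given point.
  Moreover, the charts that identify the tangent spaces with the model space are selected without
  continuity, so smoothness cannot be read off pointwise values: every argument is first moved to
  one fixed pair of charts. A lift of a section of \<open>BL\<close> is not unique: its covector may
  be changed by any covector that annihilates both the image of the anchor and the image of the
  derivative of \<open>f\<close>. Smoothness of \<open>f^!L\<close> says that the dimension of this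
  ambiguity is constant. The lifts chosen below depend linearly on the value of the section, hence
  vanish wherever the section does; this keeps supports compact. Since a maximal isotropic fibre is
  its own orthogonal, involutivity is tested by pairing the bracket with single vectors of the
  fibre, and the third argument of the Courant tensor need not be extended to a section.\<close>

definition orthonormal :: "'a::real_inner set \<Rightarrow> bool" where
  "orthonormal E \<longleftrightarrow> (\<forall>a\<in>E. \<forall>b\<in>E. a \<bullet> b = (if a = b then 1 else 0))"

lemma orthonormal_expansion:
  assumes "finite E" "orthonormal E" "x \<in> span E"
  shows "x = (\<Sum>e\<in>E. (x \<bullet> e) *\<^sub>R e)"
proof -
  obtain c where c: "x = (\<Sum>e\<in>E. c e *\<^sub>R e)"
    using assms(1,3) by (auto simp: span_finite)
  have "x \<bullet> e = c e" if "e \<in> E" for e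
  proof -
    have "x \<bullet> e = (\<Sum>b\<in>E. if b = e then c b else 0)"
      unfolding c inner_sum_left
      by (rule sum.cong) (use assms(2) that in \<open>auto simp: orthonormal_def\<close>)
    also have "\<dots> = c e" using assms(1) that by simp
    finally show ?thesis .
  qed
  then show ?thesis by (subst (1) c) (rule sum.cong, auto)
qed

lemma orthonormal_imp_independent:
  assumes "orthonormal (E::'a::real_inner set)"
  shows "independent E"
proof (rule pairwise_orthogonal_independent)
  show "pairwise orthogonal E" using assms by (auto simp: pairwise_def orthogonal_def orthonormal_def)
  show "0 \<notin> E" using assms by (force simp: orthonormal_def)
qed

lemma orthonormal_basis_exists:
  assumes "finite (B::'a::real_inner set)"
  shows "\<exists>E. finite E \<and> orthonormal E \<and> span E = span B"
proof -
  obtain C where C: "finite C" "span C = span B" "pairwise orthogonal C"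
    using basis_orthogonal[OF assms] by blast
  define E where "E = (\<lambda>x. x /\<^sub>R norm x) ` (C - {0})"
  have "orthonormal E"
    unfolding orthonormal_def
  proof (intro ballI)
    fix a b assume "a \<in> E" "b \<in> E"
    then obtain x y where xy: "x \<in> C" "y \<in> C" "x \<noteq> 0" "y \<noteq> 0" "a = x /\<^sub>R norm x" "b = y /\<^sub>R norm y"
      unfolding E_def by blast
    show "a \<bullet> b = (if a = b then 1 else 0)"
    proof (cases "x = y")
      case True
      then show ?thesis using xy by (simp add: dot_square_norm power2_eq_square)
    next
      case False
      then have "x \<bullet> y = 0" using C(3) xy by (auto simp: pairwise_def orthogonal_def)
      then have "a \<bullet> b = 0" using xy by simp
      moreover have "a \<bullet> a = 1" using xy by (simp add: dot_square_norm power2_eq_square)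
      ultimately show ?thesis by auto
    qed
  qed
  moreover have "span E = span C"
  proof (rule span_eq[THEN iffD2], intro conjI subsetI)
    fix x assume "x \<in> E" then show "x \<in> span C"
      unfolding E_def by (auto intro: span_scale span_base)
  next
    fix x assume x: "x \<in> C"
    show "x \<in> span E"
    proof (cases "x = 0")
      case False
      then have "x /\<^sub>R norm x \<in> E" using x by (auto simp: E_def)
      from span_scale[OF span_base[OF this], of "norm x"] show ?thesis using False by simp
    qed (simp add: span_zero)
  qed
  ultimately show ?thesis using C by (intro exI[of _ E]) (auto simp: E_def)
qed

text \<open>The class provides a finite spanning set but no distinguished basis. One orthonormal
  basis is chosen for each type, so that vectors and linear maps can be expanded in finite sums; on
  the zero space it is empty.\<close>

definition onb :: "'a::fd_euclidean set" where
  "onb = (SOME E. finite E \<and> orthonormal E \<and> span E = UNIV)"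

lemma finite_onb [simp]: "finite (onb::'a::fd_euclidean set)"
  and orthonormal_onb: "orthonormal (onb::'a set)"
  and span_onb [simp]: "span (onb::'a set) = UNIV"
proof -
  obtain S :: "'a set" where S: "finite S" "span S = UNIV" using fd_euclidean_finite_span by blast
  have "\<exists>E::'a set. finite E \<and> orthonormal E \<and> span E = UNIV"
    using orthonormal_basis_exists[OF S(1)] S(2) by simp
  from someI_ex[OF this] show "finite (onb::'a set)" "orthonormal (onb::'a set)" "span (onb::'a set) = UNIV"
    unfolding onb_def by blast+
qed

lemma independent_onb [simp]: "independent (onb::'a::fd_euclidean set)"
  by (rule orthonormal_imp_independent[OF orthonormal_onb])

lemma inner_onb: "a \<in> onb \<Longrightarrow> b \<in> onb \<Longrightarrow> a \<bullet> b = (if a = b then 1 else 0)"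
  using orthonormal_onb unfolding orthonormal_def by blast

lemma onb_expansion: "(\<Sum>e\<in>onb. (x \<bullet> e) *\<^sub>R e) = (x::'a::fd_euclidean)"
  by (rule orthonormal_expansion[symmetric]) (auto simp: orthonormal_onb)

lemma linear_onb_expansion:
  assumes "linear f"
  shows "f x = (\<Sum>e\<in>onb. (x \<bullet> e) *\<^sub>R f (e::'a::fd_euclidean))"
  by (subst (1) onb_expansion[symmetric])
     (simp add: linear_sum[OF assms] linear_scale[OF assms])

lemma linear_imp_bounded_linear:
  assumes "linear (f::'a::fd_euclidean \<Rightarrow> 'b::real_normed_vector)"
  shows "bounded_linear f"
proof -
  have "f = (\<lambda>x. \<Sum>e\<in>onb. (x \<bullet> e) *\<^sub>R f e)"
    using linear_onb_expansion[OF assms] by blast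
  moreover have "bounded_linear (\<lambda>x. \<Sum>e\<in>onb. (x \<bullet> e) *\<^sub>R f e)"
    by (intro bounded_linear_sum bounded_linear_intros)
  ultimately show ?thesis by simp
qed

lemma subspace_orthonormal_basis:
  assumes "subspace (V::'a::fd_euclidean set)"
  obtains E where "finite E" "orthonormal E" "span E = V" "E \<subseteq> V"
proof -
  obtain B where B: "B \<subseteq> V" "independent B" "V \<subseteq> span B"
    using maximal_independent_subset by blast
  have "finite B" using independent_span_bound[OF finite_onb B(2)] by simp
  moreover have "span B = V" using B assms by (simp add: span_minimal subset_antisym)
  ultimately show ?thesis using orthonormal_basis_exists[of B] that span_superset by metis
qed

text \<open>The constant rank argument is applied to kernels inside \<open>'e \<times> 'u\<close>,
  so the product has to belong to the class as well.\<close>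

instance prod :: (fd_euclidean, fd_euclidean) fd_euclidean
proof
  let ?S = "(\<lambda>a. (a, 0::'b)) ` (onb::'a set) \<union> (\<lambda>b. (0::'a, b)) ` (onb::'b set)"
  have "x \<in> span ?S" for x :: "'a \<times> 'b"
  proof -
    have "(fst x, 0) = (\<Sum>e\<in>onb. (fst x \<bullet> e) *\<^sub>R (e, 0::'b))"
      by (rule prod_eqI) (simp_all add: fst_sum snd_sum onb_expansion)
    then have 1: "(fst x, 0) \<in> span ?S"
      by (simp only:) (intro span_sum span_scale span_base, blast)
    have "(0, snd x) = (\<Sum>e\<in>onb. (snd x \<bullet> e) *\<^sub>R (0::'a, e))"
      by (rule prod_eqI) (simp_all add: fst_sum snd_sum onb_expansion)
    then have 2: "(0, snd x) \<in> span ?S"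
      by (simp only:) (intro span_sum span_scale span_base, blast)
    have "x = (fst x, 0) + (0, snd x)" by simp
    then show ?thesis using span_add[OF 1 2] by simp
  qed
  moreover have "finite ?S" by simp
  ultimately show "\<exists>S::('a \<times> 'b) set. finite S \<and> (\<forall>x. \<exists>c. x = (\<Sum>b\<in>S. c b *\<^sub>R b))"
    by (intro exI[of _ ?S]) (auto simp: span_finite image_iff set_eq_iff)
qed

text \<open>In coordinates the ball lies inside a box, which is compact by the theorem on products
  of compact spaces. The sum over \<open>onb\<close> maps this box continuously onto a compact set
  that contains the ball as a closed subset.\<close>

lemma fd_compact_cball: "compact (cball (x::'a::fd_euclidean) r)"
proof -
  let ?X = "product_topology (\<lambda>_. euclideanreal) (onb::'a set)" and ?R = "norm x + \<bar>r\<bar>"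
  let ?P = "PiE onb (\<lambda>_. {- ?R..?R})" and ?g = "\<lambda>c. \<Sum>e\<in>onb. c e *\<^sub>R (e::'a)"
  have "continuous_map ?X euclidean (\<lambda>c. c e *\<^sub>R e)" if "e \<in> onb" for e
  proof -
    have "continuous_map euclideanreal euclidean (\<lambda>t. t *\<^sub>R e)"
      by (simp add: continuous_on_scaleR continuous_on_id continuous_on_const)
    from continuous_map_compose[OF continuous_map_product_projection[OF that] this]
    show ?thesis by (simp add: o_def)
  qed
  then have "continuous_map ?X euclidean ?g" by (intro continuous_map_sum) auto
  moreover have "compactin ?X ?P" by (simp add: compactin_PiE)
  ultimately have K: "compact (?g ` ?P)" using image_compactin compactin_euclidean_iff by blast
  have "cball x r \<subseteq> ?g ` ?P"
  proof
    fix y assume "y \<in> cball x r"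
    then have y: "norm y \<le> ?R"
      using norm_triangle_ineq2[of y x] by (simp add: dist_norm norm_minus_commute)
    have "y \<bullet> e \<in> {- ?R..?R}" if "e \<in> onb" for e
    proof -
      have "\<bar>y \<bullet> e\<bar> \<le> norm y"
        using Cauchy_Schwarz_ineq2[of y e] inner_onb[OF that that] by (simp add: norm_eq_sqrt_inner)
      with y show ?thesis unfolding atLeastAtMost_iff by linarith
    qed
    then have P: "restrict (\<lambda>e. y \<bullet> e) onb \<in> ?P" by simp
    have g: "?g (restrict (\<lambda>e. y \<bullet> e) onb) = y" using onb_expansion[of y] by simp
    show "y \<in> ?g ` ?P" using imageI[OF P, of ?g] unfolding g .
  qed
  with K show ?thesis
    using compact_Int_closed[of "?g ` ?P" "cball x r"] by (simp add: inf.absorb2)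
qed


section \<open>Calculus of smooth functions\<close>

lemma has_frechet_derivative:
  "f differentiable (at x) \<Longrightarrow> (f has_derivative frechet_derivative f (at x)) (at x)"
  by (simp add: frechet_derivative_works[symmetric])

lemma frechet_derivative_eqI:
  "(f has_derivative f') (at x) \<Longrightarrow> frechet_derivative f (at x) = f'"
  using frechet_derivative_at by metis

lemma Ck_on_cong:
  assumes "open S" "\<And>x. x \<in> S \<Longrightarrow> f x = g x" "Ck_on k S f"
  shows "Ck_on k S g"
  using assms(2,3)
proof (induction k arbitrary: f g)
  case 0
  then show ?case using continuous_on_cong[of S S f g] by simp
next
  case (Suc k)
  have d: "g differentiable (at x)" "frechet_derivative g (at x) = frechet_derivative f (at x)"
    if "x \<in> S" for x
  proof -
    have "(f has_derivative frechet_derivative f (at x)) (at x)"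
      using Suc.prems that by (intro has_frechet_derivative) simp
    then have *: "(g has_derivative frechet_derivative f (at x)) (at x)"
      using has_derivative_transform_within_open[OF _ assms(1) that] Suc.prems(1) by blast
    show "g differentiable (at x)" using * differentiable_def by blast
    show "frechet_derivative g (at x) = frechet_derivative f (at x)"
      by (rule frechet_derivative_eqI[OF *])
  qed
  have "Ck_on k S (\<lambda>x. frechet_derivative g (at x) v)" for v
    by (rule Suc.IH[of "\<lambda>x. frechet_derivative f (at x) v"]) (use Suc.prems d in auto)
  then show ?case using d by simp
qed

lemma Ck_on_subset: "Ck_on k S f \<Longrightarrow> T \<subseteq> S \<Longrightarrow> Ck_on k T f"
  by (induction k arbitrary: f) (auto intro: continuous_on_subset)

lemma Ck_on_Suc_D: "Ck_on (Suc k) S f \<Longrightarrow> Ck_on k S f"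
proof (induction k arbitrary: f)
  case 0
  then have "f differentiable (at x)" if "x \<in> S" for x using that by simp
  then show ?case
    by (simp add: continuous_at_imp_continuous_on differentiable_imp_continuous_within)
next
  case (Suc k)
  have "\<forall>x\<in>S. f differentiable (at x)" and *: "Ck_on (Suc k) S (\<lambda>x. frechet_derivative f (at x) v)" for v
    using Suc.prems unfolding Ck_on.simps(2)[of "Suc k"] by blast+
  with Suc.IH[OF *] show ?case unfolding Ck_on.simps(2)[of k] by blast
qed

lemma Ck_on_localI:
  assumes "\<And>x. x \<in> S \<Longrightarrow> \<exists>T. open T \<and> x \<in> T \<and> Ck_on k T f"
  shows "Ck_on k S f"
  using assms
proof (induction k arbitrary: f)
  case 0
  show ?case
    unfolding Ck_on.simps(1)
  proof (intro continuous_at_imp_continuous_on ballI)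
    fix x assume "x \<in> S"
    then obtain T where "open T" "x \<in> T" "continuous_on T f" using 0 by auto
    then show "isCont f x" by (simp add: continuous_on_eq_continuous_at)
  qed
next
  case (Suc k)
  show ?case
    unfolding Ck_on.simps(2)
  proof (intro conjI allI ballI)
    fix x assume "x \<in> S"
    then obtain T where "open T" "x \<in> T" "Ck_on (Suc k) T f" using Suc.prems by blast
    then show "f differentiable (at x)" by simp
  next
    fix v show "Ck_on k S (\<lambda>x. frechet_derivative f (at x) v)"
      by (rule Suc.IH) (use Suc.prems in \<open>simp, blast\<close>)
  qed
qed

lemma Ck_on_const [simp]: "Ck_on k S (\<lambda>x. c)"
  by (induction k arbitrary: c) simp_all

text \<open>Any formula for the derivative on the open set may replace the chosen
  \<open>frechet_derivative\<close>; the closure properties below are all proved by exhibiting such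
  a formula.\<close>

lemma Ck_on_SucI:
  assumes "open S" "\<And>x. x \<in> S \<Longrightarrow> (f has_derivative f' x) (at x)" "\<And>v. Ck_on k S (\<lambda>x. f' x v)"
  shows "Ck_on (Suc k) S f"
proof -
  have "Ck_on k S (\<lambda>x. frechet_derivative f (at x) v)" for v
    by (rule Ck_on_cong[OF assms(1) _ assms(3)[of v]])
       (use frechet_derivative_eqI[OF assms(2)] in simp)
  then show ?thesis using assms(2) by (auto simp: differentiable_def)
qed

lemma Ck_on_SucD:
  assumes "Ck_on (Suc k) S f"
  shows "x \<in> S \<Longrightarrow> (f has_derivative frechet_derivative f (at x)) (at x)"
    and "Ck_on k S (\<lambda>x. frechet_derivative f (at x) v)"
  using assms by (auto intro: has_frechet_derivative)

lemma Ck_on_bounded_linear: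
  assumes "open S" "bounded_linear h" "Ck_on k S f"
  shows "Ck_on k S (\<lambda>x. h (f x))"
  using assms(3)
proof (induction k arbitrary: f)
  case 0
  then show ?case using bounded_linear.continuous_on[OF assms(2)] by simp
next
  case (Suc k)
  show ?case
    by (rule Ck_on_SucI[OF assms(1), where f' = "\<lambda>x v. h (frechet_derivative f (at x) v)"])
       (use Suc.IH Ck_on_SucD[OF Suc.prems] in \<open>auto intro!: bounded_linear.has_derivative[OF assms(2)]\<close>)
qed

lemma Ck_on_add:
  assumes "open S" "Ck_on k S f" "Ck_on k S g"
  shows "Ck_on k S (\<lambda>x. f x + g x)"
  using assms(2,3)
proof (induction k arbitrary: f g)
  case 0
  then show ?case by (simp add: continuous_on_add)
next
  case (Suc k)
  show ?case
    by (rule Ck_on_SucI[OF assms(1),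
          where f' = "\<lambda>x v. frechet_derivative f (at x) v + frechet_derivative g (at x) v"])
       (use Suc Ck_on_SucD[OF Suc.prems(1)] Ck_on_SucD[OF Suc.prems(2)] in
         \<open>auto intro!: has_derivative_add\<close>)
qed

lemma Ck_on_sum:
  assumes "open S" "\<And>i. i \<in> I \<Longrightarrow> Ck_on k S (f i)"
  shows "Ck_on k S (\<lambda>x. \<Sum>i\<in>I. f i x)"
  using assms(2)
  by (induction I rule: infinite_finite_induct) (auto intro: Ck_on_add[OF assms(1)])

lemma (in bounded_bilinear) Ck_on:
  assumes "open S" "Ck_on k S f" "Ck_on k S g"
  shows "Ck_on k S (\<lambda>x. prod (f x) (g x))"
  using assms(2,3)
proof (induction k arbitrary: f g)
  case 0
  then show ?case by (auto intro: continuous_on)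
next
  case (Suc k)
  note f = Ck_on_SucD[OF Suc.prems(1)] and g = Ck_on_SucD[OF Suc.prems(2)]
  show ?case
    by (rule Ck_on_SucI[OF assms(1),
          where f' = "\<lambda>x v. prod (f x) (frechet_derivative g (at x) v)
                            + prod (frechet_derivative f (at x) v) (g x)"])
       (use f g Suc.IH Suc.prems[THEN Ck_on_Suc_D] in
         \<open>auto intro!: Ck_on_add[OF assms(1)] FDERIV\<close>)
qed

text \<open>In the chain rule the derivative of \<open>g\<close> is evaluated on a vector that
  varies with \<open>x\<close>, which the induction hypothesis does not cover. Expanding this vector
  in the orthonormal basis of the middle space leaves derivatives of \<open>g\<close> in constant
  directions, multiplied by scalar functions; this is why the middle space has to be
  finite-dimensional.\<close>

lemma Ck_on_compose:
  fixes f :: "'a::real_normed_vector \<Rightarrow> 'b::fd_euclidean"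
  assumes "open S" "open T" "f ` S \<subseteq> T" "Ck_on k S f" "Ck_on k T g"
  shows "Ck_on k S (\<lambda>x. g (f x))"
  using assms(4,5)
proof (induction k arbitrary: g)
  case 0
  then show ?case using assms(3) by (auto intro: continuous_on_compose2)
next
  case (Suc k)
  note f = Ck_on_SucD[OF Suc.prems(1)] and g = Ck_on_SucD[OF Suc.prems(2)]
  let ?D = "\<lambda>x v. \<Sum>e\<in>onb. (frechet_derivative f (at x) v \<bullet> e) *\<^sub>R frechet_derivative g (at (f x)) e"
  show ?case
  proof (rule Ck_on_SucI[OF assms(1), where f' = ?D])
    fix x assume x: "x \<in> S"
    have gd: "(g has_derivative frechet_derivative g (at (f x))) (at (f x))"
      using x assms(3) g(1) by blast
    have "(\<lambda>v. frechet_derivative g (at (f x)) (frechet_derivative f (at x) v)) = ?D x"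
      by (rule ext) (rule linear_onb_expansion[OF has_derivative_linear[OF gd]])
    then show "((\<lambda>x. g (f x)) has_derivative ?D x) (at x)"
      using has_derivative_compose[OF f(1)[OF x] gd] by simp
  next
    fix v
    have "Ck_on k S (\<lambda>x. frechet_derivative g (at (f x)) e)" for e
      by (rule Suc.IH) (use Ck_on_Suc_D[OF Suc.prems(1)] g in auto)
    moreover have "Ck_on k S (\<lambda>x. frechet_derivative f (at x) v \<bullet> e)" for e
      by (rule Ck_on_bounded_linear[OF assms(1) bounded_linear_inner_left f(2)])
    ultimately show "Ck_on k S (\<lambda>x. ?D x v)"
      by (intro Ck_on_sum[OF assms(1)] bounded_bilinear.Ck_on[OF bounded_bilinear_scaleR assms(1)]) auto
  qed
qed

text \<open>The derivative of the inverse is a product of the inverse with itself and the derivative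
  of \<open>f\<close>, so the claim at order \<open>k\<close> yields the claim at order
  \<open>k + 1\<close>.\<close>

lemma Ck_on_inverse:
  fixes f :: "'a::real_normed_vector \<Rightarrow> real"
  assumes "open S" "Ck_on k S f" "\<And>x. x \<in> S \<Longrightarrow> f x \<noteq> 0"
  shows "Ck_on k S (\<lambda>x. inverse (f x))"
  using assms(2)
proof (induction k)
  case 0
  then show ?case using assms(3) by (simp add: continuous_on_inverse)
next
  case (Suc k)
  note f = Ck_on_SucD[OF Suc.prems(1)]
  note IH = Suc.IH[OF Ck_on_Suc_D[OF Suc.prems]]
  show ?case
  proof (rule Ck_on_SucI[OF assms(1),
        where f' = "\<lambda>x v. - (inverse (f x) * frechet_derivative f (at x) v * inverse (f x))"])
    fix x assume x: "x \<in> S"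
    show "((\<lambda>x. inverse (f x)) has_derivative
            (\<lambda>v. - (inverse (f x) * frechet_derivative f (at x) v * inverse (f x)))) (at x)"
      by (rule Deriv.has_derivative_inverse[OF assms(3)[OF x] f(1)[OF x]])
  next
    fix v show "Ck_on k S (\<lambda>x. - (inverse (f x) * frechet_derivative f (at x) v * inverse (f x)))"
      by (intro Ck_on_bounded_linear[OF assms(1) bounded_linear_minus[OF bounded_linear_ident]]
           bounded_bilinear.Ck_on[OF bounded_bilinear_mult assms(1)] IH f(2))
  qed
qed

section \<open>Closure properties of smooth functions, scalar- and operator-valued\<close>

lemma smooth_on_cong:
  "open S \<Longrightarrow> (\<And>x. x \<in> S \<Longrightarrow> f x = g x) \<Longrightarrow> smooth_on S f \<Longrightarrow> smooth_on S g"
  unfolding smooth_on_def using Ck_on_cong by blast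

lemma smooth_on_subset: "smooth_on S f \<Longrightarrow> T \<subseteq> S \<Longrightarrow> smooth_on T f"
  unfolding smooth_on_def using Ck_on_subset by blast

lemma smooth_on_localI:
  assumes "\<And>x. x \<in> S \<Longrightarrow> \<exists>T. open T \<and> x \<in> T \<and> smooth_on T f"
  shows "smooth_on S f"
  unfolding smooth_on_def
  by (intro allI Ck_on_localI) (use assms in \<open>auto simp: smooth_on_def\<close>)

lemma smooth_on_differentiable: "smooth_on S f \<Longrightarrow> x \<in> S \<Longrightarrow> f differentiable (at x)"
  unfolding smooth_on_def using Ck_on.simps(2) by blast

lemma smooth_on_has_derivative:
  "smooth_on S f \<Longrightarrow> x \<in> S \<Longrightarrow> (f has_derivative frechet_derivative f (at x)) (at x)"
  by (intro has_frechet_derivative smooth_on_differentiable)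

lemma smooth_on_continuous: "smooth_on S f \<Longrightarrow> continuous_on S f"
  unfolding smooth_on_def using Ck_on.simps(1) by blast

lemma smooth_on_frechet_derivative: "smooth_on S f \<Longrightarrow> smooth_on S (\<lambda>x. frechet_derivative f (at x) v)"
  unfolding smooth_on_def using Ck_on.simps(2) by blast

lemma smooth_on_const [simp]: "smooth_on S (\<lambda>x. c)"
  unfolding smooth_on_def by simp

lemma smooth_on_bounded_linear:
  "open S \<Longrightarrow> bounded_linear h \<Longrightarrow> smooth_on S f \<Longrightarrow> smooth_on S (\<lambda>x. h (f x))"
  unfolding smooth_on_def using Ck_on_bounded_linear by blast

lemma smooth_on_ident [simp]: "open S \<Longrightarrow> smooth_on S (\<lambda>x. x)"
  unfolding smooth_on_def
proof
  fix k assume "open S" then show "Ck_on k S (\<lambda>x. x)"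
    by (cases k) (auto intro: Ck_on_SucI[where f' = "\<lambda>x v. v"])
qed

lemma smooth_on_add:
  "open S \<Longrightarrow> smooth_on S f \<Longrightarrow> smooth_on S g \<Longrightarrow> smooth_on S (\<lambda>x. f x + g x)"
  unfolding smooth_on_def using Ck_on_add by blast

lemma smooth_on_sum:
  "open S \<Longrightarrow> (\<And>i. i \<in> I \<Longrightarrow> smooth_on S (f i)) \<Longrightarrow> smooth_on S (\<lambda>x. \<Sum>i\<in>I. f i x)"
  by (simp add: smooth_on_def Ck_on_sum)

lemma (in bounded_bilinear) smooth_on:
  "open S \<Longrightarrow> smooth_on S f \<Longrightarrow> smooth_on S g \<Longrightarrow> smooth_on S (\<lambda>x. prod (f x) (g x))"
  by (simp add: smooth_on_def Ck_on)

lemmas smooth_on_scaleR = bounded_bilinear.smooth_on[OF bounded_bilinear_scaleR]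
  and smooth_on_mult = bounded_bilinear.smooth_on[OF bounded_bilinear_mult]
  and smooth_on_inner = bounded_bilinear.smooth_on[OF bounded_bilinear_inner]
  and smooth_on_blinfun_apply = bounded_bilinear.smooth_on[OF bounded_bilinear_blinfun_apply]
  and smooth_on_blinfun_compose = bounded_bilinear.smooth_on[OF bounded_bilinear_blinfun_compose]

lemma smooth_on_uminus: "open S \<Longrightarrow> smooth_on S f \<Longrightarrow> smooth_on S (\<lambda>x. - f x)"
  by (rule smooth_on_bounded_linear[OF _ bounded_linear_minus[OF bounded_linear_ident]])

lemma smooth_on_diff:
  "open S \<Longrightarrow> smooth_on S f \<Longrightarrow> smooth_on S g \<Longrightarrow> smooth_on S (\<lambda>x. f x - g x)"
  using smooth_on_add[of S f "\<lambda>x. - g x"] smooth_on_uminus[of S g] by simp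

lemma smooth_on_compose:
  fixes f :: "'a::real_normed_vector \<Rightarrow> 'b::fd_euclidean"
  shows "open S \<Longrightarrow> open T \<Longrightarrow> f ` S \<subseteq> T \<Longrightarrow> smooth_on S f \<Longrightarrow> smooth_on T g \<Longrightarrow>
    smooth_on S (\<lambda>x. g (f x))"
  unfolding smooth_on_def by (intro allI) (rule Ck_on_compose[of S T], auto)

lemma smooth_on_inverse:
  fixes f :: "'a::real_normed_vector \<Rightarrow> real"
  shows "open S \<Longrightarrow> smooth_on S f \<Longrightarrow> (\<And>x. x \<in> S \<Longrightarrow> f x \<noteq> 0) \<Longrightarrow> smooth_on S (\<lambda>x. inverse (f x))"
  by (simp add: smooth_on_def Ck_on_inverse)

lemma smooth_on_Pair:
  assumes "open S" "smooth_on S f" "smooth_on S g"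
  shows "smooth_on S (\<lambda>x. (f x, g x))"
proof -
  have "smooth_on S (\<lambda>x. (f x, 0) + (0, g x))"
    by (intro smooth_on_add assms smooth_on_bounded_linear[where h = "\<lambda>v. (v, 0)"]
        smooth_on_bounded_linear[where h = "\<lambda>v. (0, v)"] bounded_linear_Pair
        bounded_linear_ident bounded_linear_zero)
  then show ?thesis by simp
qed

lemma smooth_on_fst: "open S \<Longrightarrow> smooth_on S f \<Longrightarrow> smooth_on S (\<lambda>x. fst (f x))"
  and smooth_on_snd: "open S \<Longrightarrow> smooth_on S f \<Longrightarrow> smooth_on S (\<lambda>x. snd (f x))"
  by (auto intro: smooth_on_bounded_linear bounded_linear_fst bounded_linear_snd)

lemma bounded_linear_outer: "bounded_linear (\<lambda>b. blinfun_scaleR_left b o\<^sub>L blinfun_inner_left e)"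
  by (intro bounded_linear_intros bounded_linear_compose[OF
        bounded_bilinear.bounded_linear_left[OF bounded_bilinear_blinfun_compose]])

lemma blinfun_onb_expansion:
  fixes B :: "'a::fd_euclidean \<Rightarrow>\<^sub>L 'b::real_normed_vector"
  shows "B = (\<Sum>e\<in>onb. blinfun_scaleR_left (B e) o\<^sub>L blinfun_inner_left e)"
  by (rule blinfun_eqI)
     (simp add: blinfun.sum_left blinfun_inner_left.rep_eq
        linear_onb_expansion[OF bounded_linear.linear[OF blinfun.bounded_linear_right], symmetric])

text \<open>An operator on a finite-dimensional space is a finite sum of operators of rank one, each
  depending linearly on one value of the operator. Smoothness can therefore be tested on fixed
  vectors.\<close>

lemma smooth_on_blinfunI:
  fixes B :: "'x::real_normed_vector \<Rightarrow> 'a::fd_euclidean \<Rightarrow>\<^sub>L 'b::real_normed_vector"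
  assumes "open S" "\<And>v. smooth_on S (\<lambda>x. blinfun_apply (B x) v)"
  shows "smooth_on S B"
proof -
  have "smooth_on S (\<lambda>x. \<Sum>e\<in>onb. blinfun_scaleR_left (B x e) o\<^sub>L blinfun_inner_left e)"
    by (intro smooth_on_sum smooth_on_bounded_linear[OF _ bounded_linear_outer] assms)
  then show ?thesis
    by (rule smooth_on_cong[OF assms(1), rotated]) (rule blinfun_onb_expansion[symmetric])
qed

text \<open>The derivative as an element of the normed space of operators, so that it can itself be
  differentiated and composed. It is meaningful only at points of differentiability.\<close>

definition Dbl :: "('a::real_normed_vector \<Rightarrow> 'b::real_normed_vector) \<Rightarrow> 'a \<Rightarrow> 'a \<Rightarrow>\<^sub>L 'b" where
  "Dbl f x = Blinfun (frechet_derivative f (at x))"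

lemma Dbl_apply: "f differentiable (at x) \<Longrightarrow> blinfun_apply (Dbl f x) = frechet_derivative f (at x)"
  unfolding Dbl_def
  by (intro bounded_linear_Blinfun_apply has_derivative_bounded_linear[OF has_frechet_derivative])

lemma Dbl_has_derivative: "f differentiable (at x) \<Longrightarrow> (f has_derivative blinfun_apply (Dbl f x)) (at x)"
  by (simp add: Dbl_apply has_frechet_derivative)

lemma Dbl_eqI: "(f has_derivative blinfun_apply f') (at x) \<Longrightarrow> Dbl f x = f'"
  unfolding Dbl_def by (simp add: frechet_derivative_eqI blinfun_apply_inverse)

lemma smooth_on_Dbl:
  fixes f :: "'a::fd_euclidean \<Rightarrow> 'b::real_normed_vector"
  assumes "open S" "smooth_on S f"
  shows "smooth_on S (Dbl f)"
proof (rule smooth_on_blinfunI[OF assms(1)])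
  fix v show "smooth_on S (\<lambda>x. blinfun_apply (Dbl f x) v)"
    by (rule smooth_on_cong[OF assms(1) _ smooth_on_frechet_derivative[OF assms(2), of v]])
       (simp add: Dbl_apply smooth_on_differentiable[OF assms(2)])
qed

lemma Dbl_cong:
  assumes "open S" "x \<in> S" "\<And>y. y \<in> S \<Longrightarrow> f y = g y" "f differentiable (at x)"
  shows "Dbl g x = Dbl f x"
  by (rule Dbl_eqI, rule has_derivative_transform_within_open[OF Dbl_has_derivative[OF assms(4)]])
     (use assms in auto)

lemma Dbl_compose:
  assumes "f differentiable (at x)" "g differentiable (at (f x))"
  shows "Dbl (\<lambda>x. g (f x)) x = Dbl g (f x) o\<^sub>L Dbl f x"
  by (rule Dbl_eqI)
     (use has_derivative_compose[OF Dbl_has_derivative[OF assms(1)] Dbl_has_derivative[OF assms(2)]]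
       in \<open>simp add: blinfun_compose.rep_eq o_def\<close>)


subsection \<open>Symmetry of the second derivative\<close>

text \<open>The mean value theorem is used twice: in the direction \<open>u\<close>, for the
  increment of \<open>\<phi>\<close> along \<open>v\<close>, and then in the direction
  \<open>v\<close>, for the first derivative along \<open>u\<close>.\<close>

lemma second_difference_mvt:
  fixes \<phi> :: "'a::real_normed_vector \<Rightarrow> real"
  assumes "smooth_on S \<phi>" "0 < t"
    and S: "\<And>r s. 0 \<le> r \<Longrightarrow> r \<le> t \<Longrightarrow> 0 \<le> s \<Longrightarrow> s \<le> t \<Longrightarrow> x + r *\<^sub>R u + s *\<^sub>R v \<in> S"
  shows "\<exists>r s. 0 \<le> r \<and> r \<le> t \<and> 0 \<le> s \<and> s \<le> t \<and>
    \<phi> (x + t *\<^sub>R u + t *\<^sub>R v) - \<phi> (x + t *\<^sub>R u) - \<phi> (x + t *\<^sub>R v) + \<phi> x =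
    t * t * frechet_derivative (\<lambda>y. frechet_derivative \<phi> (at y) u) (at (x + r *\<^sub>R u + s *\<^sub>R v)) v"
proof -
  define D where "D = (\<lambda>y. frechet_derivative \<phi> (at y))"
  define G where "G = (\<lambda>r. \<phi> (x + r *\<^sub>R u + t *\<^sub>R v) - \<phi> (x + r *\<^sub>R u + 0 *\<^sub>R v))"
  have dp: "(\<phi> has_derivative D y) (at y)" if "y \<in> S" for y
    unfolding D_def by (rule smooth_on_has_derivative[OF assms(1) that])
  have dr: "((\<lambda>r. \<phi> (x + r *\<^sub>R u + s *\<^sub>R v)) has_derivative (\<lambda>h. D (x + r *\<^sub>R u + s *\<^sub>R v) (h *\<^sub>R u))) (at r)"
    if "0 \<le> r" "r \<le> t" "0 \<le> s" "s \<le> t" for r s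
    by (rule has_derivative_compose[where f = "\<lambda>r. x + r *\<^sub>R u + s *\<^sub>R v", OF _ dp[OF S[OF that]]])
       (auto intro!: derivative_eq_intros)
  have dG: "(G has_derivative (\<lambda>h. h * (D (x + r *\<^sub>R u + t *\<^sub>R v) u - D (x + r *\<^sub>R u + 0 *\<^sub>R v) u))) (at r)"
    if "0 \<le> r" "r \<le> t" for r
  proof -
    have l1: "D (x + r *\<^sub>R u + s *\<^sub>R v) (h *\<^sub>R u) = h * D (x + r *\<^sub>R u + s *\<^sub>R v) u"
      if "0 \<le> s" "s \<le> t" for s h
      using linear_scale[OF has_derivative_linear[OF dp[OF S[OF \<open>0 \<le> r\<close> \<open>r \<le> t\<close> that]]]] by simp
    have t: "0 \<le> t" using assms(2) by simp
    have "(G has_derivative (\<lambda>h. D (x + r *\<^sub>R u + t *\<^sub>R v) (h *\<^sub>R u) - D (x + r *\<^sub>R u + 0 *\<^sub>R v) (h *\<^sub>R u))) (at r)"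
      unfolding G_def
      by (intro has_derivative_diff dr[OF that t order_refl] dr[OF that order_refl t])
    then show ?thesis unfolding l1[OF t order_refl] l1[OF order_refl t] right_diff_distrib .
  qed
  obtain r where r: "0 < r" "r < t"
    "G t - G 0 = (t - 0) * (D (x + r *\<^sub>R u + t *\<^sub>R v) u - D (x + r *\<^sub>R u + 0 *\<^sub>R v) u)"
    using mvt_simple[OF assms(2), of G "\<lambda>r h. h * (D (x + r *\<^sub>R u + t *\<^sub>R v) u - D (x + r *\<^sub>R u + 0 *\<^sub>R v) u)"]
      dG[THEN has_derivative_at_withinI] by (metis atLeastAtMost_iff greaterThanLessThan_iff)
  define H where "H = (\<lambda>s. D (x + r *\<^sub>R u + s *\<^sub>R v) u)"
  let ?E = "\<lambda>y. frechet_derivative (\<lambda>y. D y u) (at y)"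
  have dD: "((\<lambda>y. D y u) has_derivative ?E y) (at y)" if "y \<in> S" for y
    unfolding D_def
    by (rule smooth_on_has_derivative[OF smooth_on_frechet_derivative[OF assms(1)] that])
  have dH: "(H has_derivative (\<lambda>h. h * ?E (x + r *\<^sub>R u + s *\<^sub>R v) v)) (at s)" if "0 \<le> s" "s \<le> t" for s
  proof -
    have y: "x + r *\<^sub>R u + s *\<^sub>R v \<in> S" using S r that by simp
    have "(H has_derivative (\<lambda>h. ?E (x + r *\<^sub>R u + s *\<^sub>R v) (h *\<^sub>R v))) (at s)"
      unfolding H_def
      by (rule has_derivative_compose[where f = "\<lambda>s. x + r *\<^sub>R u + s *\<^sub>R v", OF _ dD[OF y]])
         (auto intro!: derivative_eq_intros)
    then show ?thesis using linear_scale[OF has_derivative_linear[OF dD[OF y]]] by simp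
  qed
  obtain s where s: "0 < s" "s < t" "H t - H 0 = (t - 0) * ?E (x + r *\<^sub>R u + s *\<^sub>R v) v"
    using mvt_simple[OF assms(2), of H "\<lambda>s h. h * ?E (x + r *\<^sub>R u + s *\<^sub>R v) v"]
      dH[THEN has_derivative_at_withinI] by (metis atLeastAtMost_iff greaterThanLessThan_iff)
  have "\<phi> (x + t *\<^sub>R u + t *\<^sub>R v) - \<phi> (x + t *\<^sub>R u) - \<phi> (x + t *\<^sub>R v) + \<phi> x = G t - G 0"
    by (simp add: G_def)
  also have "\<dots> = t * (H t - H 0)" using r(3) by (simp add: H_def)
  also have "\<dots> = t * t * ?E (x + r *\<^sub>R u + s *\<^sub>R v) v" using s(3) by simp
  finally show ?thesis using r s unfolding D_def by (intro exI[of _ r] exI[of _ s]) auto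
qed

text \<open>The second difference is symmetric in \<open>u\<close> and \<open>v\<close>. Hence the
  two mixed derivatives take a common value at points arbitrarily close to \<open>x\<close>, and
  continuity carries the equality to \<open>x\<close>.\<close>

lemma second_derivative_symmetric_real:
  fixes \<phi> :: "'a::real_normed_vector \<Rightarrow> real"
  assumes "open S" "smooth_on S \<phi>" "x \<in> S"
  shows "frechet_derivative (\<lambda>y. frechet_derivative \<phi> (at y) u) (at x) v =
         frechet_derivative (\<lambda>y. frechet_derivative \<phi> (at y) v) (at x) u"
proof -
  define A where "A = (\<lambda>u v x. frechet_derivative (\<lambda>y. frechet_derivative \<phi> (at y) u) (at x) v)"
  have cont: "isCont (A u v) x" for u v
    using smooth_on_continuous[OF smooth_on_frechet_derivative[OF smooth_on_frechet_derivative[OF assms(2)]]]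
      assms(1,3) unfolding A_def by (simp add: continuous_on_eq_continuous_at)
  have le: "\<bar>A u v x - A v u x\<bar> \<le> 2 * \<epsilon>" if "0 < \<epsilon>" for \<epsilon>
  proof -
    obtain d1 where d1: "d1 > 0" "\<And>y. dist y x < d1 \<Longrightarrow> dist (A u v y) (A u v x) < \<epsilon>"
      using cont[of u v, unfolded continuous_at_eps_delta, rule_format, OF \<open>0 < \<epsilon>\<close>] by metis
    obtain d2 where d2: "d2 > 0" "\<And>y. dist y x < d2 \<Longrightarrow> dist (A v u y) (A v u x) < \<epsilon>"
      using cont[of v u, unfolded continuous_at_eps_delta, rule_format, OF \<open>0 < \<epsilon>\<close>] by metis
    obtain d3 where d3: "d3 > 0" "ball x d3 \<subseteq> S"
      using assms(1,3) open_contains_ball by blast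
    define d where "d = min d1 (min d2 d3)"
    \<comment> \<open>The summand 1 keeps \<open>N\<close> positive when both vectors vanish. With
      \<open>t = d / (2 * N)\<close> all points of the parallelogram are within
      \<open>t * N = d / 2\<close> of \<open>x\<close>.\<close>
    define N where "N = norm u + norm v + 1"
    define t where "t = d / (2 * N)"
    have N: "N > 0" by (simp add: N_def add_nonneg_pos)
    have d: "d > 0" using d1 d2 d3 by (simp add: d_def)
    have t: "t > 0" using N d by (simp add: t_def)
    have near: "dist (x + r *\<^sub>R a + s *\<^sub>R b) x < d"
      if "0 \<le> r" "r \<le> t" "0 \<le> s" "s \<le> t" "norm a + norm b + 1 = N" for r s a b
    proof -
      have "norm (r *\<^sub>R a + s *\<^sub>R b) \<le> r * norm a + s * norm b"
        using norm_triangle_ineq[of "r *\<^sub>R a" "s *\<^sub>R b"] that by simp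
      also have "\<dots> \<le> t * norm a + t * norm b"
        using that by (intro add_mono mult_right_mono) auto
      also have "\<dots> \<le> t * N" using t that(5)[symmetric] by (simp add: algebra_simps)
      also have "\<dots> < d" using N d by (simp add: t_def)
      finally show ?thesis by (simp add: dist_norm algebra_simps)
    qed
    have inS: "x + r *\<^sub>R a + s *\<^sub>R b \<in> S"
      if "0 \<le> r" "r \<le> t" "0 \<le> s" "s \<le> t" "norm a + norm b + 1 = N" for r s a b
    proof -
      have "x + r *\<^sub>R a + s *\<^sub>R b \<in> ball x d3" using near[OF that] by (simp add: d_def dist_commute)
      then show ?thesis using d3 by blast
    qed
    have uv: "norm u + norm v + 1 = N" and vu: "norm v + norm u + 1 = N" by (simp_all add: N_def)
    obtain r1 s1 where 1: "0 \<le> r1" "r1 \<le> t" "0 \<le> s1" "s1 \<le> t"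
      "\<phi> (x + t *\<^sub>R u + t *\<^sub>R v) - \<phi> (x + t *\<^sub>R u) - \<phi> (x + t *\<^sub>R v) + \<phi> x
        = t * t * A u v (x + r1 *\<^sub>R u + s1 *\<^sub>R v)"
      using second_difference_mvt[OF assms(2) t, of x u v] inS[OF _ _ _ _ uv] unfolding A_def
      by blast
    obtain r2 s2 where 2: "0 \<le> r2" "r2 \<le> t" "0 \<le> s2" "s2 \<le> t"
      "\<phi> (x + t *\<^sub>R v + t *\<^sub>R u) - \<phi> (x + t *\<^sub>R v) - \<phi> (x + t *\<^sub>R u) + \<phi> x
        = t * t * A v u (x + r2 *\<^sub>R v + s2 *\<^sub>R u)"
      using second_difference_mvt[OF assms(2) t, of x v u] inS[OF _ _ _ _ vu] unfolding A_def
      by blast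
    have c: "x + t *\<^sub>R v + t *\<^sub>R u = x + t *\<^sub>R u + t *\<^sub>R v" by (simp add: algebra_simps)
    have "t * t * A u v (x + r1 *\<^sub>R u + s1 *\<^sub>R v) = t * t * A v u (x + r2 *\<^sub>R v + s2 *\<^sub>R u)"
      using 1(5) 2(5)[unfolded c] by linarith
    then have "A u v (x + r1 *\<^sub>R u + s1 *\<^sub>R v) = A v u (x + r2 *\<^sub>R v + s2 *\<^sub>R u)" using t by simp
    moreover have "dist (A u v (x + r1 *\<^sub>R u + s1 *\<^sub>R v)) (A u v x) < \<epsilon>"
      by (rule d1(2)) (use near[OF 1(1-4) uv] in \<open>simp add: d_def\<close>)
    moreover have "dist (A v u (x + r2 *\<^sub>R v + s2 *\<^sub>R u)) (A v u x) < \<epsilon>"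
      by (rule d2(2)) (use near[OF 2(1-4) vu] in \<open>simp add: d_def\<close>)
    ultimately show ?thesis unfolding dist_real_def by linarith
  qed
  \<comment> \<open>A nonzero difference would be at most two thirds of itself.\<close>
  have "A u v x = A v u x" using le[of "\<bar>A u v x - A v u x\<bar> / 3"] by fastforce
  then show ?thesis unfolding A_def .
qed

text \<open>Taking the inner product with an arbitrary vector \<open>w\<close> reduces the claim to
  scalar functions.\<close>

lemma second_derivative_symmetric:
  fixes F :: "'a::real_normed_vector \<Rightarrow> 'b::real_inner"
  assumes "open S" "smooth_on S F" "x \<in> S"
  shows "frechet_derivative (\<lambda>y. frechet_derivative F (at y) u) (at x) v =
         frechet_derivative (\<lambda>y. frechet_derivative F (at y) v) (at x) u"
proof -
  have "frechet_derivative (\<lambda>y. frechet_derivative F (at y) u) (at x) v \<bullet> w =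
        frechet_derivative (\<lambda>y. frechet_derivative F (at y) v) (at x) u \<bullet> w" for w
  proof -
    let ?\<phi> = "\<lambda>y. F y \<bullet> w"
    have s: "smooth_on S ?\<phi>"
      by (rule smooth_on_bounded_linear[OF assms(1) bounded_linear_inner_left assms(2)])
    have 1: "frechet_derivative ?\<phi> (at y) = (\<lambda>u. frechet_derivative F (at y) u \<bullet> w)" if "y \<in> S" for y
      by (intro frechet_derivative_eqI has_derivative_inner_left smooth_on_has_derivative[OF assms(2) that])
    have 2: "frechet_derivative (\<lambda>y. frechet_derivative ?\<phi> (at y) u) (at x) v =
          frechet_derivative (\<lambda>y. frechet_derivative F (at y) u) (at x) v \<bullet> w" for u v
    proof -
      have "((\<lambda>y. frechet_derivative F (at y) u \<bullet> w) has_derivative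
          (\<lambda>v. frechet_derivative (\<lambda>y. frechet_derivative F (at y) u) (at x) v \<bullet> w)) (at x)"
        by (intro has_derivative_inner_left
            smooth_on_has_derivative[OF smooth_on_frechet_derivative[OF assms(2)] assms(3)])
      then have "((\<lambda>y. frechet_derivative ?\<phi> (at y) u) has_derivative
          (\<lambda>v. frechet_derivative (\<lambda>y. frechet_derivative F (at y) u) (at x) v \<bullet> w)) (at x)"
        by (rule has_derivative_transform_within_open[OF _ assms(1,3)]) (simp add: 1)
      then show ?thesis by (simp add: frechet_derivative_eqI)
    qed
    show ?thesis using second_derivative_symmetric_real[OF assms(1) s assms(3), of u v] 2 by simp
  qed
  then show ?thesis by (metis vector_eq_rdot)
qed


section \<open>Maximal isotropic subspaces\<close>

text \<open>Frames are indexed families here. Summation over indices, rather than over the set of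
  values, makes sense at points where the family has repetitions.\<close>

lemma span_image_finite:
  assumes "finite I"
  shows "x \<in> span (g ` I) \<longleftrightarrow> (\<exists>c. x = (\<Sum>i\<in>I. c i *\<^sub>R g i))"
proof
  assume "x \<in> span (g ` I)"
  then show "\<exists>c. x = (\<Sum>i\<in>I. c i *\<^sub>R g i)"
  proof (induction rule: span_induct_alt)
    case base
    show ?case by (rule exI[of _ "\<lambda>i. 0"]) simp
  next
    case (step a b y)
    then obtain c k where c: "y = (\<Sum>i\<in>I. c i *\<^sub>R g i)" and k: "k \<in> I" "b = g k" by auto
    have "(\<Sum>i\<in>I. (c i + (if i = k then a else 0)) *\<^sub>R g i)
        = (\<Sum>i\<in>I. c i *\<^sub>R g i) + (\<Sum>i\<in>I. if i = k then a *\<^sub>R g i else 0)"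
      unfolding sum.distrib[symmetric] by (rule sum.cong) (auto simp: algebra_simps)
    also have "\<dots> = a *\<^sub>R b + y" using c k assms by simp
    finally show ?case by metis
  qed
next
  assume "\<exists>c. x = (\<Sum>i\<in>I. c i *\<^sub>R g i)"
  then obtain c where c: "x = (\<Sum>i\<in>I. c i *\<^sub>R g i)" ..
  show "x \<in> span (g ` I)" unfolding c by (intro span_sum span_scale span_base imageI)
qed

lemma independent_image:
  assumes "finite I" and z: "\<And>c. (\<Sum>i\<in>I. c i *\<^sub>R v i) = 0 \<Longrightarrow> \<forall>i\<in>I. c i = (0::real)"
  shows "inj_on v I" "independent (v ` I)"
proof -
  show inj: "inj_on v I"
  proof (rule inj_onI, rule ccontr)
    fix i j assume ij: "i \<in> I" "j \<in> I" "v i = v j" "i \<noteq> j"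
    let ?c = "\<lambda>k. (if k = i then 1 else 0) - (if k = j then 1 else 0) :: real"
    have "(\<Sum>k\<in>I. ?c k *\<^sub>R v k) = (\<Sum>k\<in>I. if k = i then v k else 0) - (\<Sum>k\<in>I. if k = j then v k else 0)"
      unfolding sum_subtractf[symmetric] by (rule sum.cong) auto
    also have "\<dots> = 0" using ij assms(1) by simp
    finally have "\<forall>k\<in>I. ?c k = 0" by (rule z)
    then show False using ij by fastforce
  qed
  show "independent (v ` I)"
  proof (rule independent_if_scalars_zero)
    fix u x assume s: "(\<Sum>x\<in>v ` I. u x *\<^sub>R x) = 0" and x: "x \<in> v ` I"
    have "(\<Sum>i\<in>I. u (v i) *\<^sub>R v i) = 0" using s sum.reindex[OF inj, of "\<lambda>x. u x *\<^sub>R x"] by (simp add: o_def)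
    from z[OF this] x show "u x = 0" by blast
  qed (simp add: assms(1))
qed

text \<open>Used in place of dimension counts: to show that \<open>x\<close> lies in
  \<open>R\<close>, or that \<open>R\<close> is everything, the residual \<open>r\<close> is shown
  to vanish.\<close>

lemma orthogonal_residual:
  assumes "subspace (R::'a::fd_euclidean set)"
  obtains r where "x - r \<in> R" "\<And>y. y \<in> R \<Longrightarrow> y \<bullet> r = 0"
proof -
  obtain E where E: "finite E" "orthonormal E" "span E = R" "E \<subseteq> R"
    using subspace_orthonormal_basis[OF assms] .
  define r where "r = x - (\<Sum>e\<in>E. (x \<bullet> e) *\<^sub>R e)"
  have "(\<Sum>e\<in>E. (x \<bullet> e) *\<^sub>R e) \<in> span E" by (intro span_sum span_scale span_base)
  then have "x - r \<in> R" using E(3) by (simp add: r_def)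
  moreover have "y \<bullet> r = 0" if "y \<in> R" for y
  proof -
    have "y = (\<Sum>e\<in>E. (y \<bullet> e) *\<^sub>R e)" by (rule orthonormal_expansion) (use E that in auto)
    from arg_cong[OF this, of "\<lambda>v. v \<bullet> x"] have "y \<bullet> x = (\<Sum>e\<in>E. (y \<bullet> e) * (e \<bullet> x))"
      by (simp add: inner_sum_left)
    also have "\<dots> = (\<Sum>e\<in>E. (x \<bullet> e) * (y \<bullet> e))" by (rule sum.cong) (simp_all add: inner_commute)
    finally show ?thesis by (simp add: r_def inner_diff_right inner_sum_right)
  qed
  ultimately show ?thesis using that by blast
qed

definition riesz :: "('a::fd_euclidean \<Rightarrow>\<^sub>L real) \<Rightarrow> 'a" where
  "riesz \<xi> = (\<Sum>e\<in>onb. blinfun_apply \<xi> e *\<^sub>R e)"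

lemma inner_riesz: "v \<bullet> riesz \<xi> = blinfun_apply \<xi> v"
  using linear_onb_expansion[OF bounded_linear.linear[OF blinfun.bounded_linear_right[of \<xi>]], of v]
  by (simp add: riesz_def inner_sum_right mult.commute)

lemma bounded_linear_riesz: "bounded_linear riesz"
  unfolding riesz_def
  by (intro bounded_linear_sum bounded_linear_compose[OF bounded_linear_scaleR_left] bounded_linear_intros
        blinfun.bounded_linear_left)

section \<open>The canonical pairing and self-orthogonality of maximal isotropic subspaces\<close>

lemma bounded_bilinear_pairing: "bounded_bilinear (pairing :: 'e::real_normed_vector gtangent \<Rightarrow> _)"
proof
  fix a a' b b' :: "'e gtangent" and r :: real
  show "pairing (a + a') b = pairing a b + pairing a' b"
    and "pairing a (b + b') = pairing a b + pairing a b'"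
    and "pairing (r *\<^sub>R a) b = r *\<^sub>R pairing a b"
    and "pairing a (r *\<^sub>R b) = r *\<^sub>R pairing a b"
    by (simp_all add: pairing_def blinfun.bilinear_simps algebra_simps)
next
  have "norm (pairing a b) \<le> norm a * norm b * 2" for a b :: "'e gtangent"
  proof -
    have 1: "norm (blinfun_apply (snd a) (fst b)) \<le> norm a * norm b" for a b :: "'e gtangent"
      by (rule order_trans[OF norm_blinfun])
         (auto intro!: mult_mono norm_snd_le[of "snd a" "fst a", simplified] norm_fst_le[of "fst b" "snd b", simplified])
    show ?thesis
      using norm_triangle_ineq[of "blinfun_apply (snd a) (fst b)" "blinfun_apply (snd b) (fst a)"]
        1[of a b] 1[of b a] by (simp add: pairing_def mult.commute)
  qed
  then show "\<exists>K. \<forall>a b :: 'e gtangent. norm (pairing a b) \<le> norm a * norm b * K" by blast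
qed

interpretation pairing: bounded_bilinear pairing
  by (rule bounded_bilinear_pairing)

lemma pairing_commute: "pairing a b = pairing b a"
  by (simp add: pairing_def)

lemma pairing_self: "pairing a a = 2 * blinfun_apply (snd a) (fst a)"
  by (simp add: pairing_def)

lemma isotropicD:
  assumes "isotropic V"
  shows isotropic_subspace: "subspace V"
    and isotropic_pairing: "a \<in> V \<Longrightarrow> b \<in> V \<Longrightarrow> pairing a b = 0"
  using assms by (auto simp: isotropic_def)

lemma maximal_isotropicD: "maximal_isotropic V \<Longrightarrow> isotropic V"
  by (simp add: maximal_isotropic_def)

text \<open>Under these conditions the subspace generated by \<open>V\<close> and \<open>a\<close>
  is still isotropic, so maximality forces it to equal \<open>V\<close>.\<close>

lemma maximal_isotropic_memI:
  assumes "maximal_isotropic V" "\<And>b. b \<in> V \<Longrightarrow> pairing a b = 0" "pairing a a = 0"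
  shows "a \<in> V"
proof -
  let ?W = "{t *\<^sub>R a + b | t b. b \<in> V}"
  have V: "isotropic V" using assms(1) by (rule maximal_isotropicD)
  note sV = isotropic_subspace[OF V]
  have "subspace ?W"
  proof (rule subspaceI)
    have "0 = 0 *\<^sub>R a + 0" by simp
    with subspace_0[OF sV] show "0 \<in> ?W" by blast
  next
    fix x y assume "x \<in> ?W" "y \<in> ?W"
    then obtain t b t' b' where "x = t *\<^sub>R a + b" "y = t' *\<^sub>R a + b'" "b \<in> V" "b' \<in> V" by blast
    then have "x + y = (t + t') *\<^sub>R a + (b + b')" "b + b' \<in> V"
      using subspace_add[OF sV] by (auto simp: algebra_simps)
    then show "x + y \<in> ?W" by blast
  next
    fix c x assume "x \<in> ?W"
    then obtain t b where "x = t *\<^sub>R a + b" "b \<in> V" by blast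
    then have "c *\<^sub>R x = (c * t) *\<^sub>R a + c *\<^sub>R b" "c *\<^sub>R b \<in> V"
      using subspace_scale[OF sV] by (auto simp: algebra_simps)
    then show "c *\<^sub>R x \<in> ?W" by blast
  qed
  moreover have "pairing x y = 0" if "x \<in> ?W" "y \<in> ?W" for x y
  proof -
    obtain t b t' b' where xy: "x = t *\<^sub>R a + b" "y = t' *\<^sub>R a + b'" and b: "b \<in> V" "b' \<in> V"
      using \<open>x \<in> ?W\<close> \<open>y \<in> ?W\<close> by blast
    have "pairing b a = 0" using assms(2)[OF b(1)] pairing_commute[of a b] by simp
    then show ?thesis
      using assms(2)[OF b(2)] assms(3) isotropic_pairing[OF V b]
      by (simp add: xy pairing.add_left pairing.add_right pairing.scaleR_left pairing.scaleR_right)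
  qed
  ultimately have "isotropic ?W" by (auto simp: isotropic_def)
  moreover have "V \<subseteq> ?W"
  proof
    fix b assume "b \<in> V"
    moreover have "b = 0 *\<^sub>R a + b" by simp
    ultimately show "b \<in> ?W" by blast
  qed
  ultimately have "?W = V" using assms(1) by (auto simp: maximal_isotropic_def)
  moreover have "a \<in> ?W"
  proof -
    have "a = 1 *\<^sub>R a + 0" by simp
    with subspace_0[OF sV] show ?thesis by blast
  qed
  ultimately show ?thesis by simp
qed

text \<open>Here \<open>pairing a a = 0\<close> is not assumed, so \<open>a\<close> cannot be
  adjoined directly. But \<open>V\<close> contains \<open>(0, \<alpha>)\<close> for every
  \<open>\<alpha>\<close> annihilating the projection of \<open>V\<close>, and orthogonality to
  these puts \<open>fst a\<close> into that projection. Subtracting from \<open>a\<close> an element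
  of \<open>V\<close> with the same vector part leaves a covector that annihilates the
  projection.\<close>

lemma maximal_isotropic_perp:
  fixes V :: "'e::fd_euclidean gtangent set"
  assumes "maximal_isotropic V" "\<And>b. b \<in> V \<Longrightarrow> pairing a b = 0"
  shows "a \<in> V"
proof -
  have V: "isotropic V" using assms(1) by (rule maximal_isotropicD)
  note sV = isotropic_subspace[OF V]
  have ann: "(0, \<alpha>) \<in> V" if "\<And>b. b \<in> V \<Longrightarrow> blinfun_apply \<alpha> (fst b) = 0" for \<alpha>
    by (rule maximal_isotropic_memI[OF assms(1)]) (simp_all add: pairing_def that blinfun.zero_right)
  have sR: "subspace (fst ` V)"
    by (rule linear_subspace_image[OF bounded_linear.linear[OF bounded_linear_fst] sV])
  obtain r where r: "fst a - r \<in> fst ` V" "\<And>y. y \<in> fst ` V \<Longrightarrow> y \<bullet> r = 0"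
    using orthogonal_residual[OF sR] by blast
  have "(0, blinfun_inner_left r) \<in> V"
    by (rule ann) (simp add: blinfun_inner_left.rep_eq r(2))
  from assms(2)[OF this] have "fst a \<bullet> r = 0" by (simp add: pairing_def blinfun_inner_left.rep_eq inner_commute blinfun.zero_right)
  with r(2)[OF r(1)] have "r = 0" by (simp add: inner_diff_left)
  with r(1) obtain b where b: "b \<in> V" "fst b = fst a" by auto
  have "(0, snd a - snd b) \<in> V"
  proof (rule ann)
    fix c assume "c \<in> V"
    then show "blinfun_apply (snd a - snd b) (fst c) = 0"
      using assms(2)[of c] isotropic_pairing[OF V b(1), of c] b(2)
      by (simp add: pairing_def blinfun.diff_left)
  qed
  then have "b + (0, snd a - snd b) \<in> V" by (rule subspace_add[OF sV b(1)])
  moreover have "b + (0, snd a - snd b) = a" by (rule prod_eqI) (simp_all add: b)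
  ultimately show ?thesis by simp
qed

lemma maximal_isotropicI:
  assumes "isotropic V" "\<And>a. (\<And>b. b \<in> V \<Longrightarrow> pairing a b = 0) \<Longrightarrow> a \<in> V"
  shows "maximal_isotropic V"
  unfolding maximal_isotropic_def
proof (intro conjI allI impI assms(1))
  fix W assume W: "isotropic W \<and> V \<subseteq> W"
  have "W \<subseteq> V"
    by (rule subsetI, rule assms(2)) (use W isotropic_pairing in blast)
  with W show "W = V" by blast
qed

text \<open>The metric identifies every maximal isotropic subspace of \<open>V \<oplus> V\<^sup>*\<close> with \<open>V\<close>, by
  \<open>(v, \<xi>) \<mapsto> v + \<xi>\<^sup>\<sharp>\<close>. This replaces dimension counts.\<close>

definition gvec :: "'e::fd_euclidean gtangent \<Rightarrow> 'e" where
  "gvec a = fst a + riesz (snd a)"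

lemma bounded_linear_gvec: "bounded_linear gvec"
  unfolding gvec_def
  by (intro bounded_linear_add bounded_linear_compose[OF bounded_linear_riesz] bounded_linear_fst bounded_linear_snd)

lemmas linear_gvec = bounded_linear.linear[OF bounded_linear_gvec]

text \<open>Isotropy makes the vector part of \<open>a\<close> orthogonal to the dual vector of its
  covector part, so the square of the norm of \<open>gvec a\<close> is the sum of the squares of
  both.\<close>

lemma gvec_inj:
  assumes "isotropic V" "a \<in> V" "gvec a = 0"
  shows "a = 0"
proof -
  have "fst a \<bullet> riesz (snd a) = 0"
    using isotropic_pairing[OF assms(1,2,2)] by (simp add: pairing_self inner_riesz)
  then have "gvec a \<bullet> gvec a = fst a \<bullet> fst a + riesz (snd a) \<bullet> riesz (snd a)"
    by (simp add: gvec_def inner_add inner_commute)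
  then have "fst a \<bullet> fst a + riesz (snd a) \<bullet> riesz (snd a) = 0" using assms(3) by simp
  then have "fst a = 0" "riesz (snd a) = 0"
    using inner_ge_zero[of "fst a"] inner_ge_zero[of "riesz (snd a)"]
    by (auto simp: add_nonneg_eq_0_iff)
  moreover have "snd a = 0"
    by (rule blinfun_eqI) (metis \<open>riesz (snd a) = 0\<close> inner_riesz inner_zero_right zero_blinfun.rep_eq)
  ultimately show ?thesis by (simp add: prod_eq_iff)
qed

lemma gvec_inj_on:
  assumes "isotropic V" "a \<in> V" "b \<in> V" "gvec a = gvec b"
  shows "a = b"
  using gvec_inj[OF assms(1) subspace_diff[OF isotropic_subspace[OF assms(1)] assms(2,3)]] assms(4)
  by (simp add: linear_diff[OF linear_gvec])

text \<open>If \<open>r\<close> is orthogonal to the image, then \<open>r\<close> together with the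
  covector dual to it is orthogonal to \<open>V\<close> and hence belongs to \<open>V\<close>. Its
  pairing with itself is twice the squared norm of \<open>r\<close>, so \<open>r\<close>
  vanishes.\<close>

lemma gvec_surj:
  assumes "maximal_isotropic V"
  shows "\<exists>a\<in>V. gvec a = w"
proof -
  note sV = isotropic_subspace[OF maximal_isotropicD[OF assms]]
  have sR: "subspace (gvec ` V)"
    by (rule linear_subspace_image[OF bounded_linear.linear[OF bounded_linear_gvec] sV])
  obtain r where r: "w - r \<in> gvec ` V" "\<And>y. y \<in> gvec ` V \<Longrightarrow> y \<bullet> r = 0"
    using orthogonal_residual[OF sR] by blast
  have rV: "(r, blinfun_inner_left r) \<in> V"
  proof (rule maximal_isotropic_perp[OF assms])
    fix b assume "b \<in> V"
    then have "gvec b \<bullet> r = 0" using r(2) by blast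
    moreover have "gvec b \<bullet> r = fst b \<bullet> r + blinfun_apply (snd b) r"
      unfolding gvec_def inner_add_left inner_riesz[of r, symmetric] by (simp add: inner_commute)
    ultimately show "pairing (r, blinfun_inner_left r) b = 0"
      by (simp add: pairing_def blinfun_inner_left.rep_eq)
  qed
  have "r = 0"
    using isotropic_pairing[OF maximal_isotropicD[OF assms] rV rV]
    by (simp add: pairing_self blinfun_inner_left.rep_eq)
  with r(1) show ?thesis by auto
qed

text \<open>The fibre of \<open>dirac_pullback\<close> for an abstract linear map, so that the same
  linear algebra serves the tangent maps and the derivatives of their chart representatives.\<close>

definition pull :: "('u \<Rightarrow>\<^sub>L 'e) \<Rightarrow> 'e::real_normed_vector gtangent set \<Rightarrow> 'u::real_normed_vector gtangent set" where
  "pull T V = {(X, \<eta> o\<^sub>L T) | X \<eta>. (blinfun_apply T X, \<eta>) \<in> V}"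

lemma pullI: "(blinfun_apply T X, \<eta>) \<in> V \<Longrightarrow> (X, \<eta> o\<^sub>L T) \<in> pull T V"
  by (auto simp: pull_def)

text \<open>A linear relation in which neither argument determines the other: \<open>t\<close> may
  change by the kernel of \<open>T\<close> in its vector part, and \<open>a\<close> by the
  annihilator of the range of \<open>T\<close> in its covector part.\<close>

definition relates :: "('u \<Rightarrow>\<^sub>L 'e) \<Rightarrow> 'e::real_normed_vector gtangent \<Rightarrow> 'u::real_normed_vector gtangent \<Rightarrow> bool" where
  "relates T a t \<longleftrightarrow> fst a = T (fst t) \<and> snd t = snd a o\<^sub>L T"

lemma pull_iff: "t \<in> pull T V \<longleftrightarrow> (\<exists>a\<in>V. relates T a t)"
proof
  assume "t \<in> pull T V"
  then obtain X \<eta> where t: "t = (X, \<eta> o\<^sub>L T)" "(T X, \<eta>) \<in> V" unfolding pull_def by blast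
  then have "relates T (T X, \<eta>) t" by (simp add: relates_def)
  with t(2) show "\<exists>a\<in>V. relates T a t" ..
next
  assume "\<exists>a\<in>V. relates T a t"
  then obtain a where a: "a \<in> V" "relates T a t" ..
  then have "(T (fst t), snd a) \<in> V" by (metis prod.collapse relates_def)
  from pullI[OF this] show "t \<in> pull T V" using a(2) by (metis prod.collapse relates_def)
qed

lemma relates_compose: "relates T a t \<Longrightarrow> relates S b a \<Longrightarrow> relates (S o\<^sub>L T) b t"
  by (auto simp: relates_def intro: blinfun_eqI)

lemma isotropic_pull:
  assumes "isotropic V"
  shows "isotropic (pull T V)"
  unfolding isotropic_def
proof (intro conjI ballI subspaceI)
  note sV = isotropic_subspace[OF assms]
  show "0 \<in> pull T V"
    using pullI[of T 0 0 V] subspace_0[OF sV] by (simp add: blinfun.zero_right zero_prod_def)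
  fix x y assume "x \<in> pull T V" "y \<in> pull T V"
  then obtain X \<eta> Y \<zeta> where x: "x = (X, \<eta> o\<^sub>L T)" "(T X, \<eta>) \<in> V" and y: "y = (Y, \<zeta> o\<^sub>L T)" "(T Y, \<zeta>) \<in> V"
    unfolding pull_def by blast
  show "x + y \<in> pull T V"
    using pullI[of T "X + Y" "\<eta> + \<zeta>" V] subspace_add[OF sV x(2) y(2)] x(1) y(1)
    by (simp add: blinfun.add_right bounded_bilinear.add_left[OF bounded_bilinear_blinfun_compose])
  show "pairing x y = 0"
    using isotropic_pairing[OF assms x(2) y(2)] x(1) y(1) by (simp add: pairing_def)
next
  note sV = isotropic_subspace[OF assms]
  fix c :: real and x assume "x \<in> pull T V"
  then obtain X \<eta> where x: "x = (X, \<eta> o\<^sub>L T)" "(T X, \<eta>) \<in> V"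
    unfolding pull_def by blast
  show "c *\<^sub>R x \<in> pull T V"
    using pullI[of T "c *\<^sub>R X" "c *\<^sub>R \<eta>" V] subspace_scale[OF sV x(2)] x(1)
    by (simp add: blinfun.scaleR_right bounded_bilinear.scaleR_left[OF bounded_bilinear_blinfun_compose])
qed

text \<open>Let \<open>P\<close> be the orthogonal projection along \<open>R\<close> and
  \<open>T'\<close> its composite with \<open>T\<close>. The kernel of \<open>T'\<close> consists of
  the vectors that \<open>T\<close> maps into \<open>R\<close>, and \<open>\<mu>\<close> vanishes
  there, so \<open>\<mu>\<close> factors through \<open>T'\<close>. A linear right inverse
  \<open>g\<close> on the range of \<open>T'\<close> supplies the factor; composing it with
  \<open>P\<close> makes it vanish on \<open>R\<close>.\<close>

lemma extend_functional:
  fixes T :: "'u::fd_euclidean \<Rightarrow>\<^sub>L 'e::fd_euclidean"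
  assumes "subspace R" "\<And>x. blinfun_apply T x \<in> R \<Longrightarrow> blinfun_apply \<mu> x = 0"
  shows "\<exists>\<alpha>. (\<forall>r\<in>R. blinfun_apply \<alpha> r = 0) \<and> \<alpha> o\<^sub>L T = (\<mu> :: 'u \<Rightarrow>\<^sub>L real)"
proof -
  obtain E where E: "finite E" "orthonormal E" "span E = R" "E \<subseteq> R"
    using subspace_orthonormal_basis[OF assms(1)] .
  define P where "P = (\<lambda>x. x - (\<Sum>e\<in>E. (x \<bullet> e) *\<^sub>R e))"
  have blP: "bounded_linear P"
    unfolding P_def
    by (intro bounded_linear_sub bounded_linear_ident bounded_linear_sum
          bounded_linear_compose[OF bounded_linear_scaleR_left] bounded_linear_inner_left)
  have PR: "P r = 0" if "r \<in> R" for r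
    using orthonormal_expansion[OF E(1,2), of r] E(3) that by (simp add: P_def)
  have RP: "x \<in> R" if "P x = 0" for x
  proof -
    have "x = (\<Sum>e\<in>E. (x \<bullet> e) *\<^sub>R e)" using that by (simp add: P_def)
    moreover have "(\<Sum>e\<in>E. (x \<bullet> e) *\<^sub>R e) \<in> span E" by (intro span_sum span_scale span_base)
    ultimately show ?thesis using E(3) by simp
  qed
  define T' where "T' = (\<lambda>x. P (T x))"
  have blT': "bounded_linear T'"
    unfolding T'_def by (rule bounded_linear_compose[OF blP blinfun.bounded_linear_right])
  obtain g where g: "linear g" "\<And>v. v \<in> range T' \<Longrightarrow> T' (g v) = v"
    using linear_exists_right_inverse_on[OF bounded_linear.linear[OF blT'] subspace_UNIV] by blast
  have blg: "bounded_linear g" by (rule linear_imp_bounded_linear[OF g(1)])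
  have bl: "bounded_linear (\<lambda>x. \<mu> (g (P x)))"
    by (intro bounded_linear_compose[OF blinfun.bounded_linear_right] bounded_linear_compose[OF blg] blP)
  let ?\<alpha> = "Blinfun (\<lambda>x. \<mu> (g (P x)))"
  note ap = bounded_linear_Blinfun_apply[OF bl]
  have "?\<alpha> o\<^sub>L T = \<mu>"
  proof (rule blinfun_eqI)
    fix x
    have "T' (g (T' x) - x) = 0" using g(2)[of "T' x"] by (simp add: linear_diff[OF bounded_linear.linear[OF blT']])
    then have "T (g (T' x) - x) \<in> R" unfolding T'_def by (rule RP)
    from assms(2)[OF this] show "blinfun_apply (?\<alpha> o\<^sub>L T) x = \<mu> x"
      by (simp add: ap T'_def blinfun.diff_right)
  qed
  moreover have "blinfun_apply ?\<alpha> r = 0" if "r \<in> R" for r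
    using PR[OF that] by (simp add: ap linear_0[OF g(1)] blinfun.zero_right)
  ultimately show ?thesis by blast
qed

text \<open>Let \<open>(X, \<xi>)\<close> be orthogonal to the pullback. Testing it against
  covectors annihilating the projection of \<open>V\<close> shows that \<open>T X\<close> lies in
  this projection, so \<open>(T X, \<zeta>)\<close> is in \<open>V\<close> for some
  \<open>\<zeta>\<close>. Then \<open>\<xi>\<close> minus the pullback of \<open>\<zeta>\<close>
  vanishes wherever \<open>T\<close> lands in the projection; it is thus the pullback of some
  \<open>\<alpha>\<close> annihilating the projection, by which \<open>\<zeta>\<close> can be
  corrected without leaving \<open>V\<close>.\<close>

lemma maximal_isotropic_pull:
  fixes T :: "'u::fd_euclidean \<Rightarrow>\<^sub>L 'e::fd_euclidean"
  assumes "maximal_isotropic V"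
  shows "maximal_isotropic (pull T V)"
proof (rule maximal_isotropicI)
  have V: "isotropic V" using assms(1) by (rule maximal_isotropicD)
  note sV = isotropic_subspace[OF V]
  show "isotropic (pull T V)" by (rule isotropic_pull[OF V])
  fix a assume a: "\<And>b. b \<in> pull T V \<Longrightarrow> pairing a b = 0"
  obtain X \<xi> where aX: "a = (X, \<xi>)" by (cases a)
  have perp: "\<xi> Y + \<eta> (T X) = 0" if "(T Y, \<eta>) \<in> V" for Y \<eta>
    using a[OF pullI[OF that]] by (simp add: aX pairing_def)
  have sR: "subspace (fst ` V)"
    by (rule linear_subspace_image[OF bounded_linear.linear[OF bounded_linear_fst] sV])
  have ann: "(0, \<alpha>) \<in> V" if "\<And>r. r \<in> fst ` V \<Longrightarrow> blinfun_apply \<alpha> r = 0" for \<alpha>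
    by (rule maximal_isotropic_perp[OF assms(1)]) (simp add: pairing_def that blinfun.zero_right)
  obtain r where r: "T X - r \<in> fst ` V" "\<And>y. y \<in> fst ` V \<Longrightarrow> y \<bullet> r = 0"
    using orthogonal_residual[OF sR] by blast
  have "(0, blinfun_inner_left r) \<in> V"
    by (rule ann) (simp add: blinfun_inner_left.rep_eq r(2))
  then have "T X \<bullet> r = 0"
    using perp[of 0 "blinfun_inner_left r"] by (simp add: blinfun.zero_right blinfun_inner_left.rep_eq inner_commute)
  with r(2)[OF r(1)] have "r = 0" by (simp add: inner_diff_left)
  with r(1) obtain \<zeta> where \<zeta>: "(T X, \<zeta>) \<in> V" by force
  have "blinfun_apply (\<xi> - (\<zeta> o\<^sub>L T)) Y = 0" if TY: "T Y \<in> fst ` V" for Y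
  proof -
    obtain \<eta> where \<eta>: "(T Y, \<eta>) \<in> V" using TY by force
    then show ?thesis using perp[OF \<eta>] isotropic_pairing[OF V \<zeta> \<eta>]
      by (simp add: pairing_def blinfun.diff_left)
  qed
  from extend_functional[OF sR this] obtain \<alpha> where
    \<alpha>: "\<forall>r\<in>fst ` V. blinfun_apply \<alpha> r = 0" "\<alpha> o\<^sub>L T = \<xi> - (\<zeta> o\<^sub>L T)" by blast
  have "(T X, \<zeta>) + (0, \<alpha>) \<in> V" by (rule subspace_add[OF sV \<zeta> ann]) (use \<alpha> in blast)
  then have "(X, (\<zeta> + \<alpha>) o\<^sub>L T) \<in> pull T V" by (intro pullI) simp
  moreover have "(\<zeta> + \<alpha>) o\<^sub>L T = \<xi>"
    using \<alpha>(2) by (simp add: bounded_bilinear.add_left[OF bounded_bilinear_blinfun_compose])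
  ultimately show "a \<in> pull T V" by (simp add: aX)
qed


section \<open>Smooth families of linear algebra data\<close>

text \<open>The neighbourhood shrinks at each step of the induction to the set where the new
  orthogonal component does not vanish. The condition that the dual vectors lie in the span of the
  family serves the induction: it makes the new component orthogonal to the old dual
  vectors.\<close>

lemma smooth_dual_frame_ex:
  fixes s :: "'i \<Rightarrow> 'a::real_normed_vector \<Rightarrow> 'w::real_inner"
  assumes "finite I" "open S" "y0 \<in> S" "\<And>i. i \<in> I \<Longrightarrow> smooth_on S (s i)"
    and "\<And>c. (\<Sum>i\<in>I. c i *\<^sub>R s i y0) = 0 \<Longrightarrow> \<forall>i\<in>I. c i = 0"
  shows "\<exists>T d. open T \<and> y0 \<in> T \<and> T \<subseteq> S \<and> (\<forall>i\<in>I. smooth_on T (d i)) \<and>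
    (\<forall>y\<in>T. \<forall>i\<in>I. d i y \<in> span ((\<lambda>j. s j y) ` I)) \<and>
    (\<forall>y\<in>T. \<forall>i\<in>I. \<forall>j\<in>I. d i y \<bullet> s j y = (if i = j then 1 else 0))"
  using assms(1,4,5)
proof (induction I rule: finite_induct)
  case empty
  show ?case by (rule exI[of _ S]) (use assms(2,3) in auto)
next
  case (insert a I)
  have indI: "\<forall>i\<in>I. c i = 0" if c: "(\<Sum>i\<in>I. c i *\<^sub>R s i y0) = 0" for c
  proof -
    have "(\<Sum>i\<in>I. (c(a := 0)) i *\<^sub>R s i y0) = (\<Sum>i\<in>I. c i *\<^sub>R s i y0)"
      by (rule sum.cong) (use insert(2) in auto)
    then have "\<forall>i\<in>insert a I. (c(a := 0)) i = 0"
      using insert.prems(2)[of "c(a := 0)"] c insert(1,2) by simp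
    then show ?thesis using insert(2) by (metis fun_upd_other insertCI)
  qed
  have "\<exists>T d. open T \<and> y0 \<in> T \<and> T \<subseteq> S \<and> (\<forall>i\<in>I. smooth_on T (d i)) \<and>
    (\<forall>y\<in>T. \<forall>i\<in>I. d i y \<in> span ((\<lambda>j. s j y) ` I)) \<and>
    (\<forall>y\<in>T. \<forall>i\<in>I. \<forall>j\<in>I. d i y \<bullet> s j y = (if i = j then 1 else 0))"
    by (rule insert.IH) (use insert.prems(1) indI in auto)
  then obtain T d where *: "open T \<and> y0 \<in> T \<and> T \<subseteq> S \<and> (\<forall>i\<in>I. smooth_on T (d i)) \<and>
    (\<forall>y\<in>T. \<forall>i\<in>I. d i y \<in> span ((\<lambda>j. s j y) ` I)) \<and>
    (\<forall>y\<in>T. \<forall>i\<in>I. \<forall>j\<in>I. d i y \<bullet> s j y = (if i = j then 1 else 0))"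
    by (elim exE) (rule that)
  then have T: "open T" "y0 \<in> T" "T \<subseteq> S" by simp_all
  from * have sd: "smooth_on T (d i)" if "i \<in> I" for i using that by simp
  from * have dspan: "d i y \<in> span ((\<lambda>j. s j y) ` I)" if "y \<in> T" "i \<in> I" for y i
    using that by simp
  from * have dual: "d i y \<bullet> s j y = (if i = j then 1 else 0)" if "y \<in> T" "i \<in> I" "j \<in> I" for y i j
    using that by simp
  \<comment> \<open>Gram-Schmidt: \<open>n\<close> is the component of \<open>s a\<close> orthogonal to the other \<open>s i\<close>.\<close>
  define n where "n = (\<lambda>y. s a y - (\<Sum>i\<in>I. (s i y \<bullet> s a y) *\<^sub>R d i y))"
  have ss: "smooth_on T (s i)" if "i \<in> insert a I" for i
    using insert.prems(1)[OF that] T(3) smooth_on_subset by blast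
  have sn: "smooth_on T n"
    unfolding n_def
    by (intro smooth_on_diff smooth_on_sum smooth_on_scaleR smooth_on_inner ss sd T) auto
  have ns: "n y \<bullet> s j y = 0" if "y \<in> T" "j \<in> I" for y j
  proof -
    have "(\<Sum>i\<in>I. (s i y \<bullet> s a y) *\<^sub>R d i y) \<bullet> s j y = (\<Sum>i\<in>I. if i = j then s i y \<bullet> s a y else 0)"
      unfolding inner_sum_left by (rule sum.cong) (use dual that in auto)
    also have "\<dots> = s j y \<bullet> s a y" using insert(1) that by simp
    finally show ?thesis by (simp add: n_def inner_diff_left inner_commute[of "s a y" "s j y"])
  qed
  have nspan: "n y \<bullet> x = 0" if "y \<in> T" "x \<in> span ((\<lambda>j. s j y) ` I)" for x y
    using that(2)
  proof (induction rule: span_induct_alt)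
    case base then show ?case by simp
  next
    case (step c x z) then show ?case using ns that by (auto simp: inner_add_right)
  qed
  have nn: "n y \<bullet> n y = n y \<bullet> s a y" if "y \<in> T" for y
  proof -
    have "n y \<bullet> n y = n y \<bullet> s a y - n y \<bullet> (\<Sum>i\<in>I. (s i y \<bullet> s a y) *\<^sub>R d i y)"
      by (subst (2) n_def) (simp add: inner_diff_right)
    also have "n y \<bullet> (\<Sum>i\<in>I. (s i y \<bullet> s a y) *\<^sub>R d i y) = 0"
      using that by (intro nspan span_sum span_scale dspan) auto
    finally show ?thesis by simp
  qed
  \<comment> \<open>Otherwise \<open>s a y0\<close> is a combination of the other members, and
    giving it the coefficient -1 produces a nontrivial relation.\<close>
  have "n y0 \<noteq> 0"
  proof
    assume "n y0 = 0"
    then have eq: "s a y0 = (\<Sum>i\<in>I. (s i y0 \<bullet> s a y0) *\<^sub>R d i y0)" by (simp add: n_def)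
    have "(\<Sum>i\<in>I. (s i y0 \<bullet> s a y0) *\<^sub>R d i y0) \<in> span ((\<lambda>j. s j y0) ` I)"
      using T(2) by (intro span_sum span_scale dspan) auto
    from this[folded eq] obtain c where c: "s a y0 = (\<Sum>i\<in>I. c i *\<^sub>R s i y0)"
      unfolding span_image_finite[OF insert(1)] ..
    have "(\<Sum>i\<in>I. (c(a := -1)) i *\<^sub>R s i y0) = (\<Sum>i\<in>I. c i *\<^sub>R s i y0)"
      by (rule sum.cong) (use insert(2) in auto)
    then have "(\<Sum>i\<in>insert a I. (c(a := -1)) i *\<^sub>R s i y0) = 0"
      using c insert(1,2) by simp
    from insert.prems(2)[OF this] show False by simp
  qed
  define T' where "T' = T \<inter> n -` (- {0})"
  have T': "open T'" "y0 \<in> T'" "T' \<subseteq> T"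
    unfolding T'_def using \<open>n y0 \<noteq> 0\<close> T
    by (auto intro!: continuous_open_preimage smooth_on_continuous[OF sn])
  define da where "da = (\<lambda>y. inverse (n y \<bullet> n y) *\<^sub>R n y)"
  \<comment> \<open>Subtracting a multiple of \<open>da\<close> makes an old dual vector orthogonal
    to \<open>s a\<close>. Its products with the other \<open>s j\<close> are unchanged because
    \<open>da\<close> is orthogonal to those.\<close>
  define D where "D = (\<lambda>i y. if i = a then da y else d i y - (d i y \<bullet> s a y) *\<^sub>R da y)"
  have sn': "smooth_on T' n" using smooth_on_subset[OF sn T'(3)] .
  have sda: "smooth_on T' da"
    unfolding da_def
    by (intro smooth_on_scaleR smooth_on_inverse smooth_on_inner sn' T') (auto simp: T'_def)
  have sD: "smooth_on T' (D i)" if "i \<in> insert a I" for i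
  proof (cases "i = a")
    case False
    then have "smooth_on T' (d i)" "smooth_on T' (s a)"
      using that sd ss smooth_on_subset[OF _ T'(3)] by auto
    then show ?thesis using False unfolding D_def
      by (simp add: smooth_on_diff smooth_on_scaleR smooth_on_inner sda T')
  qed (use sda in \<open>simp add: D_def\<close>)
  have das: "da y \<bullet> s j y = (if j = a then 1 else 0)" if "y \<in> T'" "j \<in> insert a I" for y j
  proof (cases "j = a")
    case True
    have "n y \<bullet> s a y \<noteq> 0" using nn[of y] that T'(3) by (auto simp: T'_def)
    then show ?thesis using True nn[of y] that T'(3) by (auto simp: da_def)
  next
    case False
    then show ?thesis using that T'(3) ns[of y j] by (auto simp: da_def)
  qed
  have Dd: "D i y \<bullet> s j y = (if i = j then 1 else 0)" if "y \<in> T'" "i \<in> insert a I" "j \<in> insert a I" for y i j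
    using that das[of y a] das[of y j] dual[of y i j] T'(3) insert(2)
    by (auto simp: D_def inner_diff_left)
  have sub: "span ((\<lambda>j. s j y) ` I) \<subseteq> span ((\<lambda>j. s j y) ` insert a I)" for y
    by (rule span_mono) auto
  have dsp: "d i y \<in> span ((\<lambda>j. s j y) ` insert a I)" if "y \<in> T'" "i \<in> I" for i y
    using dspan[of y i] that T'(3) sub[of y] by blast
  have "n y \<in> span ((\<lambda>j. s j y) ` insert a I)" if "y \<in> T'" for y
    unfolding n_def by (intro span_diff span_sum span_scale dsp that span_base) auto
  then have dasp: "da y \<in> span ((\<lambda>j. s j y) ` insert a I)" if "y \<in> T'" for y
    unfolding da_def using that by (intro span_scale)
  have Dsp: "D i y \<in> span ((\<lambda>j. s j y) ` insert a I)" if "y \<in> T'" "i \<in> insert a I" for i y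
  proof (cases "i = a")
    case True
    then show ?thesis using dasp[OF that(1)] by (simp add: D_def)
  next
    case False
    then have "i \<in> I" using that by simp
    then show ?thesis
      using False span_diff[OF dsp[OF that(1)] span_scale[OF dasp[OF that(1)]]] by (simp add: D_def)
  qed
  show ?case
    by (intro exI[of _ T'] exI[of _ D] conjI ballI T'(1,2) order_trans[OF T'(3) T(3)] sD Dsp Dd) assumption+
qed

lemma smooth_dual_frame:
  fixes s :: "'i \<Rightarrow> 'a::real_normed_vector \<Rightarrow> 'w::real_inner"
  assumes "finite I" "open S" "y0 \<in> S" "\<And>i. i \<in> I \<Longrightarrow> smooth_on S (s i)"
    and "\<And>c. (\<Sum>i\<in>I. c i *\<^sub>R s i y0) = 0 \<Longrightarrow> \<forall>i\<in>I. c i = 0"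
  obtains T d where "open T" "y0 \<in> T" "T \<subseteq> S" "\<And>i. i \<in> I \<Longrightarrow> smooth_on T (d i)"
    and "\<And>y i j. y \<in> T \<Longrightarrow> i \<in> I \<Longrightarrow> j \<in> I \<Longrightarrow> d i y \<bullet> s j y = (if i = j then 1 else 0)"
proof -
  have "\<exists>T d. open T \<and> y0 \<in> T \<and> T \<subseteq> S \<and> (\<forall>i\<in>I. smooth_on T (d i)) \<and>
    (\<forall>y\<in>T. \<forall>i\<in>I. d i y \<in> span ((\<lambda>j. s j y) ` I)) \<and>
    (\<forall>y\<in>T. \<forall>i\<in>I. \<forall>j\<in>I. d i y \<bullet> s j y = (if i = j then 1 else 0))"
    by (rule smooth_dual_frame_ex[OF assms(1,2,3)]) (erule assms(4), erule assms(5))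
  then obtain T d where *: "open T \<and> y0 \<in> T \<and> T \<subseteq> S \<and> (\<forall>i\<in>I. smooth_on T (d i)) \<and>
    (\<forall>y\<in>T. \<forall>i\<in>I. d i y \<in> span ((\<lambda>j. s j y) ` I)) \<and>
    (\<forall>y\<in>T. \<forall>i\<in>I. \<forall>j\<in>I. d i y \<bullet> s j y = (if i = j then 1 else 0))"
    by (elim exE) (rule that)
  show thesis by (rule that[of T d]) (use * in simp_all)
qed

text \<open>For \<open>y\<close> near \<open>y0\<close>, the orthogonal projection of the kernel of \<open>\<Phi> y\<close> to that of \<open>\<Phi> y0\<close> is injective, hence
  bijective as the dimensions agree; the section is the inverse image of \<open>v0\<close>.\<close>

lemma constant_rank_kernel_section:
  fixes \<Phi> :: "'a::real_normed_vector \<Rightarrow> 'v::fd_euclidean \<Rightarrow> 'w::real_inner"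
  assumes "open S" "y0 \<in> S" and lin: "\<And>y. y \<in> S \<Longrightarrow> linear (\<Phi> y)"
    and smooth: "\<And>v. smooth_on S (\<lambda>y. \<Phi> y v)"
    and rank: "\<And>y. y \<in> S \<Longrightarrow> dim {v. \<Phi> y v = 0} = r"
    and v0: "\<Phi> y0 v0 = 0"
  shows "\<exists>T s. open T \<and> y0 \<in> T \<and> T \<subseteq> S \<and> smooth_on T s \<and> s y0 = v0 \<and> (\<forall>y\<in>T. \<Phi> y (s y) = 0)"
proof -
  define K where "K = (\<lambda>y. {v. \<Phi> y v = 0})"
  have sK: "subspace (K y)" if "y \<in> S" for y
    unfolding K_def using linear_subspace_kernel[OF lin[OF that]] .
  obtain B where B: "finite B" "orthonormal B" "span B = K y0" "B \<subseteq> K y0"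
    using subspace_orthonormal_basis[OF sK[OF assms(2)]] .
  define C where "C = {v. \<forall>b\<in>B. v \<bullet> b = 0}"
  have "subspace C" unfolding C_def by (rule subspaceI) (auto simp: inner_add_left)
  then obtain E where E: "finite E" "orthonormal E" "span E = C" "E \<subseteq> C"
    using subspace_orthonormal_basis by metis
  define P where "P = (\<lambda>v. \<Sum>b\<in>B. (v \<bullet> b) *\<^sub>R b)"
  have blP: "bounded_linear P"
    unfolding P_def
    by (intro bounded_linear_sum bounded_linear_compose[OF bounded_linear_scaleR_left] bounded_linear_inner_left)
  note linP = bounded_linear.linear[OF blP]
  have PB: "P v \<in> span B" for v unfolding P_def by (intro span_sum span_scale span_base)
  have decomp: "v = P v + (\<Sum>e\<in>E. (v \<bullet> e) *\<^sub>R e)" for v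
  proof -
    have Pb: "P v \<bullet> b = v \<bullet> b" if "b \<in> B" for b
    proof -
      have "P v \<bullet> b = (\<Sum>b'\<in>B. if b' = b then v \<bullet> b' else 0)"
        unfolding P_def inner_sum_left
        by (rule sum.cong) (use B(2) that in \<open>auto simp: orthonormal_def\<close>)
      then show ?thesis using B(1) that by simp
    qed
    have "v - P v \<in> C" unfolding C_def by (simp add: inner_diff_left Pb)
    then have "v - P v = (\<Sum>e\<in>E. ((v - P v) \<bullet> e) *\<^sub>R e)"
      using orthonormal_expansion[OF E(1,2)] E(3) by blast
    also have "\<dots> = (\<Sum>e\<in>E. (v \<bullet> e) *\<^sub>R e)"
    proof (rule sum.cong[OF refl])
      fix e assume "e \<in> E"
      then have "\<forall>b\<in>B. b \<bullet> e = 0" using E(4) by (auto simp: C_def inner_commute)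
      then have "P v \<bullet> e = 0" by (simp add: P_def inner_sum_left)
      then show "((v - P v) \<bullet> e) *\<^sub>R e = (v \<bullet> e) *\<^sub>R e" by (simp add: inner_diff_left)
    qed
    finally show ?thesis by (simp add: algebra_simps)
  qed
  \<comment> \<open>\<open>\<Phi> y0\<close> is injective on the orthogonal complement
    \<open>C\<close> of its kernel. The images of the basis \<open>E\<close> of \<open>C\<close> are
    therefore independent at \<open>y0\<close> and have a smooth dual family nearby.\<close>
  have indep: "\<forall>e\<in>E. c e = 0" if "(\<Sum>e\<in>E. c e *\<^sub>R \<Phi> y0 e) = 0" for c
  proof -
    let ?w = "\<Sum>e\<in>E. c e *\<^sub>R e"
    have "\<Phi> y0 ?w = 0"
      using that by (simp add: linear_sum[OF lin[OF assms(2)]] linear_scale[OF lin[OF assms(2)]])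
    then have "?w \<in> span B" using B(3) by (simp add: K_def)
    moreover have "?w \<in> C" unfolding E(3)[symmetric] by (intro span_sum span_scale span_base)
    ultimately have "?w \<bullet> ?w = 0"
    proof -
      assume w: "?w \<in> span B" "?w \<in> C"
      have "?w \<bullet> x = 0" if "x \<in> span B" for x
        using that
        by (induction rule: span_induct_alt) (use w(2) in \<open>auto simp: C_def inner_add_right\<close>)
      then show ?thesis using w(1) by blast
    qed
    then have "?w = 0" by simp
    then show ?thesis
      using orthonormal_imp_independent[OF E(2)] E(1) independentD by blast
  qed
  obtain T d where T: "open T" "y0 \<in> T" "T \<subseteq> S" and sd: "\<And>e. e \<in> E \<Longrightarrow> smooth_on T (d e)"
    and dual: "\<And>y e e'. y \<in> T \<Longrightarrow> e \<in> E \<Longrightarrow> e' \<in> E \<Longrightarrow> d e y \<bullet> \<Phi> y e' = (if e = e' then 1 else 0)"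
    by (rule smooth_dual_frame[OF E(1) assms(1,2), of "\<lambda>e y. \<Phi> y e"]) (rule smooth, erule indep, rule that)
  \<comment> \<open>Only the \<open>E\<close>-coordinates of \<open>v0\<close> are altered, so the
    projection to the kernel at \<open>y0\<close> remains \<open>v0\<close>. A vector killed by
    \<open>\<Phi> y\<close> with that projection has no other choice of
    \<open>E\<close>-coordinates, as the dual family shows; that such a vector exists is where the
    constant rank is used.\<close>
  define s where "s = (\<lambda>y. v0 - (\<Sum>e\<in>E. (d e y \<bullet> \<Phi> y v0) *\<^sub>R e))"
  have coef: "w \<bullet> e = d e y \<bullet> \<Phi> y (w - P w)" if "y \<in> T" "e \<in> E" for w y e
  proof -
    have y: "y \<in> S" using that T by blast
    have "d e y \<bullet> \<Phi> y (w - P w) = d e y \<bullet> \<Phi> y (\<Sum>e\<in>E. (w \<bullet> e) *\<^sub>R e)"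
      using decomp[of w] by (metis add_diff_cancel_left')
    also have "\<dots> = (\<Sum>e'\<in>E. if e' = e then w \<bullet> e' else 0)"
      unfolding linear_sum[OF lin[OF y]] linear_scale[OF lin[OF y]] inner_sum_right
      by (rule sum.cong) (use dual that in auto)
    also have "\<dots> = w \<bullet> e" using E(1) that by simp
    finally show ?thesis by simp
  qed
  have "smooth_on T (\<lambda>y. \<Phi> y v0)" using smooth_on_subset[OF smooth T(3)] .
  then have "smooth_on T s"
    unfolding s_def
    by (intro smooth_on_diff smooth_on_sum smooth_on_scaleR smooth_on_inner sd T) auto
  moreover have "s y0 = v0" using v0 by (simp add: s_def)
  moreover have "\<Phi> y (s y) = 0" if y: "y \<in> T" for y
  proof -
    have yS: "y \<in> S" using y T by blast
    have "\<exists>w\<in>K y. P w = v0"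
    proof -
      obtain D where D: "D \<subseteq> K y" "independent D" "K y \<subseteq> span D" "card D = dim (K y)"
        using basis_exists by blast
      have spD: "span D = K y" using D sK[OF yS] by (simp add: span_minimal subset_antisym)
      have finD: "finite D" using independent_span_bound[OF finite_onb D(2)] by simp
      have cardD: "card D = r" using D(4) rank[OF yS] by (simp add: K_def)
      have "dim (K y0) = card B"
        using dim_span_eq_card_independent[OF orthonormal_imp_independent[OF B(2)]] B(3) by simp
      then have cardB: "card B = r" using rank[OF assms(2)] by (simp add: K_def)
      have inj: "inj_on P (span D)"
      proof (rule inj_onI)
        fix v w assume vw: "v \<in> span D" "w \<in> span D" "P v = P w"
        let ?x = "v - w"
        have x: "\<Phi> y ?x = 0" using span_diff[OF vw(1,2)] spD by (simp add: K_def)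
        have Px: "P ?x = 0" using vw(3) by (simp add: linear_diff[OF linP])
        have "?x \<bullet> e = 0" if "e \<in> E" for e using coef[OF y that, of ?x] x Px by simp
        then have "?x = 0" using decomp[of ?x] Px by simp
        then show "v = w" by simp
      qed
      have indPD: "independent (P ` D)" by (rule linear_independent_injective_image[OF linP D(2) inj])
      have cardPD: "card (P ` D) = r"
        using card_image[OF inj_on_subset[OF inj span_superset]] cardD by simp
      have "v0 \<in> span (P ` D)"
      proof (rule ccontr)
        assume n: "v0 \<notin> span (P ` D)"
        have i: "independent (insert v0 (P ` D))" by (rule independent_insertI[OF n indPD])
        have "v0 \<in> span B" using v0 B(3) by (simp add: K_def)
        then have "insert v0 (P ` D) \<subseteq> span B" using PB by blast
        from independent_span_bound[OF B(1) i this] have "card (insert v0 (P ` D)) \<le> r" using cardB by simp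
        moreover have "v0 \<notin> P ` D" using n span_base[of v0 "P ` D"] by blast
        ultimately show False using cardPD finD by simp
      qed
      then show ?thesis unfolding linear_span_image[OF linP] spD by blast
    qed
    then obtain w where w: "\<Phi> y w = 0" "P w = v0" by (auto simp: K_def)
    have "w \<bullet> e = - (d e y \<bullet> \<Phi> y v0)" if "e \<in> E" for e
      using coef[OF y that, of w] w by (simp add: linear_diff[OF lin[OF yS]])
    then have "(\<Sum>e\<in>E. (w \<bullet> e) *\<^sub>R e) = - (\<Sum>e\<in>E. (d e y \<bullet> \<Phi> y v0) *\<^sub>R e)"
      by (simp add: sum_negf)
    then have "w = s y" using decomp[of w] w(2) by (simp add: s_def)
    then show ?thesis using w by simp
  qed
  ultimately show ?thesis using T by blast
qed


section \<open>The Courant bracket in coordinates\<close>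

text \<open>In contrast to \<open>courant_bracket\<close> this refers to no atlas and to no chart
  that depends on the point, so it can be compared across a smooth map.\<close>

definition coord_courant :: "('u \<Rightarrow> 'u gtangent) \<Rightarrow> ('u \<Rightarrow> 'u gtangent) \<Rightarrow> 'u::real_normed_vector \<Rightarrow> 'u gtangent" where
  "coord_courant S T y =
    (fst (Dbl T y (fst (S y))) - fst (Dbl S y (fst (T y))),
     snd (Dbl T y (fst (S y))) + (snd (T y) o\<^sub>L (fst_blinfun o\<^sub>L Dbl S y))
     - Blinfun (\<lambda>v. snd (Dbl S y (fst (T y))) v - snd (Dbl S y v) (fst (T y))))"

lemma bounded_linear_ext_derivative:
  "bounded_linear (\<lambda>v. blinfun_apply (snd (blinfun_apply D w)) v - blinfun_apply (snd (blinfun_apply D v)) w)"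
  for D :: "'u::real_normed_vector \<Rightarrow>\<^sub>L 'u gtangent"
  by (intro bounded_linear_sub blinfun.bounded_linear_right
      bounded_linear_compose[OF blinfun.bounded_linear_left]
      bounded_linear_compose[OF bounded_linear_snd])

text \<open>Paired with a vector, the coordinate expression regroups into derivatives of whole
  sections for the flat connection of the chart. The last term collects the remaining part of the
  Lie derivative and of the exterior derivative.\<close>

lemma pairing_coord_courant:
  "pairing (coord_courant S T y) c = pairing (Dbl T y (fst (S y))) c - pairing (Dbl S y (fst (T y))) c
     + pairing (Dbl S y (fst c)) (T y)"
  by (simp add: pairing_def coord_courant_def blinfun.bilinear_simps bounded_linear_Blinfun_apply[OF bounded_linear_ext_derivative])

lemma smooth_on_coord_courant:
  fixes S T :: "'u::fd_euclidean \<Rightarrow> 'u gtangent"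
  assumes U: "open U" and S: "smooth_on U S" and T: "smooth_on U T"
  shows "smooth_on U (coord_courant S T)"
proof -
  note DS = smooth_on_Dbl[OF U S] and DT = smooth_on_Dbl[OF U T]
  note fS = smooth_on_fst[OF U S] and fT = smooth_on_fst[OF U T]
  have "smooth_on U (\<lambda>y. Blinfun (\<lambda>v. snd (Dbl S y (fst (T y))) v - snd (Dbl S y v) (fst (T y))))"
    by (rule smooth_on_blinfunI[OF U], unfold bounded_linear_Blinfun_apply[OF bounded_linear_ext_derivative])
       (intro smooth_on_diff smooth_on_blinfun_apply smooth_on_snd DS fT U smooth_on_const)
  then show ?thesis
    unfolding coord_courant_def[abs_def]
    by (intro smooth_on_Pair smooth_on_diff smooth_on_add smooth_on_blinfun_compose smooth_on_blinfun_apply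
        smooth_on_fst[OF U, of "\<lambda>y. Dbl T y (fst (S y))"] smooth_on_fst[OF U, of "\<lambda>y. Dbl S y (fst (T y))"]
        smooth_on_snd[OF U, of "\<lambda>y. Dbl T y (fst (S y))"]
        smooth_on_snd[OF U T] DS DT fS fT U smooth_on_const)
qed

text \<open>The Courant tensor of sections that are pulled back along \<open>F\<close> is computed from their lifts
  \<open>a\<^sub>i\<close> to sections along \<open>F\<close>: all contributions of the second derivative of \<open>F\<close> cancel by symmetry.\<close>

lemma pairing_coord_courant_along:
  fixes F :: "'u::fd_euclidean \<Rightarrow> 'e::fd_euclidean"
  assumes "open S" "y0 \<in> S" and F: "smooth_on S F"
    and ds: "s1 differentiable (at y0)" "s2 differentiable (at y0)"
    and da: "a1 differentiable (at y0)" "a2 differentiable (at y0)"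
    and rel: "\<And>y. y \<in> S \<Longrightarrow> relates (Dbl F y) (a1 y) (s1 y)" "\<And>y. y \<in> S \<Longrightarrow> relates (Dbl F y) (a2 y) (s2 y)"
  shows "pairing (coord_courant s1 s2 y0) (X, \<eta> o\<^sub>L Dbl F y0) =
    pairing (Dbl a2 y0 (fst (s1 y0))) (Dbl F y0 X, \<eta>) - pairing (Dbl a1 y0 (fst (s2 y0))) (Dbl F y0 X, \<eta>)
    + pairing (Dbl a1 y0 X) (a2 y0)"
proof -
  define H where "H = Dbl (Dbl F) y0"
  have sDF: "smooth_on S (Dbl F)" by (rule smooth_on_Dbl[OF assms(1) F])
  have dH: "(Dbl F has_derivative blinfun_apply H) (at y0)"
    unfolding H_def by (rule Dbl_has_derivative[OF smooth_on_differentiable[OF sDF assms(2)]])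
  have Hv: "frechet_derivative (\<lambda>y. frechet_derivative F (at y) v) (at y0) u = H u v" for u v
  proof -
    have "((\<lambda>y. Dbl F y v) has_derivative (\<lambda>u. H u v)) (at y0)"
      by (rule bounded_linear.has_derivative[OF blinfun.bounded_linear_left dH])
    then have "((\<lambda>y. frechet_derivative F (at y) v) has_derivative (\<lambda>u. H u v)) (at y0)"
      by (rule has_derivative_transform_within_open[OF _ assms(1,2)])
         (simp add: Dbl_apply smooth_on_differentiable[OF F])
    then show ?thesis by (simp add: frechet_derivative_eqI)
  qed
  have Hsym: "H u v = H v u" for u v
    using second_derivative_symmetric[OF assms(1) F assms(2), of v u] unfolding Hv .
  \<comment> \<open>The two equations that make up \<open>relates\<close> are differentiated by the
    product rule; each contributes one term with the second derivative \<open>H\<close> of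
    \<open>F\<close>.\<close>
  have E: "fst (Dbl a y0 u) = H u (fst (s y0)) + Dbl F y0 (fst (Dbl s y0 u))"
    "snd (Dbl s y0 u) v = snd (Dbl a y0 u) (Dbl F y0 v) + snd (a y0) (H u v)"
    if "s differentiable (at y0)" "a differentiable (at y0)" "\<forall>y\<in>S. relates (Dbl F y) (a y) (s y)"
    for s u v and a :: "'u \<Rightarrow> 'e gtangent"
  proof -
    note da = Dbl_has_derivative[OF that(2)] and ds = Dbl_has_derivative[OF that(1)]
    have "((\<lambda>y. Dbl F y (fst (s y))) has_derivative
        (\<lambda>u. Dbl F y0 (fst (Dbl s y0 u)) + H u (fst (s y0)))) (at y0)"
      by (intro blinfun.FDERIV dH has_derivative_fst ds)
    then have "((\<lambda>y. fst (a y)) has_derivative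
        (\<lambda>u. Dbl F y0 (fst (Dbl s y0 u)) + H u (fst (s y0)))) (at y0)"
      by (rule has_derivative_transform_within_open[OF _ assms(1,2)]) (use that(3) in \<open>simp add: relates_def\<close>)
    from fun_cong[OF has_derivative_unique[OF this has_derivative_fst[OF da]], of u]
    show "fst (Dbl a y0 u) = H u (fst (s y0)) + Dbl F y0 (fst (Dbl s y0 u))" by (simp add: add.commute)
    have "((\<lambda>y. snd (a y) o\<^sub>L Dbl F y) has_derivative
        (\<lambda>u. (snd (a y0) o\<^sub>L H u) + (snd (Dbl a y0 u) o\<^sub>L Dbl F y0))) (at y0)"
      by (intro bounded_bilinear.FDERIV[OF bounded_bilinear_blinfun_compose] dH has_derivative_snd da)
    then have "((\<lambda>y. snd (s y)) has_derivative
        (\<lambda>u. (snd (a y0) o\<^sub>L H u) + (snd (Dbl a y0 u) o\<^sub>L Dbl F y0))) (at y0)"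
      by (rule has_derivative_transform_within_open[OF _ assms(1,2)]) (use that(3) in \<open>simp add: relates_def\<close>)
    from fun_cong[OF has_derivative_unique[OF this has_derivative_snd[OF ds]], of u, symmetric]
    show "snd (Dbl s y0 u) v = snd (Dbl a y0 u) (Dbl F y0 v) + snd (a y0) (H u v)"
      by (simp add: blinfun.add_left)
  qed
  define X1 X2 \<eta>1 \<eta>2 where X: "X1 = fst (s1 y0)" "X2 = fst (s2 y0)" "\<eta>1 = snd (a1 y0)" "\<eta>2 = snd (a2 y0)"
  have rel': "\<forall>y\<in>S. relates (Dbl F y) (a1 y) (s1 y)" "\<forall>y\<in>S. relates (Dbl F y) (a2 y) (s2 y)"
    using rel by blast+
  note E' = E[OF ds(1) da(1) rel'(1), folded X] E[OF ds(2) da(2) rel'(2), folded X]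
  have s2: "snd (s2 y0) = \<eta>2 o\<^sub>L Dbl F y0" and f2: "fst (a2 y0) = Dbl F y0 X2"
    using rel(2)[OF assms(2)] by (simp_all add: X relates_def)
  have "pairing (coord_courant s1 s2 y0) (X, \<eta> o\<^sub>L Dbl F y0)
      = snd (Dbl s2 y0 X1) X + \<eta> (Dbl F y0 (fst (Dbl s2 y0 X1)))
        - (snd (Dbl s1 y0 X2) X + \<eta> (Dbl F y0 (fst (Dbl s1 y0 X2))))
        + (snd (Dbl s1 y0 X) X2 + \<eta>2 (Dbl F y0 (fst (Dbl s1 y0 X))))"
    unfolding pairing_coord_courant by (simp add: pairing_def s2 X)
  \<comment> \<open>Six terms in \<open>H\<close> arise, two for each of the covectors
    \<open>\<eta>\<close>, \<open>\<eta>1\<close> and \<open>\<eta>2\<close>. The two have opposite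
    signs and interchanged arguments.\<close>
  also have "\<dots> = snd (Dbl a2 y0 X1) (Dbl F y0 X) + \<eta> (fst (Dbl a2 y0 X1))
        - (snd (Dbl a1 y0 X2) (Dbl F y0 X) + \<eta> (fst (Dbl a1 y0 X2)))
        + (snd (Dbl a1 y0 X) (Dbl F y0 X2) + \<eta>2 (fst (Dbl a1 y0 X)))"
    unfolding E' blinfun.add_right
    using Hsym[of X1 X2] Hsym[of X X1] Hsym[of X X2] by simp
  also have "\<dots> = pairing (Dbl a2 y0 X1) (Dbl F y0 X, \<eta>) - pairing (Dbl a1 y0 X2) (Dbl F y0 X, \<eta>)
    + pairing (Dbl a1 y0 X) (a2 y0)"
    by (simp add: pairing_def f2 X)
  finally show ?thesis unfolding X .
qed

text \<open>The lifts are the composites of \<open>t1\<close> and \<open>t2\<close> with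
  \<open>F\<close>; their derivatives in a direction \<open>u\<close> are those of \<open>t1\<close>
  and \<open>t2\<close> in the direction of the image of \<open>u\<close>, so the lifted expression
  becomes the pairing formula downstairs. Setting \<open>X = 0\<close> or \<open>\<eta> = 0\<close>
  separates the two halves of \<open>relates\<close>.\<close>

lemma coord_courant_natural:
  fixes F :: "'u::fd_euclidean \<Rightarrow> 'e::fd_euclidean"
  assumes "open S" "y0 \<in> S" and F: "smooth_on S F"
    and ds: "s1 differentiable (at y0)" "s2 differentiable (at y0)"
    and dt: "t1 differentiable (at (F y0))" "t2 differentiable (at (F y0))"
    and rel: "\<And>y. y \<in> S \<Longrightarrow> relates (Dbl F y) (t1 (F y)) (s1 y)" "\<And>y. y \<in> S \<Longrightarrow> relates (Dbl F y) (t2 (F y)) (s2 y)"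
  shows "relates (Dbl F y0) (coord_courant t1 t2 (F y0)) (coord_courant s1 s2 y0)"
proof -
  note dF = smooth_on_differentiable[OF F assms(2)]
  have Da: "Dbl (\<lambda>y. t (F y)) y0 = Dbl t (F y0) o\<^sub>L Dbl F y0"
    and da: "(\<lambda>y. t (F y)) differentiable (at y0)"
    if "t differentiable (at (F y0))" for t :: "'e \<Rightarrow> 'e gtangent"
    using Dbl_compose[OF dF that] differentiable_chain_at[OF dF that] by (simp_all add: o_def)
  have key: "pairing (coord_courant s1 s2 y0) (X, \<eta> o\<^sub>L Dbl F y0) = pairing (coord_courant t1 t2 (F y0)) (Dbl F y0 X, \<eta>)" for X \<eta>
    using pairing_coord_courant_along[OF assms(1-3) ds da[OF dt(1)] da[OF dt(2)] rel, of X \<eta>]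
      rel[OF assms(2)] by (simp add: pairing_coord_courant Da[OF dt(1)] Da[OF dt(2)] relates_def)
  have "fst (coord_courant t1 t2 (F y0)) \<bullet> w = Dbl F y0 (fst (coord_courant s1 s2 y0)) \<bullet> w" for w
    using key[of 0 "blinfun_inner_left w"]
    by (simp add: pairing_def blinfun.zero_right blinfun_inner_left.rep_eq inner_commute)
  then have "fst (coord_courant t1 t2 (F y0)) = Dbl F y0 (fst (coord_courant s1 s2 y0))" by (metis vector_eq_rdot)
  moreover have "snd (coord_courant s1 s2 y0) X = (snd (coord_courant t1 t2 (F y0)) o\<^sub>L Dbl F y0) X" for X
    using key[of X 0] by (simp add: pairing_def blinfun.zero_left)
  ultimately show ?thesis unfolding relates_def by (auto intro: blinfun_eqI)
qed

text \<open>The conditions on the fibre \<open>V\<close> are imposed at the single point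
  \<open>F y0\<close>, where everything is evaluated. The expansions in the frame must hold on a
  neighbourhood because they are differentiated.\<close>

lemma coord_courant_pull_isotropic:
  fixes F :: "'u::fd_euclidean \<Rightarrow> 'e::fd_euclidean" and l :: "'i \<Rightarrow> 'e \<Rightarrow> 'e gtangent"
  assumes "open S" "y0 \<in> S" and F: "smooth_on S F"
    and ds: "s1 differentiable (at y0)" "s2 differentiable (at y0)"
    and rel: "\<And>y. y \<in> S \<Longrightarrow> relates (Dbl F y) (a1 y) (s1 y)" "\<And>y. y \<in> S \<Longrightarrow> relates (Dbl F y) (a2 y) (s2 y)"
    and a: "\<And>y. y \<in> S \<Longrightarrow> a1 y = (\<Sum>i\<in>I. c1 i y *\<^sub>R l i (F y))" "\<And>y. y \<in> S \<Longrightarrow> a2 y = (\<Sum>i\<in>I. c2 i y *\<^sub>R l i (F y))"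
    and dc: "\<And>i. i \<in> I \<Longrightarrow> c1 i differentiable (at y0)" "\<And>i. i \<in> I \<Longrightarrow> c2 i differentiable (at y0)"
    and dl: "\<And>i. i \<in> I \<Longrightarrow> l i differentiable (at (F y0))"
    and V: "isotropic V" and lV: "\<And>i. i \<in> I \<Longrightarrow> l i (F y0) \<in> V"
    and cV: "\<And>i j. i \<in> I \<Longrightarrow> j \<in> I \<Longrightarrow> coord_courant (l i) (l j) (F y0) \<in> V"
    and b: "b \<in> pull (Dbl F y0) V"
  shows "pairing (coord_courant s1 s2 y0) b = 0"
proof -
  note dF = smooth_on_differentiable[OF F assms(2)]
  obtain X \<eta> where b: "b = (X, \<eta> o\<^sub>L Dbl F y0)" and bV: "(Dbl F y0 X, \<eta>) \<in> V"
    using b unfolding pull_def by blast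
  let ?q = "F y0" and ?b = "(Dbl F y0 X, \<eta>)"
  have hd: "(a has_derivative (\<lambda>u. \<Sum>i\<in>I. c i y0 *\<^sub>R Dbl (l i) ?q (Dbl F y0 u) + Dbl (c i) y0 u *\<^sub>R l i ?q)) (at y0)"
    if "\<forall>y\<in>S. a y = (\<Sum>i\<in>I. c i y *\<^sub>R l i (F y))" "\<forall>i\<in>I. c i differentiable (at y0)"
    for a and c :: "'i \<Rightarrow> 'u \<Rightarrow> real"
  proof -
    have "((\<lambda>y. \<Sum>i\<in>I. c i y *\<^sub>R l i (F y)) has_derivative
       (\<lambda>u. \<Sum>i\<in>I. c i y0 *\<^sub>R Dbl (l i) ?q (Dbl F y0 u) + Dbl (c i) y0 u *\<^sub>R l i ?q)) (at y0)"
      by (intro has_derivative_sum has_derivative_scaleR Dbl_has_derivative that(2)[rule_format]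
            has_derivative_compose[OF Dbl_has_derivative[OF dF] Dbl_has_derivative[OF dl]])
    then show ?thesis
      by (rule has_derivative_transform_within_open[OF _ assms(1,2)]) (simp add: that(1))
  qed
  have a': "\<forall>y\<in>S. a1 y = (\<Sum>i\<in>I. c1 i y *\<^sub>R l i (F y))" "\<forall>y\<in>S. a2 y = (\<Sum>i\<in>I. c2 i y *\<^sub>R l i (F y))"
    and dc': "\<forall>i\<in>I. c1 i differentiable (at y0)" "\<forall>i\<in>I. c2 i differentiable (at y0)"
    using a dc by blast+
  have da: "a1 differentiable (at y0)" "a2 differentiable (at y0)"
    using hd[OF a'(1) dc'(1)] hd[OF a'(2) dc'(2)] unfolding differentiable_def by blast+
  have D: "pairing (Dbl a y0 u) z = (\<Sum>i\<in>I. c i y0 * pairing (Dbl (l i) ?q (Dbl F y0 u)) z)"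
    if "z \<in> V" "\<forall>y\<in>S. a y = (\<Sum>i\<in>I. c i y *\<^sub>R l i (F y))" "\<forall>i\<in>I. c i differentiable (at y0)"
    for a z u and c :: "'i \<Rightarrow> 'u \<Rightarrow> real"
  proof -
    have "a differentiable (at y0)" using hd[OF that(2,3)] unfolding differentiable_def by blast
    then have "Dbl a y0 u = (\<Sum>i\<in>I. c i y0 *\<^sub>R Dbl (l i) ?q (Dbl F y0 u) + Dbl (c i) y0 u *\<^sub>R l i ?q)"
      using frechet_derivative_eqI[OF hd[OF that(2,3)]] by (simp add: Dbl_apply)
    then show ?thesis
      using isotropic_pairing[OF V lV that(1)]
      by (simp add: pairing.sum_left pairing.add_left pairing.scaleR_left)
  qed
  have a1q: "Dbl F y0 (fst (s1 y0)) = (\<Sum>i\<in>I. c1 i y0 *\<^sub>R fst (l i ?q))"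
    and a2q: "Dbl F y0 (fst (s2 y0)) = (\<Sum>i\<in>I. c2 i y0 *\<^sub>R fst (l i ?q))"
    using rel[OF assms(2)] a[OF assms(2)] by (simp_all add: relates_def fst_sum)
  have a2V: "a2 y0 \<in> V"
    unfolding a(2)[OF assms(2)]
    by (intro subspace_sum subspace_scale isotropic_subspace[OF V] lV)
  have "pairing (coord_courant s1 s2 y0) b = pairing (Dbl a2 y0 (fst (s1 y0))) ?b - pairing (Dbl a1 y0 (fst (s2 y0))) ?b
    + pairing (Dbl a1 y0 X) (a2 y0)"
    unfolding b by (rule pairing_coord_courant_along[OF assms(1-3) ds da rel])
  also have "pairing (Dbl a2 y0 (fst (s1 y0))) ?b
      = (\<Sum>j\<in>I. \<Sum>i\<in>I. c1 i y0 * c2 j y0 * pairing (Dbl (l j) ?q (fst (l i ?q))) ?b)"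
    unfolding D[OF bV a'(2) dc'(2)] a1q
    by (simp add: blinfun.sum_right blinfun.scaleR_right pairing.sum_left pairing.scaleR_left sum_distrib_left mult_ac)
  also have "\<dots> = (\<Sum>i\<in>I. \<Sum>j\<in>I. c1 i y0 * c2 j y0 * pairing (Dbl (l j) ?q (fst (l i ?q))) ?b)"
    by (rule sum.swap)
  also have "pairing (Dbl a1 y0 (fst (s2 y0))) ?b
      = (\<Sum>i\<in>I. \<Sum>j\<in>I. c1 i y0 * c2 j y0 * pairing (Dbl (l i) ?q (fst (l j ?q))) ?b)"
    unfolding D[OF bV a'(1) dc'(1)] a2q
    by (simp add: blinfun.sum_right blinfun.scaleR_right pairing.sum_left pairing.scaleR_left sum_distrib_left mult_ac)
  also have "pairing (Dbl a1 y0 X) (a2 y0)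
      = (\<Sum>i\<in>I. \<Sum>j\<in>I. c1 i y0 * c2 j y0 * pairing (Dbl (l i) ?q (fst ?b)) (l j ?q))"
    unfolding D[OF a2V a'(1) dc'(1)] unfolding a(2)[OF assms(2)]
    by (simp add: pairing.sum_right pairing.scaleR_right sum_distrib_left mult_ac)
  finally have "pairing (coord_courant s1 s2 y0) b = (\<Sum>i\<in>I. \<Sum>j\<in>I. c1 i y0 * c2 j y0 * pairing (coord_courant (l i) (l j) ?q) ?b)"
    unfolding pairing_coord_courant by (simp add: sum_subtractf sum.distrib algebra_simps)
  also have "\<dots> = 0"
    using isotropic_pairing[OF V cV bV] by simp
  finally show ?thesis .
qed


section \<open>A flat function\<close>

text \<open>Up to linear combinations, this family is closed under differentiation.\<close>

definition flat_fun :: "nat \<Rightarrow> real \<Rightarrow> real" where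
  "flat_fun n t = (if t \<le> 0 then 0 else exp (- inverse t) * inverse t ^ n)"

text \<open>With \<open>u = inverse t\<close>, the difference quotient from the right is
  \<open>u ^ Suc n / exp u\<close>, which tends to 0 as \<open>u\<close> tends to infinity. From the
  left it is 0.\<close>

lemma flat_fun_has_derivative_0: "(flat_fun n has_real_derivative 0) (at 0)"
proof -
  have "((\<lambda>t. inverse t ^ Suc n / exp (inverse t)) \<longlongrightarrow> 0) (at_right (0::real))"
    by (rule filterlim_compose[OF tendsto_power_div_exp_0 filterlim_inverse_at_top_right])
  then have "((\<lambda>t. (flat_fun n t - flat_fun n 0) / (t - 0)) \<longlongrightarrow> 0) (at_right 0)"
    by (rule Lim_transform_eventually)
       (auto simp: eventually_at_right_less flat_fun_def exp_minus field_simps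
         intro!: eventually_mono[OF eventually_at_right_less[of 0]])
  moreover have "((\<lambda>t. (flat_fun n t - flat_fun n 0) / (t - 0)) \<longlongrightarrow> 0) (at_left 0)"
    by (rule Lim_transform_eventually[OF tendsto_const])
       (auto simp: flat_fun_def eventually_at_left_field intro!: exI[of _ "-1"])
  ultimately show ?thesis
    unfolding has_field_derivative_iff by (rule filterlim_split_at[rotated])
qed

lemma flat_fun_has_derivative:
  "(flat_fun n has_real_derivative (flat_fun (n + 2) t - real n * flat_fun (n + 1) t)) (at t)"
proof -
  consider "t < 0" | "t = 0" | "t > 0" by linarith
  then show ?thesis
  proof cases
    case 1
    have "((\<lambda>t. 0) has_real_derivative 0) (at t)" by simp
    then have "(flat_fun n has_real_derivative 0) (at t)"
      by (rule has_field_derivative_transform_within_open[of _ _ _ "{..<0}"]) (use 1 in \<open>auto simp: flat_fun_def\<close>)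
    then show ?thesis using 1 by (simp add: flat_fun_def)
  next
    case 2
    then show ?thesis using flat_fun_has_derivative_0[of n] by (simp add: flat_fun_def)
  next
    case 3
    \<comment> \<open>The subtraction in the exponent is truncated; for \<open>n = 0\<close> the
      factor \<open>real n\<close> makes both sides vanish.\<close>
    have *: "real n * inverse t ^ (n - Suc 0) * inverse t * inverse t = real n * inverse t ^ Suc n"
      by (cases n) simp_all
    have "((\<lambda>t. exp (- inverse t) * inverse t ^ n) has_real_derivative
        exp (- inverse t) * (inverse t * inverse t) * inverse t ^ n
        - exp (- inverse t) * (real n * inverse t ^ (n - Suc 0) * inverse t * inverse t)) (at t)"
      by (rule derivative_eq_intros refl | use 3 in \<open>simp add: algebra_simps\<close>)+
    then have "((\<lambda>t. exp (- inverse t) * inverse t ^ n) has_real_derivative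
        (flat_fun (n + 2) t - real n * flat_fun (n + 1) t)) (at t)"
      unfolding * using 3 by (simp add: flat_fun_def algebra_simps power_add power2_eq_square)
    then show ?thesis
      by (rule has_field_derivative_transform_within_open[of _ _ _ "{0<..}"]) (use 3 in \<open>auto simp: flat_fun_def\<close>)
  qed
qed

lemma smooth_on_flat_fun: "smooth_on UNIV (flat_fun n)"
  unfolding smooth_on_def
proof
  fix k show "Ck_on k UNIV (flat_fun n)"
  proof (induction k arbitrary: n)
    case 0
    have "continuous_on UNIV (flat_fun n)"
      by (rule continuous_at_imp_continuous_on) (use flat_fun_has_derivative DERIV_isCont in blast)
    then show ?case by simp
  next
    case (Suc k)
    show ?case
    proof (rule Ck_on_SucI)
      show "(flat_fun n has_derivative (\<lambda>v. (flat_fun (n + 2) t - real n * flat_fun (n + 1) t) * v)) (at t)" for t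
        using flat_fun_has_derivative[of n t] unfolding has_field_derivative_def .
    next
      fix v
      have "bounded_linear (\<lambda>x. x * v)" "bounded_linear (\<lambda>x. - (real n) * x)" for v :: real
        by (intro bounded_linear_intros)+
      note bl = this
      have "Ck_on k UNIV (\<lambda>t. flat_fun (n + 2) t + - (real n) * flat_fun (n + 1) t)"
        by (intro Ck_on_add Suc.IH Ck_on_bounded_linear[OF _ bl(2)] open_UNIV)
      from Ck_on_bounded_linear[OF open_UNIV bl(1) this, of v]
      show "Ck_on k UNIV (\<lambda>t. (flat_fun (n + 2) t - real n * flat_fun (n + 1) t) * v)" by simp
    qed simp
  qed
qed

lemma flat_fun_nonneg: "0 \<le> flat_fun 0 t" and flat_fun_pos_iff: "flat_fun 0 t > 0 \<longleftrightarrow> t > 0"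
  by (auto simp: flat_fun_def)


section \<open>Local lifts to the pullback algebroid\<close>

lemma dim_image_inj_on:
  assumes "linear g" "subspace S" "inj_on g S"
  shows "dim (g ` S) = dim S"
proof -
  obtain B where B: "B \<subseteq> S" "independent B" "S \<subseteq> span B" "card B = dim S"
    using basis_exists by blast
  have sp: "span B = S" using B assms(2) by (simp add: span_minimal subset_antisym)
  have "independent (g ` B)"
    by (rule linear_independent_injective_image[OF assms(1) B(2)]) (simp add: sp assms(3))
  moreover have "span (g ` B) = g ` S" using linear_span_image[OF assms(1), of B] sp by simp
  moreover have "card (g ` B) = card B" by (rule card_image[OF inj_on_subset[OF assms(3) B(1)]])
  ultimately show ?thesis using B(4) dim_span_eq_card_independent by metis
qed

text \<open>Duality makes the vectors \<open>g e\<close> independent. There are as many of them as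
  basis vectors, so they span, and the coefficients are read off with \<open>d\<close>.\<close>

lemma dual_span_UNIV:
  fixes g d :: "'u::fd_euclidean \<Rightarrow> 'u"
  assumes dual: "\<And>e e'. e \<in> onb \<Longrightarrow> e' \<in> onb \<Longrightarrow> d e \<bullet> g e' = (if e = e' then 1 else 0)"
  shows "w = (\<Sum>e\<in>onb. (d e \<bullet> w) *\<^sub>R g e)"
proof -
  have co: "d e \<bullet> (\<Sum>e\<in>onb. c e *\<^sub>R g e) = c e" if "e \<in> onb" for c e
  proof -
    have "d e \<bullet> (\<Sum>e\<in>onb. c e *\<^sub>R g e) = (\<Sum>e'\<in>onb. if e' = e then c e' else 0)"
      unfolding inner_sum_right by (rule sum.cong) (use dual that in auto)
    then show ?thesis using that by simp
  qed
  have inj: "inj_on g onb" and ind: "independent (g ` onb)"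
    by (rule independent_image[OF finite_onb], metis co inner_zero_right)+
  have "w \<in> span (g ` onb)"
  proof (rule ccontr)
    assume n: "w \<notin> span (g ` onb)"
    have "card (insert w (g ` onb)) \<le> card (onb :: 'u set)"
      using independent_span_bound[OF finite_onb independent_insertI[OF n ind]] by simp
    moreover have "w \<notin> g ` onb" using n span_base[of w "g ` onb"] by blast
    ultimately show False using card_image[OF inj] by simp
  qed
  then obtain c where c: "w = (\<Sum>e\<in>onb. c e *\<^sub>R g e)"
    unfolding span_image_finite[OF finite_onb] ..
  have "d e \<bullet> w = c e" if "e \<in> onb" for e unfolding c by (rule co[OF that])
  then have "(\<Sum>e\<in>onb. (d e \<bullet> w) *\<^sub>R g e) = (\<Sum>e\<in>onb. c e *\<^sub>R g e)" by (intro sum.cong) auto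
  then show ?thesis using c by simp
qed

text \<open>Independence is required at the base point alone; the construction of a smooth dual
  family carries it to a neighbourhood.\<close>

definition isotropic_frame :: "'e::fd_euclidean set \<Rightarrow> 'e \<Rightarrow> ('e \<Rightarrow> 'e gtangent set) \<Rightarrow> 'i set \<Rightarrow>
    ('i \<Rightarrow> 'e \<Rightarrow> 'e gtangent) \<Rightarrow> bool" where
  "isotropic_frame Z z0 \<Lambda> I l \<longleftrightarrow> finite I \<and> open Z \<and> z0 \<in> Z \<and> (\<forall>i\<in>I. smooth_on Z (l i)) \<and>
    (\<forall>z\<in>Z. maximal_isotropic (\<Lambda> z) \<and> span ((\<lambda>i. l i z) ` I) = \<Lambda> z) \<and>
    (\<forall>c. (\<Sum>i\<in>I. c i *\<^sub>R l i z0) = 0 \<longrightarrow> (\<forall>i\<in>I. c i = 0))"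

text \<open>The dual family is built from inner products, and the frame takes values in pairs of a
  vector and a covector. Its image under \<open>gvec\<close> takes values in the inner product space
  \<open>'e\<close>, and stays independent because \<open>gvec\<close> is injective on isotropic
  subspaces.\<close>

lemma frame_coordinates:
  assumes "isotropic_frame Z z0 \<Lambda> I l"
  obtains T m where "open T" "z0 \<in> T" "T \<subseteq> Z" "\<And>i. i \<in> I \<Longrightarrow> smooth_on T (m i)"
    and "\<And>z b. z \<in> T \<Longrightarrow> b \<in> \<Lambda> z \<Longrightarrow> b = (\<Sum>i\<in>I. (m i z \<bullet> gvec b) *\<^sub>R l i z)"
proof -
  have fin: "finite I" and oZ: "open Z" "z0 \<in> Z" and l: "\<And>i. i \<in> I \<Longrightarrow> smooth_on Z (l i)"
    and mi: "\<And>z. z \<in> Z \<Longrightarrow> maximal_isotropic (\<Lambda> z)"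
    and sp: "\<And>z. z \<in> Z \<Longrightarrow> span ((\<lambda>i. l i z) ` I) = \<Lambda> z"
    and ind: "\<And>c. (\<Sum>i\<in>I. c i *\<^sub>R l i z0) = 0 \<Longrightarrow> \<forall>i\<in>I. c i = 0"
    using assms unfolding isotropic_frame_def by simp_all
  have lZ: "l i z \<in> \<Lambda> z" if "z \<in> Z" "i \<in> I" for i z
    unfolding sp[OF that(1), symmetric] using that(2) by (intro span_base imageI)
  have sg: "smooth_on Z (\<lambda>z. gvec (l i z))" if "i \<in> I" for i
    by (rule smooth_on_bounded_linear[OF oZ(1) bounded_linear_gvec l[OF that]])
  have indg: "\<forall>i\<in>I. c i = 0" if c: "(\<Sum>i\<in>I. c i *\<^sub>R gvec (l i z0)) = 0" for c
  proof (rule ind, rule gvec_inj[OF maximal_isotropicD[OF mi[OF oZ(2)]]])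
    show "(\<Sum>i\<in>I. c i *\<^sub>R l i z0) \<in> \<Lambda> z0"
      by (intro subspace_sum subspace_scale isotropic_subspace maximal_isotropicD mi oZ lZ)
    show "gvec (\<Sum>i\<in>I. c i *\<^sub>R l i z0) = 0"
      using c by (simp add: linear_sum[OF linear_gvec] linear_scale[OF linear_gvec])
  qed
  obtain T m where T: "open T" "z0 \<in> T" "T \<subseteq> Z" and m: "\<And>i. i \<in> I \<Longrightarrow> smooth_on T (m i)"
    and dual: "\<And>z i j. z \<in> T \<Longrightarrow> i \<in> I \<Longrightarrow> j \<in> I \<Longrightarrow> m i z \<bullet> gvec (l j z) = (if i = j then 1 else 0)"
    by (rule smooth_dual_frame[OF fin oZ, of "\<lambda>i z. gvec (l i z)"]) (erule sg, erule indg, rule that)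
  have ex: "b = (\<Sum>i\<in>I. (m i z \<bullet> gvec b) *\<^sub>R l i z)" if z: "z \<in> T" and b: "b \<in> \<Lambda> z" for z b
  proof -
    have "b \<in> span ((\<lambda>i. l i z) ` I)" using sp z T(3) b by blast
    then obtain c where c: "b = (\<Sum>i\<in>I. c i *\<^sub>R l i z)"
      unfolding span_image_finite[OF fin] ..
    have "m i z \<bullet> gvec b = c i" if i: "i \<in> I" for i
    proof -
      have "m i z \<bullet> gvec b = (\<Sum>j\<in>I. if j = i then c j else 0)"
        unfolding c linear_sum[OF linear_gvec] linear_scale[OF linear_gvec] inner_sum_right
        by (rule sum.cong) (use dual[OF z i] in auto)
      then show ?thesis using i fin by simp
    qed
    then have "(\<Sum>i\<in>I. (m i z \<bullet> gvec b) *\<^sub>R l i z) = (\<Sum>i\<in>I. c i *\<^sub>R l i z)"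
      by (intro sum.cong) auto
    then show ?thesis using c by simp
  qed
  show thesis by (rule that[OF T]) (erule m, erule (1) ex)
qed

text \<open>The \<open>b e\<close> are a frame of the pullback of \<open>\<Lambda>\<close> with coordinate functionals \<open>t \<mapsto> d e \<bullet> gvec t\<close>, and
  the \<open>\<alpha> e\<close> are lifts of this frame.\<close>

definition lift_frame :: "'u::fd_euclidean set \<Rightarrow> ('u \<Rightarrow> 'e::fd_euclidean) \<Rightarrow> ('u \<Rightarrow> 'e gtangent set) \<Rightarrow>
    ('u \<Rightarrow> 'u \<Rightarrow> 'u) \<Rightarrow> ('u \<Rightarrow> 'u \<Rightarrow> 'u gtangent) \<Rightarrow> ('u \<Rightarrow> 'u \<Rightarrow> 'e gtangent) \<Rightarrow> bool" where
  "lift_frame T F \<Lambda> d b \<alpha> \<longleftrightarrow>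
    (\<forall>e\<in>onb. smooth_on T (d e) \<and> smooth_on T (b e) \<and> smooth_on T (\<alpha> e)) \<and>
    (\<forall>y\<in>T. (\<forall>e\<in>onb. \<alpha> e y \<in> \<Lambda> y \<and> relates (Dbl F y) (\<alpha> e y) (b e y)) \<and>
      (\<forall>e\<in>onb. \<forall>e'\<in>onb. d e y \<bullet> gvec (b e' y) = (if e = e' then 1 else 0)) \<and>
      (\<forall>t\<in>pull (Dbl F y) (\<Lambda> y). t = (\<Sum>e\<in>onb. (d e y \<bullet> gvec t) *\<^sub>R b e y)))"

lemma lift_frameD:
  assumes "lift_frame T F \<Lambda> d b \<alpha>"
  shows "e \<in> onb \<Longrightarrow> smooth_on T (d e)" "e \<in> onb \<Longrightarrow> smooth_on T (b e)" "e \<in> onb \<Longrightarrow> smooth_on T (\<alpha> e)"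
    and "y \<in> T \<Longrightarrow> e \<in> onb \<Longrightarrow> \<alpha> e y \<in> \<Lambda> y"
    and "y \<in> T \<Longrightarrow> e \<in> onb \<Longrightarrow> relates (Dbl F y) (\<alpha> e y) (b e y)"
    and "y \<in> T \<Longrightarrow> e \<in> onb \<Longrightarrow> e' \<in> onb \<Longrightarrow> d e y \<bullet> gvec (b e' y) = (if e = e' then 1 else 0)"
    and "y \<in> T \<Longrightarrow> t \<in> pull (Dbl F y) (\<Lambda> y) \<Longrightarrow> t = (\<Sum>e\<in>onb. (d e y \<bullet> gvec t) *\<^sub>R b e y)"
  using assms unfolding lift_frame_def by simp_all

text \<open>Prescribed elements of the pullback algebroid at \<open>y0\<close> are extended to
  smooth sections. They are chosen so that \<open>gvec\<close> maps their images in the pulled-back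
  fibre at \<open>y0\<close> to the orthonormal basis itself; the images then stay independent
  nearby, and their number is that needed for a frame.\<close>

lemma local_lift:
  fixes F :: "'u::fd_euclidean \<Rightarrow> 'e::fd_euclidean"
  assumes "open \<Omega>" "y0 \<in> \<Omega>" and F: "smooth_on \<Omega> F"
    and frame: "isotropic_frame Z (F y0) \<Lambda> I l"
    and rank: "\<And>y. y \<in> \<Omega> \<Longrightarrow> dim {(a, v). a \<in> \<Lambda> (F y) \<and> fst a = Dbl F y v} = r"
  obtains T d b \<alpha> where "open T" "y0 \<in> T" "T \<subseteq> \<Omega>" "lift_frame T F (\<lambda>y. \<Lambda> (F y)) d b \<alpha>"
proof -
  have z0: "F y0 \<in> Z" and l: "\<And>i. i \<in> I \<Longrightarrow> smooth_on Z (l i)"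
    and mi: "\<And>z. z \<in> Z \<Longrightarrow> maximal_isotropic (\<Lambda> z)"
    and sp: "\<And>z. z \<in> Z \<Longrightarrow> span ((\<lambda>i. l i z) ` I) = \<Lambda> z"
    using frame unfolding isotropic_frame_def by simp_all
  obtain Z' m where Z': "open Z'" "F y0 \<in> Z'" "Z' \<subseteq> Z" and sm: "\<And>i. i \<in> I \<Longrightarrow> smooth_on Z' (m i)"
    and m: "\<And>z b. z \<in> Z' \<Longrightarrow> b \<in> \<Lambda> z \<Longrightarrow> b = (\<Sum>i\<in>I. (m i z \<bullet> gvec b) *\<^sub>R l i z)"
    by (rule frame_coordinates[OF frame]) (rule that)
  \<comment> \<open>On \<open>Z'\<close>, \<open>A z\<close> is the inverse of \<open>gvec\<close>
    on the fibre \<open>\<Lambda> z\<close>, written with smooth coefficients.\<close>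
  define A where "A = (\<lambda>z w. \<Sum>i\<in>I. (m i z \<bullet> w) *\<^sub>R l i z)"
  have linA: "linear (A z)" for z
    unfolding A_def
    by (intro bounded_linear.linear bounded_linear_sum bounded_linear_compose[OF bounded_linear_scaleR_left] bounded_linear_inner_right)
  have Am: "A z (gvec b) = b" if "z \<in> Z'" "b \<in> \<Lambda> z" for z b
    unfolding A_def using m[OF that] by simp
  have AL: "A z w \<in> \<Lambda> z" if "z \<in> Z'" for z w
  proof -
    have "z \<in> Z" using that Z' by blast
    from sp[OF this, symmetric] show ?thesis
      unfolding A_def by (simp only:) (intro span_sum span_scale span_base imageI)
  qed
  have gA: "gvec (A z w) = w" if "z \<in> Z'" for z w
  proof -
    have "z \<in> Z" using that Z' by blast
    then obtain b where "b \<in> \<Lambda> z" and w: "gvec b = w" using gvec_surj[OF mi, of z w] by blast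
    then have "A z (gvec b) = b" by (intro Am[OF that])
    then show ?thesis by (simp add: w)
  qed
  define \<Omega>' where "\<Omega>' = \<Omega> \<inter> F -` Z'"
  have \<Omega>': "open \<Omega>'" "y0 \<in> \<Omega>'" "\<Omega>' \<subseteq> \<Omega>" "F ` \<Omega>' \<subseteq> Z'"
    unfolding \<Omega>'_def using assms(1,2) Z' by (auto intro!: continuous_open_preimage smooth_on_continuous[OF F])
  note F' = smooth_on_subset[OF F \<Omega>'(3)]
  note sDF = smooth_on_Dbl[OF \<Omega>'(1) F']
  have sl: "smooth_on Z' (l i)" if "i \<in> I" for i using smooth_on_subset[OF l[OF that] Z'(3)] .
  have slF: "smooth_on \<Omega>' (\<lambda>y. l i (F y))" and smF: "smooth_on \<Omega>' (\<lambda>y. m i (F y))" if "i \<in> I" for i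
    using smooth_on_compose[OF \<Omega>'(1) Z'(1) \<Omega>'(4) F'] sl[OF that] sm[OF that] by auto
  \<comment> \<open>Parametrising the varying fibre of \<open>\<Lambda>\<close> by \<open>A\<close>
    turns the fibres of the pullback algebroid into kernels of linear maps between fixed
    spaces.\<close>
  define \<Phi> where "\<Phi> = (\<lambda>y (p :: 'e \<times> 'u). fst (A (F y) (fst p)) - Dbl F y (snd p))"
  have lin\<Phi>: "linear (\<Phi> y)" for y
    unfolding \<Phi>_def
    by (intro bounded_linear.linear bounded_linear_sub
        bounded_linear_compose[OF bounded_linear_fst] bounded_linear_compose[OF linear_imp_bounded_linear[OF linA]]
        bounded_linear_fst bounded_linear_compose[OF blinfun.bounded_linear_right] bounded_linear_snd)
  have s\<Phi>: "smooth_on \<Omega>' (\<lambda>y. \<Phi> y p)" for p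
    unfolding \<Phi>_def A_def
    by (intro smooth_on_diff smooth_on_fst[OF \<Omega>'(1), of "\<lambda>y. \<Sum>i\<in>I. (m i (F y) \<bullet> fst p) *\<^sub>R l i (F y)"]
        smooth_on_sum smooth_on_scaleR smooth_on_inner smooth_on_blinfun_apply
        smF slF sDF \<Omega>'(1) smooth_on_const)
  have rk: "dim {p. \<Phi> y p = 0} = r" if y: "y \<in> \<Omega>'" for y
  proof -
    have Fy: "F y \<in> Z'" and yO: "y \<in> \<Omega>" using y \<Omega>' by blast+
    let ?S = "{(a, v). a \<in> \<Lambda> (F y) \<and> fst a = Dbl F y v}" and ?g = "\<lambda>(a, v). (gvec a, v :: 'u)"
    have iso: "isotropic (\<Lambda> (F y))" using mi Fy Z' maximal_isotropicD by blast
    note sub = isotropic_subspace[OF iso]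
    have lg: "linear ?g"
      unfolding case_prod_beta
      by (intro bounded_linear.linear bounded_linear_Pair bounded_linear_compose[OF bounded_linear_gvec]
          bounded_linear_fst bounded_linear_snd)
    have "subspace ?S"
      by (rule subspaceI)
         (use subspace_0[OF sub] subspace_add[OF sub] subspace_scale[OF sub] in
           \<open>auto simp: blinfun.bilinear_simps zero_prod_def split_beta\<close>)
    moreover have "inj_on ?g ?S"
      by (rule inj_onI) (use gvec_inj_on[OF iso] in \<open>auto simp: split_beta\<close>)
    ultimately have "dim (?g ` ?S) = dim ?S" by (rule dim_image_inj_on[OF lg])
    moreover have "?g ` ?S = {p. \<Phi> y p = 0}"
    proof (intro set_eqI iffI)
      fix p assume "p \<in> ?g ` ?S"
      then obtain q where "q \<in> ?S" "p = ?g q" by (rule imageE)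
      then have "fst q \<in> \<Lambda> (F y)" "fst (fst q) = Dbl F y (snd q)" "p = (gvec (fst q), snd q)"
        by (simp_all add: split_beta)
      then show "p \<in> {p. \<Phi> y p = 0}" using Am[OF Fy] by (simp add: \<Phi>_def)
    next
      fix p assume "p \<in> {p. \<Phi> y p = 0}"
      then have "(A (F y) (fst p), snd p) \<in> ?S" using AL[OF Fy] by (simp add: \<Phi>_def)
      moreover have "p = ?g (A (F y) (fst p), snd p)" using gA[OF Fy] by simp
      ultimately show "p \<in> ?g ` ?S" by (rule rev_image_eqI)
    qed
    ultimately show ?thesis using rank[OF yO] by simp
  qed
  \<comment> \<open>The pulled-back fibre at \<open>y0\<close> is maximal isotropic, so
    \<open>gvec\<close> attains the value \<open>e\<close> on it. A lift of the element with this
    value is the initial value of the section.\<close>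
  have "\<exists>T s. open T \<and> y0 \<in> T \<and> T \<subseteq> \<Omega>' \<and> smooth_on T s \<and> (\<forall>y\<in>T. \<Phi> y (s y) = 0) \<and>
     gvec (snd (s y0), snd (A (F y0) (fst (s y0))) o\<^sub>L Dbl F y0) = e" for e
  proof -
    have mp: "maximal_isotropic (pull (Dbl F y0) (\<Lambda> (F y0)))"
      by (rule maximal_isotropic_pull[OF mi[OF z0]])
    obtain X \<eta> where X: "(Dbl F y0 X, \<eta>) \<in> \<Lambda> (F y0)" "gvec (X, \<eta> o\<^sub>L Dbl F y0) = e"
      using gvec_surj[OF mp, of e] unfolding pull_def by blast
    have A0: "A (F y0) (gvec (Dbl F y0 X, \<eta>)) = (Dbl F y0 X, \<eta>)" using Am[OF Z'(2) X(1)] .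
    then have "\<Phi> y0 (gvec (Dbl F y0 X, \<eta>), X) = 0" by (simp add: \<Phi>_def)
    have "\<exists>T s. open T \<and> y0 \<in> T \<and> T \<subseteq> \<Omega>' \<and> smooth_on T s \<and> s y0 = (gvec (Dbl F y0 X, \<eta>), X) \<and> (\<forall>y\<in>T. \<Phi> y (s y) = 0)"
      by (rule constant_rank_kernel_section[OF \<Omega>'(1,2) lin\<Phi> s\<Phi> _ \<open>\<Phi> y0 _ = 0\<close>]) (erule rk)
    then obtain T s where "open T \<and> y0 \<in> T \<and> T \<subseteq> \<Omega>' \<and> smooth_on T s \<and> s y0 = (gvec (Dbl F y0 X, \<eta>), X) \<and> (\<forall>y\<in>T. \<Phi> y (s y) = 0)"
      by (elim exE) (rule that)
    then show ?thesis using A0 X(2) by (intro exI[of _ T] exI[of _ s]) simp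
  qed
  then obtain TT ss where *: "open (TT e) \<and> y0 \<in> TT e \<and> TT e \<subseteq> \<Omega>' \<and> smooth_on (TT e) (ss e) \<and>
      (\<forall>y\<in>TT e. \<Phi> y (ss e y) = 0) \<and> gvec (snd (ss e y0), snd (A (F y0) (fst (ss e y0))) o\<^sub>L Dbl F y0) = e" for e
    by metis
  define T1 where "T1 = \<Omega>' \<inter> (\<Inter>e\<in>onb. TT e)"
  have T1: "open T1" "y0 \<in> T1" "T1 \<subseteq> \<Omega>'"
    unfolding T1_def using * \<Omega>' by (auto intro!: open_Int open_INT)
  define \<alpha> where "\<alpha> = (\<lambda>e y. A (F y) (fst (ss e y)))"
  define b where "b = (\<lambda>e y. (snd (ss e y), snd (\<alpha> e y) o\<^sub>L Dbl F y))"
  have FT1: "F y \<in> Z'" if "y \<in> T1" for y using that T1 \<Omega>' by blast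
  have sss: "smooth_on T1 (ss e)" if "e \<in> onb" for e
  proof (rule smooth_on_subset)
    show "smooth_on (TT e) (ss e)" using *[of e] by simp
    show "T1 \<subseteq> TT e" unfolding T1_def using that by blast
  qed
  have s\<alpha>: "smooth_on T1 (\<alpha> e)" if e: "e \<in> onb" for e
    unfolding \<alpha>_def A_def
    by (intro smooth_on_sum smooth_on_scaleR smooth_on_inner smooth_on_subset[OF smF T1(3)]
        smooth_on_subset[OF slF T1(3)] smooth_on_fst[OF T1(1) sss[OF e]] T1(1))
  have sb: "smooth_on T1 (b e)" if e: "e \<in> onb" for e
    unfolding b_def
    by (intro smooth_on_Pair smooth_on_snd[OF T1(1) sss[OF e]] smooth_on_blinfun_compose
        smooth_on_snd[OF T1(1) s\<alpha>[OF e]] smooth_on_subset[OF sDF T1(3)] T1(1))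
  have gb0: "gvec (b e y0) = e" for e using *[of e] by (simp add: b_def \<alpha>_def)
  have ker: "\<Phi> y (ss e y) = 0" if "y \<in> T1" "e \<in> onb" for y e
    using *[of e] that unfolding T1_def by blast
  have f\<alpha>: "fst (\<alpha> e y) = Dbl F y (fst (b e y))" if "y \<in> T1" "e \<in> onb" for y e
    using ker[OF that] by (simp add: \<Phi>_def \<alpha>_def b_def)
  have \<alpha>L: "\<alpha> e y \<in> \<Lambda> (F y)" if "y \<in> T1" for y e
    unfolding \<alpha>_def by (rule AL[OF FT1[OF that]])
  have bp: "b e y \<in> pull (Dbl F y) (\<Lambda> (F y))" if "y \<in> T1" "e \<in> onb" for y e
  proof -
    have "(Dbl F y (fst (b e y)), snd (\<alpha> e y)) \<in> \<Lambda> (F y)"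
      using \<alpha>L[OF that(1), of e] unfolding f\<alpha>[OF that, symmetric] by simp
    from pullI[OF this] show ?thesis by (simp add: b_def)
  qed
  have sgb: "smooth_on T1 (\<lambda>y. gvec (b e y))" if "e \<in> onb" for e
    by (rule smooth_on_bounded_linear[OF T1(1) bounded_linear_gvec sb[OF that]])
  have indb: "\<forall>e\<in>onb. c e = 0" if "(\<Sum>e\<in>onb. c e *\<^sub>R gvec (b e y0)) = 0" for c :: "'u \<Rightarrow> real"
    using that independentD[OF independent_onb finite_onb order_refl, of c] unfolding gb0 by blast
  obtain T d where T: "open T" "y0 \<in> T" "T \<subseteq> T1" and sd: "\<And>e. e \<in> onb \<Longrightarrow> smooth_on T (d e)"
    and dual: "\<And>y e e'. y \<in> T \<Longrightarrow> e \<in> onb \<Longrightarrow> e' \<in> onb \<Longrightarrow> d e y \<bullet> gvec (b e' y) = (if e = e' then 1 else 0)"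
    by (rule smooth_dual_frame[OF finite_onb T1(1,2), of "\<lambda>e y. gvec (b e y)"]) (erule sgb, erule indb, rule that)
  \<comment> \<open>Both sides lie in the pulled-back fibre, where \<open>gvec\<close> is injective,
    so it is enough to compare them in \<open>'u\<close>.\<close>
  have expand: "t = (\<Sum>e\<in>onb. (d e y \<bullet> gvec t) *\<^sub>R b e y)" if y: "y \<in> T" and t: "t \<in> pull (Dbl F y) (\<Lambda> (F y))" for y t
  proof (rule gvec_inj_on[OF _ t])
    have yT1: "y \<in> T1" using y T by blast
    show iso: "isotropic (pull (Dbl F y) (\<Lambda> (F y)))"
      using isotropic_pull[OF maximal_isotropicD[OF mi]] FT1[OF yT1] Z' by blast
    show "(\<Sum>e\<in>onb. (d e y \<bullet> gvec t) *\<^sub>R b e y) \<in> pull (Dbl F y) (\<Lambda> (F y))"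
      by (intro subspace_sum subspace_scale isotropic_subspace[OF iso] bp[OF yT1])
    show "gvec t = gvec (\<Sum>e\<in>onb. (d e y \<bullet> gvec t) *\<^sub>R b e y)"
      unfolding linear_sum[OF linear_gvec] linear_scale[OF linear_gvec]
      by (rule dual_span_UNIV[OF dual[OF y]])
  qed
  have TO: "T \<subseteq> \<Omega>" using T(3) T1(3) \<Omega>'(3) by blast
  have "lift_frame T F (\<lambda>y. \<Lambda> (F y)) d b \<alpha>"
    unfolding lift_frame_def
  proof (intro conjI ballI)
    fix e :: 'u assume e: "e \<in> onb"
    show "smooth_on T (d e)" by (rule sd[OF e])
    show "smooth_on T (b e)" "smooth_on T (\<alpha> e)" using smooth_on_subset[OF _ T(3)] sb[OF e] s\<alpha>[OF e] by blast+
  next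
    fix y and e :: 'u assume y: "y \<in> T" and e: "e \<in> onb"
    have y1: "y \<in> T1" using y T(3) by blast
    show "\<alpha> e y \<in> \<Lambda> (F y)" by (rule \<alpha>L[OF y1])
    show "relates (Dbl F y) (\<alpha> e y) (b e y)" using f\<alpha>[OF y1 e] by (simp add: relates_def b_def)
  qed (erule (2) dual, erule (1) expand)
  then show thesis by (rule that[OF T(1,2) TO])
qed


section \<open>Change of charts\<close>

definition gtrans :: "('m, 'e::real_normed_vector) chart \<Rightarrow> ('m, 'e) chart \<Rightarrow> 'm \<Rightarrow> 'e gtangent \<Rightarrow> 'e gtangent" where
  "gtrans c d p a = (trans_deriv c d p (fst a), snd a o\<^sub>L trans_deriv d c p)"

text \<open>The case \<open>f = id\<close> gives the representatives of ordinary sections.\<close>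

definition along_rep :: "('m, 'e::real_normed_vector) chart set \<Rightarrow> ('n \<Rightarrow> 'm) \<Rightarrow> ('n, 'u::real_normed_vector) chart \<Rightarrow>
    ('m, 'e) chart \<Rightarrow> ('n \<Rightarrow> 'e gtangent) \<Rightarrow> 'u \<Rightarrow> 'e gtangent" where
  "along_rep A f c d a y =
    (let x = chart_inv c y in gtrans (chart_at A (f x)) d (f x) (a x))"

abbreviation sec_rep :: "('m, 'e::real_normed_vector) chart set \<Rightarrow> ('m, 'e) chart \<Rightarrow> ('m \<Rightarrow> 'e gtangent) \<Rightarrow> 'e \<Rightarrow> 'e gtangent" where
  "sec_rep A c s \<equiv> along_rep A id c c s"

lemma dirac_pullback_eq: "dirac_pullback AN A f L x = pull (tangent_map AN A f x) (L (f x))"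
  by (simp add: dirac_pullback_def pull_def)

lemma trans_deriv_eq: "trans_deriv c d p = Dbl (snd d \<circ> id \<circ> chart_inv c) (snd c p)"
  by (simp add: trans_deriv_def Dbl_def)

lemma tangent_map_eq: "tangent_map AN A f x =
    Dbl (snd (chart_at A (f x)) \<circ> f \<circ> chart_inv (chart_at AN x)) (snd (chart_at AN x) x)"
  by (simp add: tangent_map_def Dbl_def)

lemma blinfun_compose_assoc: "(a o\<^sub>L b) o\<^sub>L c = a o\<^sub>L (b o\<^sub>L c)"
  by (rule blinfun_eqI) simp

lemma blinfun_compose_id: "a o\<^sub>L id_blinfun = a"
  by (rule blinfun_eqI) simp

lemma linear_gtrans: "linear (gtrans c d p)"
  by (rule linearI) (simp_all add: gtrans_def blinfun.bilinear_simps
      bounded_bilinear.add_left[OF bounded_bilinear_blinfun_compose]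
      bounded_bilinear.scaleR_left[OF bounded_bilinear_blinfun_compose])

lemma chart_chain_rule:
  assumes "open S" "snd c x \<in> S" "chart_inv c (snd c x) = x"
    and "\<And>y. y \<in> S \<Longrightarrow> chart_inv d (snd d (f (chart_inv c y))) = f (chart_inv c y)"
    and "(snd d \<circ> f \<circ> chart_inv c) differentiable (at (snd c x))"
    and "(snd e \<circ> g \<circ> chart_inv d) differentiable (at (snd d (f x)))"
  shows "Dbl (snd e \<circ> (g \<circ> f) \<circ> chart_inv c) (snd c x) =
    Dbl (snd e \<circ> g \<circ> chart_inv d) (snd d (f x)) o\<^sub>L Dbl (snd d \<circ> f \<circ> chart_inv c) (snd c x)"
proof -
  let ?F = "snd d \<circ> f \<circ> chart_inv c" and ?G = "snd e \<circ> g \<circ> chart_inv d"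
  have Fx: "?F (snd c x) = snd d (f x)" using assms(3) by simp
  have dG: "?G differentiable (at (?F (snd c x)))" unfolding Fx by (rule assms(6))
  have "Dbl (snd e \<circ> (g \<circ> f) \<circ> chart_inv c) (snd c x) = Dbl (\<lambda>y. ?G (?F y)) (snd c x)"
    by (rule Dbl_cong[OF assms(1,2)])
       (use assms(4) differentiable_chain_at[OF assms(5) dG] in \<open>auto simp: o_def\<close>)
  also have "\<dots> = Dbl ?G (?F (snd c x)) o\<^sub>L Dbl ?F (snd c x)" by (rule Dbl_compose[OF assms(5) dG])
  finally show ?thesis unfolding Fx .
qed

locale smooth_manifold =
  fixes A :: "('m::{t2_space, second_countable_topology}, 'e::fd_euclidean) chart set"
  assumes atlas: "smooth_atlas A"
begin

lemma chart_at: "chart_at A p \<in> A" "p \<in> fst (chart_at A p)"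
proof -
  have "\<exists>c. c \<in> A \<and> p \<in> fst c" using atlas unfolding smooth_atlas_def by blast
  from someI_ex[OF this] show "chart_at A p \<in> A" "p \<in> fst (chart_at A p)"
    unfolding chart_at_def by blast+
qed

lemma chart_open: "c \<in> A \<Longrightarrow> open (fst c)"
  and chart_homeo: "c \<in> A \<Longrightarrow> homeomorphism (fst c) (snd c ` fst c) (snd c) (chart_inv c)"
  and chart_image_open: "c \<in> A \<Longrightarrow> open (snd c ` fst c)"
  using atlas unfolding smooth_atlas_def by blast+

lemma chart_inv [simp]: "c \<in> A \<Longrightarrow> x \<in> fst c \<Longrightarrow> chart_inv c (snd c x) = x"
  using chart_homeo unfolding homeomorphism_def by blast

lemma chart_continuous: "c \<in> A \<Longrightarrow> continuous_on (fst c) (snd c)"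
  and chart_inv_continuous: "c \<in> A \<Longrightarrow> continuous_on (snd c ` fst c) (chart_inv c)"
  using chart_homeo unfolding homeomorphism_def by blast+

lemma image_open:
  assumes "c \<in> A" "open V" "V \<subseteq> fst c"
  shows "open (snd c ` V)"
proof -
  have "openin (top_of_set (fst c)) V" using assms chart_open by (simp add: openin_open_eq)
  from homeomorphism_imp_open_map[OF chart_homeo[OF assms(1)] this] show ?thesis
    using chart_image_open[OF assms(1)] openin_open_trans by blast
qed

lemma trans_smooth: "c \<in> A \<Longrightarrow> d \<in> A \<Longrightarrow> smooth_on (snd c ` (fst c \<inter> fst d)) (snd d \<circ> id \<circ> chart_inv c)"
  using atlas unfolding smooth_atlas_def by auto

lemma trans_image_open: "c \<in> A \<Longrightarrow> d \<in> A \<Longrightarrow> open (snd c ` (fst c \<inter> fst d))"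
  by (intro image_open open_Int chart_open) auto

lemma trans_differentiable:
  assumes "c \<in> A" "d \<in> A" "p \<in> fst c" "p \<in> fst d"
  shows "(snd d \<circ> id \<circ> chart_inv c) differentiable (at (snd c p))"
  by (rule smooth_on_differentiable[OF trans_smooth[OF assms(1,2)]]) (use assms in blast)

lemma trans_deriv_comp:
  assumes "c \<in> A" "d \<in> A" "e \<in> A" "p \<in> fst c" "p \<in> fst d" "p \<in> fst e"
  shows "trans_deriv d e p o\<^sub>L trans_deriv c d p = trans_deriv c e p"
proof -
  have "Dbl (snd e \<circ> (id \<circ> id) \<circ> chart_inv c) (snd c p) =
    Dbl (snd e \<circ> id \<circ> chart_inv d) (snd d (id p)) o\<^sub>L Dbl (snd d \<circ> id \<circ> chart_inv c) (snd c p)"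
    by (rule chart_chain_rule[OF trans_image_open[OF assms(1,2)] _ _ _ trans_differentiable])
       (use assms trans_differentiable[OF assms(2,3,5,6)] in auto)
  then show ?thesis by (simp add: trans_deriv_eq)
qed

lemma trans_deriv_self:
  assumes "c \<in> A" "p \<in> fst c"
  shows "trans_deriv c c p = id_blinfun"
proof -
  have "((\<lambda>y. y) has_derivative blinfun_apply id_blinfun) (at (snd c p))" by simp
  then have "((snd c \<circ> id \<circ> chart_inv c) has_derivative blinfun_apply id_blinfun) (at (snd c p))"
    by (rule has_derivative_transform_within_open[OF _ chart_image_open[OF assms(1)]])
       (use assms in auto)
  then show ?thesis unfolding trans_deriv_eq by (rule Dbl_eqI)
qed

lemma gtrans_comp:
  assumes "c \<in> A" "d \<in> A" "e \<in> A" "p \<in> fst c" "p \<in> fst d" "p \<in> fst e"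
  shows "gtrans d e p (gtrans c d p a) = gtrans c e p a"
  using trans_deriv_comp[OF assms] trans_deriv_comp[OF assms(3,2,1,6,5,4)]
  by (auto simp: gtrans_def blinfun_compose_assoc blinfun_apply_blinfun_compose[symmetric]
      simp del: blinfun_apply_blinfun_compose)

lemma gtrans_self: "c \<in> A \<Longrightarrow> p \<in> fst c \<Longrightarrow> gtrans c c p a = a"
  by (simp add: gtrans_def trans_deriv_self prod_eq_iff blinfun_eqI)

text \<open>For an invertible derivative the relation becomes the graph of a map. Thus invariance of
  the bracket under a change of chart is a case of its naturality.\<close>

lemma relates_gtrans_iff:
  assumes "c \<in> A" "d \<in> A" "p \<in> fst c" "p \<in> fst d"
  shows "relates (trans_deriv c d p) b a \<longleftrightarrow> b = gtrans c d p a"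
proof -
  have "trans_deriv c d p o\<^sub>L trans_deriv d c p = id_blinfun" "trans_deriv d c p o\<^sub>L trans_deriv c d p = id_blinfun"
    using assms by (simp_all add: trans_deriv_comp trans_deriv_self)
  then have "\<xi> o\<^sub>L trans_deriv c d p o\<^sub>L trans_deriv d c p = \<xi>" "\<xi> o\<^sub>L trans_deriv d c p o\<^sub>L trans_deriv c d p = \<xi>"
    for \<xi> :: "'e \<Rightarrow>\<^sub>L real"
    by (simp_all add: blinfun_compose_assoc blinfun_compose_id)
  then show ?thesis by (auto simp: relates_def gtrans_def prod_eq_iff)
qed

lemma pairing_gtrans:
  assumes "c \<in> A" "d \<in> A" "p \<in> fst c" "p \<in> fst d"
  shows "pairing (gtrans c d p a) (gtrans c d p b) = pairing a b"
proof -
  have "trans_deriv d c p (trans_deriv c d p v) = v" for v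
    using trans_deriv_comp[OF assms(1,2,1,3,4,3)] trans_deriv_self[OF assms(1,3)]
    by (metis blinfun_apply_blinfun_compose blinfun_apply_id_blinfun)
  then show ?thesis by (simp add: pairing_def gtrans_def)
qed

lemma maximal_isotropic_gtrans:
  assumes "c \<in> A" "d \<in> A" "p \<in> fst c" "p \<in> fst d" "maximal_isotropic V"
  shows "maximal_isotropic (gtrans c d p ` V)"
proof (rule maximal_isotropicI)
  have V: "isotropic V" using assms(5) by (rule maximal_isotropicD)
  show "isotropic (gtrans c d p ` V)"
    using linear_subspace_image[OF linear_gtrans isotropic_subspace[OF V], of c d p] isotropic_pairing[OF V]
    by (auto simp: isotropic_def pairing_gtrans[OF assms(1-4)])
  fix a assume a: "\<And>b. b \<in> gtrans c d p ` V \<Longrightarrow> pairing a b = 0"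
  have eq: "gtrans c d p (gtrans d c p a) = a"
    using gtrans_comp[OF assms(2,1,2,4,3,4)] gtrans_self[OF assms(2,4)] by simp
  have "gtrans d c p a \<in> V"
  proof (rule maximal_isotropic_perp[OF assms(5)])
    fix b assume "b \<in> V"
    then have "pairing a (gtrans c d p b) = 0" by (intro a imageI)
    then show "pairing (gtrans d c p a) b = 0"
      using pairing_gtrans[OF assms(1-4), of "gtrans d c p a" b] by (simp add: eq)
  qed
  then show "a \<in> gtrans c d p ` V" using eq by force
qed

text \<open>The base point is allowed to move along \<open>h\<close>, because a section along a map
  is transported at the image point.\<close>

lemma smooth_on_gtrans:
  fixes h :: "'w::real_normed_vector \<Rightarrow> 'e"
  assumes "c \<in> A" "d \<in> A" "open W" "smooth_on W h" "h ` W \<subseteq> snd c ` (fst c \<inter> fst d)" "smooth_on W S"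
  shows "smooth_on W (\<lambda>y. gtrans c d (chart_inv c (h y)) (S y))"
proof -
  note o1 = trans_image_open[OF assms(1,2)] and o2 = trans_image_open[OF assms(2,1)]
  let ?t = "snd d \<circ> id \<circ> chart_inv c"
  have h: "chart_inv c (h y) \<in> fst c \<inter> fst d" "snd c (chart_inv c (h y)) = h y" if "y \<in> W" for y
    using assms(1,5) that by auto
  have 1: "smooth_on W (\<lambda>y. trans_deriv c d (chart_inv c (h y)))"
    by (rule smooth_on_cong[OF assms(3) _ smooth_on_compose[OF assms(3) o1 assms(5,4)
            smooth_on_Dbl[OF o1 trans_smooth[OF assms(1,2)]]]])
       (simp add: trans_deriv_eq h)
  have th: "smooth_on W (\<lambda>y. ?t (h y))"
    by (rule smooth_on_compose[OF assms(3) o1 assms(5,4) trans_smooth[OF assms(1,2)]])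
  have thW: "(\<lambda>y. ?t (h y)) ` W \<subseteq> snd d ` (fst d \<inter> fst c)" using h by auto
  have 2: "smooth_on W (\<lambda>y. trans_deriv d c (chart_inv c (h y)))"
    by (rule smooth_on_cong[OF assms(3) _ smooth_on_compose[OF assms(3) o2 thW th
            smooth_on_Dbl[OF o2 trans_smooth[OF assms(2,1)]]]])
       (simp add: trans_deriv_eq)
  show ?thesis
    unfolding gtrans_def
    by (intro smooth_on_Pair smooth_on_blinfun_apply smooth_on_blinfun_compose 1 2
        smooth_on_fst[OF assms(3,6)] smooth_on_snd[OF assms(3,6)] assms(3))
qed

end

section \<open>Local expressions of a smooth map and sections along it\<close>

locale manifold_map = B: smooth_manifold AB + M: smooth_manifold AM
  for AB :: "('b::{t2_space, second_countable_topology}, 'u::fd_euclidean) chart set"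
    and AM :: "('m::{t2_space, second_countable_topology}, 'e::fd_euclidean) chart set" +
  fixes f :: "'b \<Rightarrow> 'm"
  assumes smooth_f: "smooth_map AB AM f"
begin

definition loc :: "('b, 'u) chart \<Rightarrow> ('m, 'e) chart \<Rightarrow> 'u \<Rightarrow> 'e" where
  "loc c d = snd d \<circ> f \<circ> chart_inv c"

definition dom :: "('b, 'u) chart \<Rightarrow> ('m, 'e) chart \<Rightarrow> 'b set" where
  "dom c d = fst c \<inter> f -` fst d"

lemma open_vimage_f: "open V \<Longrightarrow> open (f -` V)"
  using smooth_f unfolding smooth_map_def by (simp add: open_vimage)

lemma open_dom: "c \<in> AB \<Longrightarrow> d \<in> AM \<Longrightarrow> open (dom c d)"
  unfolding dom_def by (intro open_Int open_vimage_f B.chart_open M.chart_open)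

lemma open_image_dom: "c \<in> AB \<Longrightarrow> d \<in> AM \<Longrightarrow> open (snd c ` dom c d)"
  by (intro B.image_open open_dom) (auto simp: dom_def)

lemma smooth_loc: "c \<in> AB \<Longrightarrow> d \<in> AM \<Longrightarrow> smooth_on (snd c ` dom c d) (loc c d)"
  using smooth_f unfolding smooth_map_def loc_def dom_def by blast

lemma loc_apply: "c \<in> AB \<Longrightarrow> x \<in> fst c \<Longrightarrow> loc c d (snd c x) = snd d (f x)"
  by (simp add: loc_def)

lemma tangent_map_loc: "tangent_map AB AM f x = Dbl (loc (chart_at AB x) (chart_at AM (f x))) (snd (chart_at AB x) x)"
  by (simp add: tangent_map_eq loc_def)

text \<open>Both sides are the derivative of \<open>f\<close> read from \<open>c\<close> to
  \<open>d'\<close>, factored once through \<open>d\<close> and once through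
  \<open>c'\<close>.\<close>

lemma Dbl_loc_change:
  assumes "c \<in> AB" "c' \<in> AB" "d \<in> AM" "d' \<in> AM" "x \<in> dom c d" "x \<in> dom c' d'"
  shows "trans_deriv d d' (f x) o\<^sub>L Dbl (loc c d) (snd c x) = Dbl (loc c' d') (snd c' x) o\<^sub>L trans_deriv c c' x"
proof -
  have x: "x \<in> fst c" "x \<in> fst c'" "f x \<in> fst d" "f x \<in> fst d'" using assms by (auto simp: dom_def)
  have dl: "loc c d differentiable (at (snd c x))" if "c \<in> AB" "d \<in> AM" "x \<in> dom c d" for c d
    by (rule smooth_on_differentiable[OF smooth_loc[OF that(1,2)] imageI[OF that(3)]])
  have "Dbl (snd d' \<circ> (id \<circ> f) \<circ> chart_inv c) (snd c x) =
      Dbl (snd d' \<circ> id \<circ> chart_inv d) (snd d (f x)) o\<^sub>L Dbl (snd d \<circ> f \<circ> chart_inv c) (snd c x)"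
  proof (rule chart_chain_rule)
    show "open (snd c ` dom c d)" using assms open_image_dom by blast
    show "snd c x \<in> snd c ` dom c d" using assms by blast
    show "chart_inv c (snd c x) = x" using x assms by simp
    show "chart_inv d (snd d (f (chart_inv c y))) = f (chart_inv c y)" if "y \<in> snd c ` dom c d" for y
      using that assms by (auto simp: dom_def)
    show "(snd d \<circ> f \<circ> chart_inv c) differentiable at (snd c x)"
      using dl assms unfolding loc_def by blast
    show "(snd d' \<circ> id \<circ> chart_inv d) differentiable at (snd d (f x))"
      by (rule smooth_on_differentiable[OF M.trans_smooth]) (use assms x in auto)
  qed
  moreover have "Dbl (snd d' \<circ> (f \<circ> id) \<circ> chart_inv c) (snd c x) =
      Dbl (snd d' \<circ> f \<circ> chart_inv c') (snd c' (id x)) o\<^sub>L Dbl (snd c' \<circ> id \<circ> chart_inv c) (snd c x)"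
  proof (rule chart_chain_rule)
    show "open (snd c ` (fst c \<inter> fst c'))" using assms B.trans_image_open by blast
    show "snd c x \<in> snd c ` (fst c \<inter> fst c')" using x by blast
    show "chart_inv c (snd c x) = x" using x assms by simp
    show "chart_inv c' (snd c' (id (chart_inv c y))) = id (chart_inv c y)" if "y \<in> snd c ` (fst c \<inter> fst c')" for y
      using that assms by auto
    show "(snd c' \<circ> id \<circ> chart_inv c) differentiable at (snd c x)"
      by (rule smooth_on_differentiable[OF B.trans_smooth]) (use assms x in auto)
    show "(snd d' \<circ> f \<circ> chart_inv c') differentiable at (snd c' (id x))"
      using dl[of c' d'] assms unfolding loc_def by simp
  qed
  ultimately show ?thesis by (simp add: trans_deriv_eq loc_def)
qed

lemma relates_change:
  assumes "c \<in> AB" "c' \<in> AB" "d \<in> AM" "d' \<in> AM" "x \<in> dom c d" "x \<in> dom c' d'"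
    and "relates (Dbl (loc c d) (snd c x)) a t"
  shows "relates (Dbl (loc c' d') (snd c' x)) (gtrans d d' (f x) a) (gtrans c c' x t)"
proof -
  have x: "x \<in> fst c" "x \<in> fst c'" "f x \<in> fst d" "f x \<in> fst d'" using assms by (auto simp: dom_def)
  let ?D = "Dbl (loc c' d') (snd c' x)"
  have r: "relates (trans_deriv d d' (f x)) (gtrans d d' (f x) a) a"
    using M.relates_gtrans_iff[OF assms(3,4) x(3,4)] by blast
  have 1: "relates (?D o\<^sub>L trans_deriv c c' x) (gtrans d d' (f x) a) t"
    using relates_compose[OF assms(7) r] unfolding Dbl_loc_change[OF assms(1-6)] .
  have "relates (trans_deriv c' c x) t (gtrans c c' x t)"
    unfolding B.relates_gtrans_iff[OF assms(2,1) x(2,1)] using assms x by (simp add: B.gtrans_comp B.gtrans_self)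
  from relates_compose[OF this 1] show ?thesis
    using assms x by (simp add: blinfun_compose_assoc B.trans_deriv_comp B.trans_deriv_self blinfun_compose_id)
qed

lemma along_rep_change:
  assumes "c \<in> AB" "c' \<in> AB" "d \<in> AM" "d' \<in> AM" "x \<in> dom c d" "x \<in> dom c' d'"
  shows "along_rep AM f c' d' a (snd c' x) = gtrans d d' (f x) (along_rep AM f c d a (snd c x))"
proof -
  have x: "x \<in> fst c" "x \<in> fst c'" "f x \<in> fst d" "f x \<in> fst d'" using assms by (auto simp: dom_def)
  show ?thesis
    unfolding along_rep_def Let_def
    using assms x by (simp add: M.gtrans_comp M.chart_at)
qed

definition smooth_along_at :: "('b \<Rightarrow> 'e gtangent) \<Rightarrow> 'b \<Rightarrow> bool" where
  "smooth_along_at a x \<longleftrightarrow> (\<exists>c\<in>AB. \<exists>d\<in>AM. \<exists>W. open W \<and> x \<in> W \<and> W \<subseteq> dom c d \<and>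
     smooth_on (snd c ` W) (along_rep AM f c d a))"

definition smooth_along_on :: "'b set \<Rightarrow> ('b \<Rightarrow> 'e gtangent) \<Rightarrow> bool" where
  "smooth_along_on U a \<longleftrightarrow> (\<forall>c\<in>AB. \<forall>d\<in>AM. smooth_on (snd c ` (dom c d \<inter> U)) (along_rep AM f c d a))"

lemma smooth_along_atI:
  "c \<in> AB \<Longrightarrow> d \<in> AM \<Longrightarrow> open W \<Longrightarrow> x \<in> W \<Longrightarrow> W \<subseteq> dom c d \<Longrightarrow>
    smooth_on (snd c ` W) (along_rep AM f c d a) \<Longrightarrow> smooth_along_at a x"
  unfolding smooth_along_at_def by blast

text \<open>One convenient pair of charts around each point suffices. The representative in another
  pair arises by precomposing with a transition map of the source and applying a transition of the
  target, and both operations are smooth.\<close>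

lemma smooth_along_onI:
  assumes "open U" and at: "\<And>x. x \<in> U \<Longrightarrow> smooth_along_at a x"
  shows "smooth_along_on U a"
  unfolding smooth_along_on_def
proof (intro ballI smooth_on_localI)
  fix c d y assume cd': "c \<in> AB" "d \<in> AM" and "y \<in> snd c ` (dom c d \<inter> U)"
  then obtain x where x: "x \<in> dom c d" "x \<in> U" "y = snd c x" by blast
  from at[OF x(2)] obtain c0 d0 W where cd: "c0 \<in> AB" "d0 \<in> AM" and W: "open W" "x \<in> W" "W \<subseteq> dom c0 d0"
    and s: "smooth_on (snd c0 ` W) (along_rep AM f c0 d0 a)"
    unfolding smooth_along_at_def by blast
  define W' where "W' = W \<inter> dom c d"
  have W': "open W'" "x \<in> W'" "W' \<subseteq> fst c" "W' \<subseteq> fst c0" "W' \<subseteq> W" "W' \<subseteq> dom c d" "W' \<subseteq> dom c0 d0"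
    unfolding W'_def using W x open_dom[OF cd'] by (auto simp: dom_def)
  define T where "T = snd c ` W'"
  have T: "open T" "y \<in> T" unfolding T_def using W' x B.image_open[OF cd'(1)] by auto
  have inv: "chart_inv c z \<in> W'" "snd c (chart_inv c z) = z" if "z \<in> T" for z
    using that W' cd'(1) by (auto simp: T_def subset_iff)
  define h where "h = (\<lambda>z. snd c0 (chart_inv c z))"
  have hs: "smooth_on T h"
  proof -
    have "T \<subseteq> snd c ` (fst c \<inter> fst c0)" unfolding T_def using W' by blast
    from smooth_on_subset[OF B.trans_smooth[OF cd'(1) cd(1)] this] show ?thesis
      by (simp add: h_def o_def)
  qed
  have hT: "h ` T \<subseteq> snd c0 ` W'" using inv by (auto simp: h_def)
  have oW: "open (snd c0 ` W')" by (rule B.image_open[OF cd(1) W'(1,4)])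
  have sW: "smooth_on (snd c0 ` W') (along_rep AM f c0 d0 a)"
    by (rule smooth_on_subset[OF s]) (use W' in blast)
  have s1: "smooth_on T (\<lambda>z. along_rep AM f c0 d0 a (h z))"
    by (rule smooth_on_compose[OF T(1) oW hT hs sW])
  have W'd: "snd c0 ` W' \<subseteq> snd c0 ` dom c0 d0" using W' by blast
  have s2: "smooth_on T (\<lambda>z. loc c0 d0 (h z))"
    by (rule smooth_on_compose[OF T(1) oW hT hs smooth_on_subset[OF smooth_loc[OF cd] W'd]])
  have inv0: "chart_inv c0 (h z) = chart_inv c z" if "z \<in> T" for z
    using inv[OF that] W' cd(1) by (auto simp: h_def)
  have lf: "chart_inv d0 (loc c0 d0 (h z)) = f (chart_inv c z)" if "z \<in> T" for z
    using inv0[OF that] inv[OF that] W' cd(2) by (auto simp: loc_def dom_def)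
  have s2T: "(\<lambda>z. loc c0 d0 (h z)) ` T \<subseteq> snd d0 ` (fst d0 \<inter> fst d)"
  proof
    fix w assume "w \<in> (\<lambda>z. loc c0 d0 (h z)) ` T"
    then obtain z where z: "z \<in> T" "w = loc c0 d0 (h z)" by blast
    then have "w = snd d0 (f (chart_inv c z))" by (simp add: loc_def inv0)
    moreover have "f (chart_inv c z) \<in> fst d0 \<inter> fst d" using inv[OF z(1)] W' by (auto simp: dom_def)
    ultimately show "w \<in> snd d0 ` (fst d0 \<inter> fst d)" by blast
  qed
  have "smooth_on T (\<lambda>z. gtrans d0 d (chart_inv d0 (loc c0 d0 (h z))) (along_rep AM f c0 d0 a (h z)))"
    by (rule M.smooth_on_gtrans[OF cd(2) cd'(2) T(1) s2 s2T s1])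
  then have "smooth_on T (along_rep AM f c d a)"
  proof (rule smooth_on_cong[OF T(1), rotated])
    fix z assume z: "z \<in> T"
    have "chart_inv c z \<in> dom c0 d0" "chart_inv c z \<in> dom c d" using inv[OF z] W' by blast+
    from along_rep_change[OF cd(1) cd'(1) cd(2) cd'(2) this, of a]
    show "gtrans d0 d (chart_inv d0 (loc c0 d0 (h z))) (along_rep AM f c0 d0 a (h z)) = along_rep AM f c d a z"
      using inv[OF z] lf[OF z] by (simp add: h_def)
  qed
  with T show "\<exists>T. open T \<and> y \<in> T \<and> smooth_on T (along_rep AM f c d a)" by blast
qed

lemma smooth_gsection_along_iff: "smooth_gsection_along AB AM f a \<longleftrightarrow> smooth_along_on UNIV a"
proof -
  have "smooth_on (snd c ` (fst c \<inter> f -` fst d))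
          (\<lambda>y. let x = chart_inv c y in vec_in_chart AM d (f x) (fst (a x))) \<and>
        smooth_on (snd c ` (fst c \<inter> f -` fst d))
          (\<lambda>y. let x = chart_inv c y in covec_in_chart AM d (f x) (snd (a x)))
     \<longleftrightarrow> smooth_on (snd c ` dom c d) (along_rep AM f c d a)" (is "?l \<longleftrightarrow> ?r")
    if "c \<in> AB" "d \<in> AM" for c d
  proof -
    note op = open_image_dom[OF that]
    have eq: "along_rep AM f c d a = (\<lambda>y. (let x = chart_inv c y in vec_in_chart AM d (f x) (fst (a x)),
        let x = chart_inv c y in covec_in_chart AM d (f x) (snd (a x))))"
      by (rule ext) (simp add: along_rep_def gtrans_def vec_in_chart_def covec_in_chart_def Let_def)
    show ?thesis
    proof
      assume ?l
      then show ?r unfolding eq dom_def[symmetric] by (intro smooth_on_Pair op) auto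
    next
      assume ?r
      from smooth_on_fst[OF op this] smooth_on_snd[OF op this] show ?l
        unfolding eq dom_def[symmetric] by simp
    qed
  qed
  then show ?thesis unfolding smooth_gsection_along_def smooth_along_on_def by simp
qed

end

section \<open>Ordinary sections and their Courant bracket\<close>

context smooth_manifold
begin

text \<open>Ordinary sections are sections along the identity, so locality of smoothness and cutting
  off are proved only for sections along maps.\<close>

lemma manifold_map_id: "manifold_map A A id"
  by unfold_locales (use atlas in \<open>auto simp: smooth_map_def smooth_atlas_def\<close>)

lemma sec_rep_change:
  assumes "c \<in> A" "d \<in> A" "p \<in> fst c" "p \<in> fst d"
  shows "sec_rep A d s (snd d p) = gtrans c d p (sec_rep A c s (snd c p))"
proof -
  interpret I: manifold_map A A id by (rule manifold_map_id)
  show ?thesis using I.along_rep_change[OF assms(1,2,1,2), of p s] assms by (simp add: I.dom_def)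
qed

lemma sec_rep_at: "c \<in> A \<Longrightarrow> p \<in> fst c \<Longrightarrow> sec_rep A c s (snd c p) = gtrans (chart_at A p) c p (s p)"
  by (simp add: along_rep_def)

lemma smooth_gsection_on_iff:
  assumes "open U"
  shows "smooth_gsection_on A U s \<longleftrightarrow> (\<forall>c\<in>A. smooth_on (snd c ` (fst c \<inter> U)) (sec_rep A c s))"
proof -
  have "smooth_on (snd c ` (fst c \<inter> U)) (vec_rep A c (fst \<circ> s)) \<and>
        smooth_on (snd c ` (fst c \<inter> U)) (form_rep A c (snd \<circ> s)) \<longleftrightarrow>
        smooth_on (snd c ` (fst c \<inter> U)) (sec_rep A c s)" (is "?l \<longleftrightarrow> ?r") if "c \<in> A" for c
  proof -
    have op: "open (snd c ` (fst c \<inter> U))"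
      by (intro image_open open_Int chart_open assms that) auto
    have eq: "sec_rep A c s = (\<lambda>y. (vec_rep A c (fst \<circ> s) y, form_rep A c (snd \<circ> s) y))"
      by (rule ext) (simp add: along_rep_def gtrans_def vec_rep_def form_rep_def vec_in_chart_def covec_in_chart_def Let_def)
    show ?thesis
    proof
      assume ?l
      then show ?r unfolding eq by (intro smooth_on_Pair op) auto
    next
      assume ?r
      from smooth_on_fst[OF op this] smooth_on_snd[OF op this] show ?l
        unfolding eq by simp
    qed
  qed
  then show ?thesis
    unfolding smooth_gsection_on_def smooth_vector_field_on_def smooth_form_on_def by blast
qed

lemma smooth_gsection_onD:
  assumes "smooth_gsection_on A U s" "open U" "c \<in> A"
  shows "smooth_on (snd c ` (fst c \<inter> U)) (sec_rep A c s)"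
  using assms smooth_gsection_on_iff by blast

lemma smooth_gsection_on_localI:
  assumes "open U"
    and "\<And>p. p \<in> U \<Longrightarrow> \<exists>c\<in>A. \<exists>W. open W \<and> p \<in> W \<and> W \<subseteq> fst c \<and> smooth_on (snd c ` W) (sec_rep A c s)"
  shows "smooth_gsection_on A U s"
proof -
  interpret I: manifold_map A A id by (rule manifold_map_id)
  have "I.smooth_along_on U s"
  proof (rule I.smooth_along_onI[OF assms(1)])
    fix x assume "x \<in> U"
    from assms(2)[OF this] obtain c W where "c \<in> A" "open W" "x \<in> W" "W \<subseteq> fst c" "smooth_on (snd c ` W) (sec_rep A c s)"
      by blast
    then show "I.smooth_along_at s x" by (intro I.smooth_along_atI[of c c W]) (auto simp: I.dom_def)
  qed
  then have "smooth_on (snd c ` (fst c \<inter> U)) (sec_rep A c s)" if "c \<in> A" for c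
    using that unfolding I.smooth_along_on_def by (force simp: I.dom_def)
  then show ?thesis unfolding smooth_gsection_on_iff[OF assms(1)] by blast
qed

text \<open>The inverse operation to \<open>sec_rep\<close>; its values are meaningful on the domain
  of \<open>c\<close>.\<close>

definition of_rep :: "('m, 'e) chart \<Rightarrow> ('e \<Rightarrow> 'e gtangent) \<Rightarrow> 'm \<Rightarrow> 'e gtangent" where
  "of_rep c S p = gtrans c (chart_at A p) p (S (snd c p))"

lemma sec_rep_of_rep:
  assumes "c \<in> A" "p \<in> fst c"
  shows "sec_rep A c (of_rep c S) (snd c p) = S (snd c p)"
  using assms by (simp add: sec_rep_at of_rep_def gtrans_comp gtrans_self chart_at)

lemma smooth_of_rep:
  assumes "c \<in> A" "open W" "W \<subseteq> fst c" "smooth_on (snd c ` W) S"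
  shows "smooth_gsection_on A W (of_rep c S)"
proof (rule smooth_gsection_on_localI[OF assms(2)])
  fix p assume "p \<in> W"
  moreover have "smooth_on (snd c ` W) (sec_rep A c (of_rep c S))"
    by (rule smooth_on_cong[OF image_open[OF assms(1-3)] _ assms(4)])
       (use sec_rep_of_rep[OF assms(1)] assms(3) in auto)
  ultimately show "\<exists>d\<in>A. \<exists>W. open W \<and> p \<in> W \<and> W \<subseteq> fst d \<and> smooth_on (snd d ` W) (sec_rep A d (of_rep c S))"
    using assms by blast
qed

subsection \<open>The Courant bracket in an arbitrary chart\<close>

lemma sec_rep_differentiable:
  assumes "smooth_gsection_on A U s" "open U" "p \<in> U" "c \<in> A" "p \<in> fst c"
  shows "sec_rep A c s differentiable (at (snd c p))"
  by (rule smooth_on_differentiable[OF smooth_gsection_onD[OF assms(1,2,4)]]) (use assms in blast)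

lemma courant_bracket_coord_courant:
  assumes "smooth_gsection_on A U s" "smooth_gsection_on A U t" "open U" "p \<in> U"
  shows "courant_bracket A s t p = coord_courant (sec_rep A (chart_at A p) s) (sec_rep A (chart_at A p) t) (snd (chart_at A p) p)"
proof -
  let ?c = "chart_at A p"
  let ?y = "snd ?c p" and ?S = "sec_rep A ?c s" and ?T = "sec_rep A ?c t"
  have at: "sec_rep A ?c s ?y = s p" for s
    using chart_at gtrans_self by (simp add: sec_rep_at)
  have v: "vec_rep A ?c (fst \<circ> s) = (\<lambda>y. fst (sec_rep A ?c s y))"
    and w: "form_rep A ?c (snd \<circ> s) = (\<lambda>y. snd (sec_rep A ?c s y))" for s
    by (auto simp: along_rep_def gtrans_def vec_rep_def form_rep_def vec_in_chart_def covec_in_chart_def Let_def)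
  have df: "frechet_derivative (\<lambda>y. fst (sec_rep A ?c s y)) (at ?y) = (\<lambda>w. fst (Dbl (sec_rep A ?c s) ?y w))"
    and ds: "frechet_derivative (\<lambda>y. snd (sec_rep A ?c s y)) (at ?y) = (\<lambda>w. snd (Dbl (sec_rep A ?c s) ?y w))"
    if "smooth_gsection_on A U s" for s
    using Dbl_has_derivative[OF sec_rep_differentiable[OF that assms(3,4) chart_at]]
    by (auto intro!: frechet_derivative_eqI has_derivative_fst has_derivative_snd)
  have "Blinfun (\<lambda>w. fst (Dbl ?S ?y w)) = fst_blinfun o\<^sub>L Dbl ?S ?y"
    by (rule blinfun_eqI)
       (simp add: bounded_linear_Blinfun_apply bounded_linear_compose[OF bounded_linear_fst blinfun.bounded_linear_right])
  then show ?thesis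
    unfolding courant_bracket_def lie_bracket_def lie_derivative_def ext_derivative_def coord_courant_def
    by (simp add: Let_def v w df[OF assms(1)] df[OF assms(2)] ds[OF assms(1)] ds[OF assms(2)] at)
qed

text \<open>By definition the bracket at \<open>p\<close> is computed in the chart selected for
  \<open>p\<close>, which jumps with \<open>p\<close>. Smoothness of the bracket becomes visible
  only after all its values are expressed in one chart.\<close>

lemma sec_rep_courant_bracket:
  assumes "smooth_gsection_on A U s" "smooth_gsection_on A U t" "open U" "p \<in> U" "c \<in> A" "p \<in> fst c"
  shows "sec_rep A c (courant_bracket A s t) (snd c p) = coord_courant (sec_rep A c s) (sec_rep A c t) (snd c p)"
proof -
  let ?c = "chart_at A p"
  let ?F = "snd c \<circ> id \<circ> chart_inv ?c" and ?S = "snd ?c ` (fst ?c \<inter> fst c)" and ?y = "snd ?c p"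
  have Fy: "?F ?y = snd c p" using chart_at by simp
  have y: "?y \<in> ?S" using chart_at assms by blast
  have op: "open ?S" by (rule trans_image_open[OF chart_at(1) assms(5)])
  have rel: "relates (Dbl ?F y) (sec_rep A c s (?F y)) (sec_rep A ?c s y)" if yS: "y \<in> ?S" for y s
  proof -
    obtain q where q: "q \<in> fst ?c" "q \<in> fst c" "y = snd ?c q" using yS by blast
    have D: "Dbl ?F y = trans_deriv ?c c q" by (simp add: trans_deriv_eq q)
    have Fq: "?F y = snd c q" using q chart_at(1) by simp
    show ?thesis
      unfolding D relates_gtrans_iff[OF chart_at(1) assms(5) q(1,2)] unfolding Fq unfolding q(3)
      by (rule sec_rep_change[OF chart_at(1) assms(5) q(1,2)])
  qed
  note dif = sec_rep_differentiable[OF assms(1,3,4)] sec_rep_differentiable[OF assms(2,3,4)]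
  have D: "Dbl ?F ?y = trans_deriv ?c c p" by (simp add: trans_deriv_eq)
  have "relates (Dbl ?F ?y) (coord_courant (sec_rep A c s) (sec_rep A c t) (?F ?y)) (coord_courant (sec_rep A ?c s) (sec_rep A ?c t) ?y)"
    by (rule coord_courant_natural[OF op y trans_smooth[OF chart_at(1) assms(5)] dif(1)[OF chart_at] dif(2)[OF chart_at]
      dif(1)[OF assms(5,6), folded Fy] dif(2)[OF assms(5,6), folded Fy]]) (erule rel)+
  then show ?thesis
    unfolding Fy D relates_gtrans_iff[OF chart_at(1) assms(5) chart_at(2) assms(6)]
      sec_rep_at[OF assms(5,6)] courant_bracket_coord_courant[OF assms(1-4)] ..
qed

lemma smooth_courant_bracket:
  assumes "smooth_gsection_on A U s" "smooth_gsection_on A U t" "open U"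
  shows "smooth_gsection_on A U (courant_bracket A s t)"
  unfolding smooth_gsection_on_iff[OF assms(3)]
proof
  fix c assume c: "c \<in> A"
  have op: "open (snd c ` (fst c \<inter> U))" by (intro image_open open_Int chart_open assms c) auto
  show "smooth_on (snd c ` (fst c \<inter> U)) (sec_rep A c (courant_bracket A s t))"
  proof (rule smooth_on_cong[OF op _ smooth_on_coord_courant[OF op smooth_gsection_onD[OF assms(1,3) c] smooth_gsection_onD[OF assms(2,3) c]]])
    fix y assume "y \<in> snd c ` (fst c \<inter> U)"
    then obtain p where p: "p \<in> fst c" "p \<in> U" "y = snd c p" by blast
    then show "coord_courant (sec_rep A c s) (sec_rep A c t) y = sec_rep A c (courant_bracket A s t) y"
      using sec_rep_courant_bracket[OF assms p(2) c p(1)] by simp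
  qed
qed

end


section \<open>Cut-off functions and global frames\<close>

context smooth_manifold
begin

definition smooth_fun :: "('m \<Rightarrow> real) \<Rightarrow> bool" where
  "smooth_fun \<phi> \<longleftrightarrow> (\<forall>c\<in>A. smooth_on (snd c ` fst c) (\<lambda>y. \<phi> (chart_inv c y)))"

text \<open>A radial flat function in a chart is extended by 0. The extension is smooth because the
  support stays in the image \<open>K\<close> of a closed ball, which is compact and hence closed in
  the Hausdorff manifold, so that every point outside the chart has a neighbourhood on which the
  function is 0.\<close>

lemma bump_function:
  assumes "open U" "p \<in> U"
  obtains \<phi> :: "'m \<Rightarrow> real" where "smooth_fun \<phi>" "\<And>x. 0 \<le> \<phi> x" "0 < \<phi> p" "open {x. 0 < \<phi> x}"
    "closure {x. \<phi> x \<noteq> 0} \<subseteq> U"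
proof -
  let ?c = "chart_at A p"
  note c = chart_at[of p]
  define z where "z = snd ?c p"
  have oU: "open (snd ?c ` (fst ?c \<inter> U))" by (intro image_open open_Int chart_open c assms) auto
  moreover have "z \<in> snd ?c ` (fst ?c \<inter> U)" using c assms by (auto simp: z_def)
  ultimately obtain r where r: "0 < r" "cball z r \<subseteq> snd ?c ` (fst ?c \<inter> U)"
    using open_contains_cball by blast
  define K where "K = chart_inv ?c ` cball z r"
  have "cball z r \<subseteq> snd ?c ` fst ?c" using r(2) by blast
  then have cK: "compact K"
    unfolding K_def
    by (intro compact_continuous_image fd_compact_cball continuous_on_subset[OF chart_inv_continuous[OF c(1)]])
  have KU: "K \<subseteq> U" unfolding K_def using r(2) c(1) by (auto simp: subset_iff)
  \<comment> \<open>The argument of the flat function is positive exactly on the open ball of radius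
    \<open>r\<close> around \<open>z\<close>.\<close>
  define g where "g = (\<lambda>y. flat_fun 0 (1 - (y - z) \<bullet> (y - z) * inverse (r * r)))"
  have sg: "smooth_on UNIV g"
    unfolding g_def
    by (rule smooth_on_compose[OF open_UNIV open_UNIV _ _ smooth_on_flat_fun])
       (auto intro!: smooth_on_diff smooth_on_mult smooth_on_inner)
  have gpos: "0 < g y \<longleftrightarrow> y \<in> ball z r" for y
  proof -
    have "0 < g y \<longleftrightarrow> (y - z) \<bullet> (y - z) < r * r"
      using r(1) by (simp add: g_def flat_fun_pos_iff field_simps)
    also have "\<dots> \<longleftrightarrow> norm (y - z) * norm (y - z) < r * r"
      by (simp add: dot_square_norm power2_eq_square)
    also have "\<dots> \<longleftrightarrow> norm (y - z) < r"
      using r(1) mult_strict_mono'[of "norm (y - z)" r "norm (y - z)" r] mult_mono[of r "norm (y - z)" r "norm (y - z)"]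
      by (smt (verit) norm_ge_zero)
    finally show ?thesis by (simp add: dist_norm norm_minus_commute)
  qed
  have g0: "0 \<le> g y" for y by (simp add: g_def flat_fun_nonneg)
  define \<phi> where "\<phi> = (\<lambda>x. if x \<in> fst ?c then g (snd ?c x) else 0)"
  have \<phi>pos: "{x. 0 < \<phi> x} = fst ?c \<inter> snd ?c -` ball z r" by (auto simp: \<phi>_def gpos)
  have \<phi>nn: "0 \<le> \<phi> x" for x by (simp add: \<phi>_def g0)
  have ne: "{x. \<phi> x \<noteq> 0} = {x. 0 < \<phi> x}" using \<phi>nn by (auto simp: less_le)
  have "{x. \<phi> x \<noteq> 0} \<subseteq> K"
  proof
    fix x assume "x \<in> {x. \<phi> x \<noteq> 0}"
    then have x: "x \<in> fst ?c" "snd ?c x \<in> cball z r" unfolding ne \<phi>pos by auto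
    then have "x = chart_inv ?c (snd ?c x)" using c(1) by simp
    then show "x \<in> K" unfolding K_def using x(2) by (rule image_eqI)
  qed
  then have clK: "closure {x. \<phi> x \<noteq> 0} \<subseteq> K" by (rule closure_minimal[OF _ compact_imp_closed[OF cK]])
  have "smooth_fun \<phi>"
    unfolding smooth_fun_def
  proof (intro ballI smooth_on_localI)
    fix d y assume d: "d \<in> A" and "y \<in> snd d ` fst d"
    then obtain x where x: "x \<in> fst d" "y = snd d x" by blast
    show "\<exists>T. open T \<and> y \<in> T \<and> smooth_on T (\<lambda>y. \<phi> (chart_inv d y))"
    proof (cases "x \<in> fst ?c")
      case True
      let ?T = "snd d ` (fst d \<inter> fst ?c)"
      have T: "open ?T" by (rule trans_image_open[OF d c(1)])
      have "smooth_on ?T (\<lambda>y. g ((snd ?c \<circ> id \<circ> chart_inv d) y))"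
        by (rule smooth_on_compose[OF T open_UNIV subset_UNIV trans_smooth[OF d c(1)] sg])
      then have "smooth_on ?T (\<lambda>y. \<phi> (chart_inv d y))"
        by (rule smooth_on_cong[OF T, rotated]) (use d in \<open>auto simp: \<phi>_def\<close>)
      then show ?thesis using T x True by blast
    next
      case False
      let ?T = "snd d ` (fst d \<inter> - K)"
      have T: "open ?T"
        using cK by (intro image_open d open_Int chart_open) (auto intro: compact_imp_closed)
      have "x \<notin> K" using False r(2) c(1) by (auto simp: K_def subset_iff)
      moreover have "smooth_on ?T (\<lambda>y. \<phi> (chart_inv d y))"
      proof (rule smooth_on_cong[OF T _ smooth_on_const[of ?T 0]])
        fix y assume "y \<in> ?T"
        then have "chart_inv d y \<notin> K" using d by auto
        then have "chart_inv d y \<notin> {x. \<phi> x \<noteq> 0}" using clK closure_subset[of "{x. \<phi> x \<noteq> 0}"] by blast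
        then show "0 = \<phi> (chart_inv d y)" by simp
      qed
      ultimately show ?thesis using T x by blast
    qed
  qed
  moreover have "open {x. 0 < \<phi> x}"
    unfolding \<phi>pos by (rule continuous_open_preimage[OF chart_continuous chart_open]) (simp_all add: c)
  moreover have "0 < \<phi> p" using c(2) r(1) by (simp add: \<phi>_def gpos z_def)
  ultimately show thesis using that \<phi>nn clK KU by blast
qed

end

context manifold_map
begin

lemma dom_chart_at: "x \<in> dom (chart_at AB x) (chart_at AM (f x))"
  by (simp add: dom_def B.chart_at M.chart_at)

lemma along_rep_scaleR:
  "along_rep AM f c d (\<lambda>x. \<phi> x *\<^sub>R a x) y = \<phi> (chart_inv c y) *\<^sub>R along_rep AM f c d a y"
  by (simp add: along_rep_def Let_def linear_scale[OF linear_gtrans])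

lemma along_rep_sum:
  "along_rep AM f c d (\<lambda>x. \<Sum>i\<in>I. a i x) y = (\<Sum>i\<in>I. along_rep AM f c d (a i) y)"
  by (simp add: along_rep_def Let_def linear_sum[OF linear_gtrans])

text \<open>Nothing is assumed about \<open>a\<close> outside \<open>U\<close>: a point there is
  outside the closed support of \<open>\<phi>\<close>, and the product vanishes near it.\<close>

lemma smooth_along_cutoff:
  assumes "B.smooth_fun \<phi>" "smooth_along_on U a" "open U" "closure {x. \<phi> x \<noteq> 0} \<subseteq> U"
  shows "smooth_along_on UNIV (\<lambda>x. \<phi> x *\<^sub>R a x)"
proof (rule smooth_along_onI[OF open_UNIV])
  fix x
  let ?c = "chart_at AB x" and ?d = "chart_at AM (f x)" and ?K = "closure {x. \<phi> x \<noteq> 0}"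
  note c = B.chart_at(1)[of x] and d = M.chart_at(1)[of "f x"]
  have dc: "dom ?c ?d \<subseteq> fst ?c" by (auto simp: dom_def)
  note sI = smooth_along_atI[OF c d, of "dom ?c ?d \<inter> V" for V]
  have oW: "open (dom ?c ?d \<inter> V)" "open (snd ?c ` (dom ?c ?d \<inter> V))" if "open V" for V
    using that open_dom[OF c d] B.image_open[OF c, of "dom ?c ?d \<inter> V"] dc by blast+
  show "smooth_along_at (\<lambda>x. \<phi> x *\<^sub>R a x) x"
  proof (cases "x \<in> U")
    case True
    note o = oW[OF assms(3)]
    have "snd ?c ` (dom ?c ?d \<inter> U) \<subseteq> snd ?c ` fst ?c" using dc by blast
    then have "smooth_on (snd ?c ` (dom ?c ?d \<inter> U)) (\<lambda>y. \<phi> (chart_inv ?c y))"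
      using assms(1) c smooth_on_subset unfolding B.smooth_fun_def by blast
    moreover have "smooth_on (snd ?c ` (dom ?c ?d \<inter> U)) (along_rep AM f ?c ?d a)"
      using assms(2) c d unfolding smooth_along_on_def by blast
    ultimately have "smooth_on (snd ?c ` (dom ?c ?d \<inter> U)) (along_rep AM f ?c ?d (\<lambda>x. \<phi> x *\<^sub>R a x))"
      unfolding along_rep_scaleR[abs_def] by (rule smooth_on_scaleR[OF o(2)])
    then show ?thesis using True dom_chart_at by (intro sI[OF o(1)]) blast+
  next
    case False
    have o: "open (dom ?c ?d \<inter> - ?K)" "open (snd ?c ` (dom ?c ?d \<inter> - ?K))" by (intro oW open_Compl closed_closure)+
    have "smooth_on (snd ?c ` (dom ?c ?d \<inter> - ?K)) (along_rep AM f ?c ?d (\<lambda>x. \<phi> x *\<^sub>R a x))"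
    proof (rule smooth_on_cong[OF o(2) _ smooth_on_const[of _ 0]])
      fix y assume "y \<in> snd ?c ` (dom ?c ?d \<inter> - ?K)"
      then have "chart_inv ?c y \<notin> ?K" using c dc by auto
      then have "chart_inv ?c y \<notin> {x. \<phi> x \<noteq> 0}" using closure_subset[of "{x. \<phi> x \<noteq> 0}"] by blast
      then show "0 = along_rep AM f ?c ?d (\<lambda>x. \<phi> x *\<^sub>R a x) y" by (simp add: along_rep_scaleR)
    qed
    then show ?thesis using False assms(4) dom_chart_at by (intro sI[OF o(1)]) blast+
  qed
qed

end

context smooth_manifold
begin

lemma smooth_gsection_cutoff:
  assumes "smooth_fun \<phi>" "smooth_gsection_on A U s" "open U" "closure {x. \<phi> x \<noteq> 0} \<subseteq> U"
  shows "smooth_gsection_on A UNIV (\<lambda>x. \<phi> x *\<^sub>R s x)"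
proof -
  interpret I: manifold_map A A id by (rule manifold_map_id)
  have "I.smooth_along_on U s"
  proof (rule I.smooth_along_onI[OF assms(3)])
    fix x assume x: "x \<in> U"
    let ?c = "chart_at A x"
    note c = chart_at[of x]
    have "smooth_on (snd ?c ` (fst ?c \<inter> U)) (sec_rep A ?c s)"
      by (rule smooth_gsection_onD[OF assms(2,3) c(1)])
    then show "I.smooth_along_at s x"
      using c x assms(3) chart_open[OF c(1)]
      by (intro I.smooth_along_atI[OF c(1) c(1), of "fst ?c \<inter> U"]) (auto simp: I.dom_def)
  qed
  from I.smooth_along_cutoff[OF assms(1) this assms(3,4)]
  have "smooth_on (snd c ` fst c) (sec_rep A c (\<lambda>x. \<phi> x *\<^sub>R s x))" if "c \<in> A" for c
    using that unfolding I.smooth_along_on_def by (force simp: I.dom_def)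
  then show ?thesis unfolding smooth_gsection_on_iff[OF open_UNIV] by simp
qed

text \<open>Where the bump function is positive, rescaling a local frame by it changes neither span
  nor independence; elsewhere the products are 0 and still lie in the subspaces
  \<open>L p\<close>.\<close>

lemma dirac_global_frame:
  assumes "dirac_structure A L"
  obtains k :: nat and U g where "open U" "q \<in> U" "\<And>i. i < k \<Longrightarrow> g i \<in> sections A L"
    "\<And>p. p \<in> U \<Longrightarrow> span ((\<lambda>i. g i p) ` {..<k}) = L p"
    "\<And>p c. p \<in> U \<Longrightarrow> (\<Sum>i<k. c i *\<^sub>R g i p) = 0 \<Longrightarrow> \<forall>i<k. c i = 0"
proof -
  have "smooth_subbundle A L" and mi: "maximal_isotropic (L p)" for p
    using assms unfolding dirac_structure_def by blast+
  then obtain k :: nat where k: "\<And>p. \<exists>U s. open U \<and> p \<in> U \<and> (\<forall>i<k. smooth_gsection_on A U (s i)) \<and>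
      (\<forall>q\<in>U. inj_on (\<lambda>i. s i q) {..<k} \<and> independent ((\<lambda>i. s i q) ` {..<k}) \<and> span ((\<lambda>i. s i q) ` {..<k}) = L q)"
    unfolding smooth_subbundle_def by auto
  obtain U s where "open U \<and> q \<in> U \<and> (\<forall>i<k. smooth_gsection_on A U (s i)) \<and>
      (\<forall>q\<in>U. inj_on (\<lambda>i. s i q) {..<k} \<and> independent ((\<lambda>i. s i q) ` {..<k}) \<and> span ((\<lambda>i. s i q) ` {..<k}) = L q)"
    using k[of q] by (elim exE) (rule that)
  then have U: "open U" "q \<in> U" and s: "\<And>i. i < k \<Longrightarrow> smooth_gsection_on A U (s i)"
    and inj: "\<And>p. p \<in> U \<Longrightarrow> inj_on (\<lambda>i. s i p) {..<k}"
    and ind: "\<And>p. p \<in> U \<Longrightarrow> independent ((\<lambda>i. s i p) ` {..<k})"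
    and sp: "\<And>p. p \<in> U \<Longrightarrow> span ((\<lambda>i. s i p) ` {..<k}) = L p"
    by simp_all
  obtain \<phi> :: "'m \<Rightarrow> real" where \<phi>: "smooth_fun \<phi>" "\<And>x. 0 \<le> \<phi> x" "0 < \<phi> q" "open {x. 0 < \<phi> x}"
    "closure {x. \<phi> x \<noteq> 0} \<subseteq> U"
    by (rule bump_function[OF U]) (rule that)
  define g where "g = (\<lambda>i p. \<phi> p *\<^sub>R s i p)"
  let ?V = "{x. 0 < \<phi> x}"
  have VU: "p \<in> U" if "\<phi> p \<noteq> 0" for p
    using that \<phi>(5) closure_subset[of "{x. \<phi> x \<noteq> 0}"] by blast
  have sub: "subspace (L p)" for p by (rule isotropic_subspace[OF maximal_isotropicD[OF mi]])
  show thesis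
  proof (rule that[of ?V k g])
    show "open ?V" "q \<in> ?V" using \<phi> by auto
    show "g i \<in> sections A L" if i: "i < k" for i
    proof -
      have "g i p \<in> L p" for p
      proof (cases "\<phi> p = 0")
        case False
        have "s i p \<in> L p" unfolding sp[OF VU[OF False], symmetric] using i by (intro span_base) auto
        then show ?thesis unfolding g_def by (rule subspace_scale[OF sub])
      qed (simp add: g_def subspace_0[OF sub])
      moreover have "smooth_gsection_on A UNIV (g i)"
        unfolding g_def by (rule smooth_gsection_cutoff[OF \<phi>(1) s[OF i] U(1) \<phi>(5)])
      ultimately show ?thesis by (simp add: sections_def)
    qed
    fix p assume p: "p \<in> ?V"
    then have pU: "p \<in> U" and p0: "\<phi> p \<noteq> 0" using VU by force+
    have "s i p = inverse (\<phi> p) *\<^sub>R g i p" for i using p0 by (simp add: g_def)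
    then have "s i p \<in> span ((\<lambda>i. g i p) ` {..<k})" if "i < k" for i
      using that span_scale[OF span_base[OF imageI[of i "{..<k}" "\<lambda>i. g i p"]], of "inverse (\<phi> p)"] by simp
    then have "(\<lambda>i. s i p) ` {..<k} \<subseteq> span ((\<lambda>i. g i p) ` {..<k})" by blast
    moreover have "g i p \<in> span ((\<lambda>i. s i p) ` {..<k})" if "i < k" for i
      unfolding g_def using that by (intro span_scale span_base imageI) simp
    then have "(\<lambda>i. g i p) ` {..<k} \<subseteq> span ((\<lambda>i. s i p) ` {..<k})" by blast
    ultimately show "span ((\<lambda>i. g i p) ` {..<k}) = L p"
      unfolding sp[OF pU, symmetric] by (simp add: span_eq)
    fix c assume "(\<Sum>i<k. c i *\<^sub>R g i p) = 0"
    then have z: "(\<Sum>i<k. (c i * \<phi> p) *\<^sub>R s i p) = 0" by (simp add: g_def)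
    \<comment> \<open>Independence is stated for the set of frame vectors. The inverse of the
      injective index map turns the indexed coefficients into a function on that set.\<close>
    define u where "u = (\<lambda>v. c (the_inv_into {..<k} (\<lambda>i. s i p) v) * \<phi> p)"
    have ui: "u (s i p) = c i * \<phi> p" if "i < k" for i
      using the_inv_into_f_f[OF inj[OF pU], of i] that by (simp add: u_def)
    have "(\<Sum>v\<in>(\<lambda>i. s i p) ` {..<k}. u v *\<^sub>R v) = (\<Sum>i<k. u (s i p) *\<^sub>R s i p)"
      by (subst sum.reindex[OF inj[OF pU]]) (simp add: o_def)
    also have "\<dots> = (\<Sum>i<k. (c i * \<phi> p) *\<^sub>R s i p)" by (rule sum.cong) (simp_all add: ui)
    finally have "(\<Sum>v\<in>(\<lambda>i. s i p) ` {..<k}. u v *\<^sub>R v) = 0" using z by simp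
    then have "u v = 0" if "v \<in> (\<lambda>i. s i p) ` {..<k}" for v
      using independentD[OF ind[OF pU] _ order_refl] that by blast
    then have "u (s i p) = 0" if "i < k" for i using that by simp
    then show "\<forall>i<k. c i = 0" using ui p0 by simp
  qed
qed

end

section \<open>The pullback of a Dirac structure\<close>

locale dirac_map = manifold_map AB AM f
  for AB :: "('b::{t2_space, second_countable_topology}, 'u::fd_euclidean) chart set"
    and AM :: "('m::{t2_space, second_countable_topology}, 'e::fd_euclidean) chart set"
    and f :: "'b \<Rightarrow> 'm" +
  fixes L :: "'m \<Rightarrow> 'e gtangent set" and r :: nat
  assumes dirac: "dirac_structure AM L"
    and rank: "dim (algebroid_pullback AB AM f L x) = r"
begin

abbreviation BL :: "'b \<Rightarrow> 'u gtangent set" where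
  "BL \<equiv> dirac_pullback AB AM f L"

lemma L_maximal_isotropic: "maximal_isotropic (L q)"
  using dirac unfolding dirac_structure_def by blast

lemmas L_isotropic = maximal_isotropicD[OF L_maximal_isotropic]
lemmas L_subspace = isotropic_subspace[OF L_isotropic]

lemma BL_maximal_isotropic: "maximal_isotropic (BL x)"
  unfolding dirac_pullback_eq by (rule maximal_isotropic_pull[OF L_maximal_isotropic])

lemmas BL_isotropic = maximal_isotropicD[OF BL_maximal_isotropic]
lemmas BL_subspace = isotropic_subspace[OF BL_isotropic]

lemma BL_iff: "t \<in> BL x \<longleftrightarrow> (\<exists>a\<in>L (f x). relates (tangent_map AB AM f x) a t)"
  unfolding dirac_pullback_eq pull_iff ..

text \<open>\<open>L\<close> read in the chart \<open>d\<close>; meaningful on the image of the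
  chart domain.\<close>

definition Lrep :: "('m, 'e) chart \<Rightarrow> 'e \<Rightarrow> 'e gtangent set" where
  "Lrep d z = gtrans (chart_at AM (chart_inv d z)) d (chart_inv d z) ` L (chart_inv d z)"

lemma Lrep_at: "d \<in> AM \<Longrightarrow> q \<in> fst d \<Longrightarrow> Lrep d (snd d q) = gtrans (chart_at AM q) d q ` L q"
  by (simp add: Lrep_def)

lemma Lrep_maximal_isotropic:
  assumes "d \<in> AM" "q \<in> fst d"
  shows "maximal_isotropic (Lrep d (snd d q))"
  unfolding Lrep_at[OF assms]
  by (intro M.maximal_isotropic_gtrans M.chart_at assms L_maximal_isotropic)

lemma relates_chart:
  assumes "c \<in> AB" "d \<in> AM" "x \<in> dom c d" "relates (tangent_map AB AM f x) a t"
  shows "relates (Dbl (loc c d) (snd c x)) (gtrans (chart_at AM (f x)) d (f x) a) (gtrans (chart_at AB x) c x t)"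
  using relates_change[OF B.chart_at(1) assms(1) M.chart_at(1) assms(2) dom_chart_at assms(3)] assms(4)
  unfolding tangent_map_loc by blast

lemma relates_unchart:
  assumes "c \<in> AB" "d \<in> AM" "x \<in> dom c d" "relates (Dbl (loc c d) (snd c x)) a t"
  shows "relates (tangent_map AB AM f x) (gtrans d (chart_at AM (f x)) (f x) a) (gtrans c (chart_at AB x) x t)"
  using relates_change[OF assms(1) B.chart_at(1) assms(2) M.chart_at(1) assms(3) dom_chart_at assms(4)]
  unfolding tangent_map_loc .

lemma BL_chart:
  assumes "c \<in> AB" "d \<in> AM" "x \<in> dom c d" "t \<in> BL x"
  shows "gtrans (chart_at AB x) c x t \<in> pull (Dbl (loc c d) (snd c x)) (Lrep d (loc c d (snd c x)))"
proof -
  have x: "x \<in> fst c" "f x \<in> fst d" using assms(3) by (auto simp: dom_def)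
  obtain a where a: "a \<in> L (f x)" "relates (tangent_map AB AM f x) a t" using assms(4) unfolding BL_iff ..
  have "gtrans (chart_at AM (f x)) d (f x) a \<in> Lrep d (loc c d (snd c x))"
    using a(1) unfolding loc_apply[OF assms(1) x(1)] Lrep_at[OF assms(2) x(2)] by blast
  then show ?thesis using relates_chart[OF assms(1-3) a(2)] unfolding pull_iff by blast
qed

lemma Lrep_unchart:
  assumes "d \<in> AM" "q \<in> fst d" "a \<in> Lrep d (snd d q)"
  shows "gtrans d (chart_at AM q) q a \<in> L q"
  using assms(3) unfolding Lrep_at[OF assms(1,2)]
  by (auto simp: M.gtrans_comp M.gtrans_self M.chart_at assms(1,2))

text \<open>The rank hypothesis refers to the charts selected at each point. Passing to a fixed pair
  of charts acts on the fibre by the linear map \<open>?g\<close>, whose inverse is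
  \<open>?h\<close>, so the dimension is unchanged.\<close>

lemma rank_chart:
  assumes "c \<in> AB" "d \<in> AM" "x \<in> dom c d"
  shows "dim {(a, v). a \<in> Lrep d (loc c d (snd c x)) \<and> fst a = Dbl (loc c d) (snd c x) v} = r"
proof -
  let ?S = "algebroid_pullback AB AM f L x"
  let ?c = "chart_at AB x" and ?d = "chart_at AM (f x)"
  let ?g = "\<lambda>p :: 'e gtangent \<times> 'u. (gtrans ?d d (f x) (fst p), trans_deriv ?c c x (snd p))"
  let ?h = "\<lambda>p :: 'e gtangent \<times> 'u. (gtrans d ?d (f x) (fst p), trans_deriv c ?c x (snd p))"
  have x: "x \<in> fst c" "f x \<in> fst d" using assms(3) by (auto simp: dom_def)
  have F: "loc c d (snd c x) = snd d (f x)" by (rule loc_apply[OF assms(1) x(1)])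
  have lin: "linear ?g"
    by (rule linearI) (simp_all add: linear_add[OF linear_gtrans] linear_scale[OF linear_gtrans] blinfun.bilinear_simps)
  have tt: "trans_deriv c ?c x (trans_deriv ?c c x v) = v" "trans_deriv ?c c x (trans_deriv c ?c x v) = v" for v
    using B.trans_deriv_comp[OF B.chart_at(1) assms(1) B.chart_at(1) B.chart_at(2) x(1) B.chart_at(2)]
      B.trans_deriv_comp[OF assms(1) B.chart_at(1) assms(1) x(1) B.chart_at(2) x(1)]
      B.trans_deriv_self[OF B.chart_at(1) B.chart_at(2)] B.trans_deriv_self[OF assms(1) x(1)]
    by (metis blinfun_apply_blinfun_compose blinfun_apply_id_blinfun)+
  have hg: "?h (?g p) = p" and gh: "?g (?h p) = p" for p
    using tt x by (simp_all add: M.gtrans_comp M.gtrans_self M.chart_at assms(2))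
  have "subspace ?S"
    by (rule subspaceI)
       (use subspace_0[OF L_subspace] subspace_add[OF L_subspace] subspace_scale[OF L_subspace] in
         \<open>auto simp: algebroid_pullback_def blinfun.bilinear_simps zero_prod_def split_beta\<close>)
  moreover have "inj_on ?g ?S" by (rule inj_on_inverseI[of _ ?h]) (rule hg)
  ultimately have "dim (?g ` ?S) = dim ?S" by (rule dim_image_inj_on[OF lin])
  moreover have "?g ` ?S = {(a, v). a \<in> Lrep d (loc c d (snd c x)) \<and> fst a = Dbl (loc c d) (snd c x) v}" (is "_ = ?R")
  proof (intro set_eqI iffI)
    fix p assume "p \<in> ?g ` ?S"
    then obtain q where q: "q \<in> ?S" "p = ?g q" by (rule imageE)
    then have a: "fst q \<in> L (f x)" "fst (fst q) = tangent_map AB AM f x (snd q)"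
      by (auto simp: algebroid_pullback_def)
    then have "relates (tangent_map AB AM f x) (fst q) (snd q, snd (fst q) o\<^sub>L tangent_map AB AM f x)"
      by (simp add: relates_def)
    from relates_chart[OF assms this] have "fst (fst p) = Dbl (loc c d) (snd c x) (snd p)"
      unfolding q(2) by (simp add: relates_def gtrans_def)
    moreover have "fst p \<in> Lrep d (loc c d (snd c x))"
      unfolding F Lrep_at[OF assms(2) x(2)] q(2) using a(1) by simp
    ultimately show "p \<in> ?R" by (simp add: split_beta)
  next
    fix p assume "p \<in> ?R"
    then have a: "fst p \<in> Lrep d (snd d (f x))" "fst (fst p) = Dbl (loc c d) (snd c x) (snd p)"
      unfolding F by auto
    then have "relates (Dbl (loc c d) (snd c x)) (fst p) (snd p, snd (fst p) o\<^sub>L Dbl (loc c d) (snd c x))"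
      by (simp add: relates_def)
    from relates_unchart[OF assms this] have "fst (fst (?h p)) = tangent_map AB AM f x (snd (?h p))"
      by (simp add: relates_def gtrans_def)
    moreover have "fst (?h p) \<in> L (f x)" using Lrep_unchart[OF assms(2) x(2) a(1)] by simp
    ultimately have "?h p \<in> ?S" by (simp add: algebroid_pullback_def)
    then show "p \<in> ?g ` ?S" using gh[of p, symmetric] by (rule rev_image_eqI)
  qed
  ultimately show ?thesis using rank by simp
qed

text \<open>The frame consists of representatives of global sections of \<open>L\<close>, so that
  the involutivity of \<open>L\<close> applies to each pair of its members.\<close>

lemma Lrep_frame:
  assumes d: "d \<in> AM" "q0 \<in> fst d"
  obtains k Z g where "isotropic_frame Z (snd d q0) (Lrep d) {..<k} (\<lambda>i. sec_rep AM d (g i))"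
    "\<And>i::nat. i < k \<Longrightarrow> g i \<in> sections AM L"
proof -
  obtain k :: nat and U g where U: "open U" "q0 \<in> U" and g: "\<And>i. i < k \<Longrightarrow> g i \<in> sections AM L"
    and sp: "\<And>p. p \<in> U \<Longrightarrow> span ((\<lambda>i. g i p) ` {..<k}) = L p"
    and ind: "\<And>p c. p \<in> U \<Longrightarrow> (\<Sum>i<k. c i *\<^sub>R g i p) = 0 \<Longrightarrow> \<forall>i<k. c i = 0"
    by (rule M.dirac_global_frame[OF dirac, of q0]) (rule that)
  have at: "sec_rep AM d (g i) (snd d q) = gtrans (chart_at AM q) d q (g i q)" if "q \<in> fst d" for i q
    by (rule M.sec_rep_at[OF d(1) that])
  have "isotropic_frame (snd d ` (fst d \<inter> U)) (snd d q0) (Lrep d) {..<k} (\<lambda>i. sec_rep AM d (g i))"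
    unfolding isotropic_frame_def
  proof (intro conjI ballI allI impI)
    show "open (snd d ` (fst d \<inter> U))" by (intro M.image_open d open_Int M.chart_open U) auto
    show "smooth_on (snd d ` (fst d \<inter> U)) (sec_rep AM d (g i))" if "i \<in> {..<k}" for i
    proof -
      have "smooth_gsection_on AM UNIV (g i)" using g[of i] that by (simp add: sections_def)
      from M.smooth_gsection_onD[OF this open_UNIV d(1)] show ?thesis by (rule smooth_on_subset) blast
    qed
  next
    fix z assume "z \<in> snd d ` (fst d \<inter> U)"
    then obtain q where q: "q \<in> fst d" "q \<in> U" "z = snd d q" by blast
    show "maximal_isotropic (Lrep d z)" unfolding q(3) by (rule Lrep_maximal_isotropic[OF d(1) q(1)])
    have "(\<lambda>i. gtrans (chart_at AM q) d q (g i q)) ` {..<k} = gtrans (chart_at AM q) d q ` ((\<lambda>i. g i q) ` {..<k})"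
      by (simp add: image_image)
    then show "span ((\<lambda>i. sec_rep AM d (g i) z) ` {..<k}) = Lrep d z"
      unfolding q(3) at[OF q(1)] Lrep_at[OF d(1) q(1)] using linear_span_image[OF linear_gtrans] sp[OF q(2)] by metis
  next
    fix c i assume "(\<Sum>i\<in>{..<k}. c i *\<^sub>R sec_rep AM d (g i) (snd d q0)) = 0" and i: "i \<in> {..<k}"
    then have "gtrans (chart_at AM q0) d q0 (\<Sum>i<k. c i *\<^sub>R g i q0) = 0"
      unfolding at[OF d(2)] by (simp add: linear_sum[OF linear_gtrans] linear_scale[OF linear_gtrans])
    then have "gtrans d (chart_at AM q0) q0 (gtrans (chart_at AM q0) d q0 (\<Sum>i<k. c i *\<^sub>R g i q0)) = 0"
      by (simp add: linear_0[OF linear_gtrans])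
    then have "(\<Sum>i<k. c i *\<^sub>R g i q0) = 0" by (simp add: M.gtrans_comp M.gtrans_self M.chart_at d)
    then show "c i = 0" using ind[OF U(2)] i by simp
  qed (use d U in auto)
  then show thesis by (rule that) (rule g)
qed

lemma local_lift_at:
  fixes x0 :: 'b
  defines "c \<equiv> chart_at AB x0" and "d \<equiv> chart_at AM (f x0)"
  obtains W \<delta> b \<alpha> where "open W" "x0 \<in> W" "W \<subseteq> dom c d"
    "lift_frame (snd c ` W) (loc c d) (\<lambda>y. Lrep d (loc c d y)) \<delta> b \<alpha>"
proof -
  have c: "c \<in> AB" "x0 \<in> fst c" and d: "d \<in> AM" "f x0 \<in> fst d"
    unfolding c_def d_def using B.chart_at M.chart_at by blast+
  let ?F = "loc c d" and ?y0 = "snd c x0"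
  have F0: "?F ?y0 = snd d (f x0)" by (rule loc_apply[OF c])
  obtain k :: nat and Z g where "isotropic_frame Z (snd d (f x0)) (Lrep d) {..<k} (\<lambda>i. sec_rep AM d (g i))"
    by (rule Lrep_frame[OF d]) (rule that)
  then have fr: "isotropic_frame Z (?F ?y0) (Lrep d) {..<k} (\<lambda>i. sec_rep AM d (g i))" unfolding F0 .
  have y0: "?y0 \<in> snd c ` dom c d" using c d by (auto simp: dom_def)
  have rk: "dim {(a, v). a \<in> Lrep d (?F y) \<and> fst a = Dbl ?F y v} = r" if "y \<in> snd c ` dom c d" for y
    using that rank_chart[OF c(1) d(1)] by blast
  obtain T \<delta> b \<alpha> where T: "open T" "?y0 \<in> T" and Td: "T \<subseteq> snd c ` dom c d"
    and lf: "lift_frame T ?F (\<lambda>y. Lrep d (?F y)) \<delta> b \<alpha>"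
    by (rule local_lift[OF open_image_dom[OF c(1) d(1)] y0 smooth_loc[OF c(1) d(1)] fr rk]) (assumption, rule that)
  define W where "W = dom c d \<inter> snd c -` T"
  have "open W"
    unfolding W_def
    by (rule continuous_open_preimage[OF continuous_on_subset[OF B.chart_continuous[OF c(1)]] open_dom[OF c(1) d(1)] T(1)])
       (auto simp: dom_def)
  moreover have "snd c ` W = T" unfolding W_def using Td by blast
  moreover have "x0 \<in> W" "W \<subseteq> dom c d" unfolding W_def using T(2) c d by (auto simp: dom_def)
  ultimately show thesis using that lf by metis
qed

end


lemma relates_sum:
  assumes "\<And>i. i \<in> I \<Longrightarrow> relates T (a i) (t i)"
  shows "relates T (\<Sum>i\<in>I. k i *\<^sub>R a i) (\<Sum>i\<in>I. k i *\<^sub>R t i)"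
  using assms
proof (induction I rule: infinite_finite_induct)
  case (insert j I)
  then have 1: "relates T (a j) (t j)" and 2: "relates T (\<Sum>i\<in>I. k i *\<^sub>R a i) (\<Sum>i\<in>I. k i *\<^sub>R t i)" by simp_all
  have "relates T (k j *\<^sub>R a j + v) (k j *\<^sub>R t j + w)" if "relates T v w" for v w
    using 1 that
    by (simp add: relates_def blinfun.bilinear_simps bounded_bilinear.add_left[OF bounded_bilinear_blinfun_compose]
        bounded_bilinear.scaleR_left[OF bounded_bilinear_blinfun_compose])
  from this[OF 2] show ?case using insert(1,2) by simp
qed (simp_all add: relates_def)

section \<open>Local lifts, local frames and involutivity of the pullback\<close>

context dirac_map
begin

text \<open>A section is expanded in the local frame of \<open>BL\<close>, and each frame vector is
  replaced by its lift with the same coefficient. The neighbourhood is therefore the same for all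
  sections, and the lift vanishes wherever the section does.\<close>

lemma lift_exists:
  obtains W where "open W" "x0 \<in> W"
    "\<And>s. s \<in> sections AB BL \<Longrightarrow> \<exists>a. smooth_along_on W a \<and>
        (\<forall>x\<in>W. a x \<in> L (f x) \<and> relates (tangent_map AB AM f x) (a x) (s x) \<and> (s x = 0 \<longrightarrow> a x = 0))"
proof -
  let ?c = "chart_at AB x0" and ?d = "chart_at AM (f x0)"
  note c = B.chart_at(1)[of x0] and d = M.chart_at(1)[of "f x0"]
  obtain W \<delta> b \<alpha> where W: "open W" "x0 \<in> W" "W \<subseteq> dom ?c ?d"
    and lf: "lift_frame (snd ?c ` W) (loc ?c ?d) (\<lambda>y. Lrep ?d (loc ?c ?d y)) \<delta> b \<alpha>"
    by (rule local_lift_at[of x0]) (rule that)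
  note D = lift_frameD[OF lf] and Dx = lift_frameD(4-)[OF lf imageI]
  have Wc: "x \<in> fst ?c" "f x \<in> fst ?d" if "x \<in> W" for x using that W(3) by (auto simp: dom_def)
  have Lx: "loc ?c ?d (snd ?c x) = snd ?d (f x)" if "x \<in> W" for x by (rule loc_apply[OF c Wc(1)[OF that]])
  have oW: "open (snd ?c ` W)" by (rule B.image_open[OF c W(1)]) (use Wc in blast)
  show thesis
  proof (rule that[OF W(1,2)])
    fix s assume s: "s \<in> sections AB BL"
    then have sBL: "s x \<in> BL x" and ss: "smooth_gsection_on AB UNIV s" for x by (simp_all add: sections_def)
    let ?S = "sec_rep AB ?c s"
    define R where "R = (\<lambda>y. \<Sum>e\<in>onb. (\<delta> e y \<bullet> gvec (?S y)) *\<^sub>R \<alpha> e y)"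
    define a where "a = (\<lambda>x. gtrans ?d (chart_at AM (f x)) (f x) (R (snd ?c x)))"
    have sS: "smooth_on (snd ?c ` W) ?S"
      by (rule smooth_on_subset[OF B.smooth_gsection_onD[OF ss open_UNIV c]]) (use Wc in blast)
    have sR: "smooth_on (snd ?c ` W) R"
      unfolding R_def
      by (intro smooth_on_sum smooth_on_scaleR smooth_on_inner D(1,3) oW
          smooth_on_bounded_linear[OF oW bounded_linear_gvec sS])
    have ra: "along_rep AM f ?c ?d a (snd ?c x) = R (snd ?c x)" if "x \<in> W" for x
      using Wc[OF that] c d by (simp add: along_rep_def a_def M.gtrans_comp M.gtrans_self M.chart_at)
    have "smooth_on (snd ?c ` W) (along_rep AM f ?c ?d a)"
      by (rule smooth_on_cong[OF oW _ sR]) (use ra in auto)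
    then have "smooth_along_on W a"
      by (intro smooth_along_onI[OF W(1)] smooth_along_atI[OF c d W(1) _ W(3)])
    moreover have "a x \<in> L (f x) \<and> relates (tangent_map AB AM f x) (a x) (s x) \<and> (s x = 0 \<longrightarrow> a x = 0)" if x: "x \<in> W" for x
    proof -
      have Sx: "?S (snd ?c x) = gtrans (chart_at AB x) ?c x (s x)"
        by (rule B.sec_rep_at[OF c Wc(1)[OF x]])
      have "R (snd ?c x) \<in> Lrep ?d (snd ?d (f x))"
        unfolding R_def
        by (intro subspace_sum subspace_scale Dx(1)[OF x, unfolded Lx[OF x]]
            isotropic_subspace[OF maximal_isotropicD[OF Lrep_maximal_isotropic[OF d Wc(2)[OF x]]]])
      then have "a x \<in> L (f x)" unfolding a_def by (rule Lrep_unchart[OF d Wc(2)[OF x]])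
      moreover have "relates (Dbl (loc ?c ?d) (snd ?c x)) (R (snd ?c x)) (?S (snd ?c x))"
      proof -
        have "relates (Dbl (loc ?c ?d) (snd ?c x)) (R (snd ?c x))
            (\<Sum>e\<in>onb. (\<delta> e (snd ?c x) \<bullet> gvec (?S (snd ?c x))) *\<^sub>R b e (snd ?c x))"
          unfolding R_def by (rule relates_sum) (rule Dx(2)[OF x])
        then show ?thesis using Dx(4)[OF x BL_chart[OF c d subsetD[OF W(3) x] sBL]] unfolding Sx by simp
      qed
      from relates_unchart[OF c d subsetD[OF W(3) x] this]
      have "relates (tangent_map AB AM f x) (a x) (s x)"
        using Wc[OF x] c by (simp add: a_def Sx B.gtrans_comp B.gtrans_self B.chart_at)
      moreover have "a x = 0" if "s x = 0"
        unfolding a_def R_def Sx that by (simp add: linear_0[OF linear_gtrans] linear_0[OF linear_gvec])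
      ultimately show ?thesis by blast
    qed
    ultimately show "\<exists>a. smooth_along_on W a \<and>
        (\<forall>x\<in>W. a x \<in> L (f x) \<and> relates (tangent_map AB AM f x) (a x) (s x) \<and> (s x = 0 \<longrightarrow> a x = 0))"
      by blast
  qed
qed

lemma BL_subbundle: "smooth_subbundle AB BL"
proof -
  let ?k = "card (onb :: 'u set)"
  \<comment> \<open>Frames in \<open>smooth_subbundle\<close> are indexed by an initial segment of
    the natural numbers, so the basis is enumerated. The rank of \<open>BL\<close> is the dimension
    of the model space of the source.\<close>
  obtain h where h: "bij_betw h {0..<?k} (onb :: 'u set)"
    using ex_bij_betw_nat_finite[OF finite_onb] by blast
  have hi: "h ` {..<?k} = onb" using h by (simp add: bij_betw_def atLeast0LessThan)
  have hinj: "inj_on h {..<?k}" using h by (simp add: bij_betw_def atLeast0LessThan)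
  show ?thesis
    unfolding smooth_subbundle_def
  proof (intro exI[of _ ?k] allI)
    fix x0
    let ?c = "chart_at AB x0" and ?d = "chart_at AM (f x0)"
    note c = B.chart_at(1)[of x0] and d = M.chart_at(1)[of "f x0"]
    obtain W \<delta> b \<alpha> where W: "open W" "x0 \<in> W" "W \<subseteq> dom ?c ?d"
      and lf: "lift_frame (snd ?c ` W) (loc ?c ?d) (\<lambda>y. Lrep ?d (loc ?c ?d y)) \<delta> b \<alpha>"
      by (rule local_lift_at[of x0]) (rule that)
    note D = lift_frameD[OF lf] and Dx = lift_frameD(4-)[OF lf imageI]
    have Wc: "x \<in> fst ?c" "f x \<in> fst ?d" if "x \<in> W" for x using that W(3) by (auto simp: dom_def)
    define v where "v = (\<lambda>e. B.of_rep ?c (b e))"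
    have sv: "smooth_gsection_on AB W (v e)" if "e \<in> onb" for e
      unfolding v_def by (rule B.smooth_of_rep[OF c W(1) _ D(2)[OF that]]) (use Wc in blast)
    have frame: "inj_on (\<lambda>e. v e x) onb \<and> independent ((\<lambda>e. v e x) ` onb) \<and> span ((\<lambda>e. v e x) ` onb) = BL x"
      if x: "x \<in> W" for x
    proof -
      let ?G = "gtrans ?c (chart_at AB x) x" and ?H = "gtrans (chart_at AB x) ?c x"
      have vG: "v e x = ?G (b e (snd ?c x))" for e by (simp add: v_def B.of_rep_def)
      have HG: "?H (?G t) = t" and GH: "?G (?H t) = t" for t
        using Wc[OF x] c by (simp_all add: B.gtrans_comp B.gtrans_self B.chart_at)
      have z: "\<forall>e\<in>onb. u e = 0" if u: "(\<Sum>e\<in>onb. u e *\<^sub>R v e x) = 0" for u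
      proof
        fix e :: 'u assume e: "e \<in> onb"
        have "?H (\<Sum>e\<in>onb. u e *\<^sub>R v e x) = (\<Sum>e\<in>onb. u e *\<^sub>R b e (snd ?c x))"
          by (simp add: linear_sum[OF linear_gtrans] linear_scale[OF linear_gtrans] vG HG)
        then have "(\<Sum>e\<in>onb. u e *\<^sub>R b e (snd ?c x)) = 0" using u by (simp add: linear_0[OF linear_gtrans])
        then have "0 = \<delta> e (snd ?c x) \<bullet> gvec (\<Sum>e\<in>onb. u e *\<^sub>R b e (snd ?c x))"
          by (simp add: linear_0[OF linear_gvec])
        also have "\<dots> = (\<Sum>e'\<in>onb. if e' = e then u e' else 0)"
          unfolding linear_sum[OF linear_gvec] linear_scale[OF linear_gvec] inner_sum_right
          by (rule sum.cong) (use Dx(3)[OF x e] in auto)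
        finally show "u e = 0" using e by simp
      qed
      have ii: "inj_on (\<lambda>e. v e x) onb" "independent ((\<lambda>e. v e x) ` onb)"
        by (rule independent_image[OF finite_onb], erule z)+
      have "v e x \<in> BL x" if "e \<in> onb" for e
        unfolding BL_iff vG
        using relates_unchart[OF c d subsetD[OF W(3) x] Dx(2)[OF x that]]
          Lrep_unchart[OF d Wc(2)[OF x] Dx(1)[OF x that, unfolded loc_apply[OF c Wc(1)[OF x]]]] by blast
      then have "span ((\<lambda>e. v e x) ` onb) \<subseteq> BL x" by (intro span_minimal BL_subspace) blast
      moreover have "t \<in> span ((\<lambda>e. v e x) ` onb)" if t: "t \<in> BL x" for t
      proof -
        have "t = ?G (\<Sum>e\<in>onb. (\<delta> e (snd ?c x) \<bullet> gvec (?H t)) *\<^sub>R b e (snd ?c x))"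
          unfolding Dx(4)[OF x BL_chart[OF c d subsetD[OF W(3) x] t], symmetric] by (simp add: GH)
        also have "\<dots> = (\<Sum>e\<in>onb. (\<delta> e (snd ?c x) \<bullet> gvec (?H t)) *\<^sub>R v e x)"
          by (simp add: linear_sum[OF linear_gtrans] linear_scale[OF linear_gtrans] vG)
        finally show ?thesis
          unfolding span_image_finite[OF finite_onb]
          by (rule exI[of _ "\<lambda>e. \<delta> e (snd ?c x) \<bullet> gvec (?H t)"])
      qed
      ultimately show ?thesis using ii by blast
    qed
    show "\<exists>U s. open U \<and> x0 \<in> U \<and> (\<forall>i<?k. smooth_gsection_on AB U (s i)) \<and>
        (\<forall>q\<in>U. inj_on (\<lambda>i. s i q) {..<?k} \<and> independent ((\<lambda>i. s i q) ` {..<?k}) \<and> span ((\<lambda>i. s i q) ` {..<?k}) = BL q)"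
    proof (intro exI[of _ W] exI[of _ "\<lambda>i. v (h i)"] conjI W(1,2) allI impI ballI)
      show "smooth_gsection_on AB W (v (h i))" if "i < ?k" for i by (rule sv) (use hi that in blast)
      fix q assume q: "q \<in> W"
      have im: "(\<lambda>i. v (h i) q) ` {..<?k} = (\<lambda>e. v e q) ` onb"
        using image_image[of "\<lambda>e. v e q" h "{..<?k}"] unfolding hi by (rule sym)
      show "inj_on (\<lambda>i. v (h i) q) {..<?k}"
        using comp_inj_on[OF hinj, of "\<lambda>e. v e q"] frame[OF q] hi by (simp add: o_def)
      show "independent ((\<lambda>i. v (h i) q) ` {..<?k})" "span ((\<lambda>i. v (h i) q) ` {..<?k}) = BL q"
        unfolding im using frame[OF q] by blast+
    qed
  qed
qed

lemma along_rep_at: "c \<in> AB \<Longrightarrow> x \<in> fst c \<Longrightarrow>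
    along_rep AM f c d a (snd c x) = gtrans (chart_at AM (f x)) d (f x) (a x)"
  by (simp add: along_rep_def)

text \<open>The charts are those selected at \<open>x0\<close> and \<open>f x0\<close>. At the base
  point the representatives are then the values themselves, and the fibres \<open>L (f x0)\<close>
  and \<open>BL x0\<close> appear without transport.\<close>

lemma BL_involutive_at:
  assumes s: "s \<in> sections AB BL" and t: "t \<in> sections AB BL"
  shows "courant_bracket AB s t x0 \<in> BL x0"
proof -
  define c d where "c = chart_at AB x0" and "d = chart_at AM (f x0)"
  have c: "c \<in> AB" "x0 \<in> fst c" and d: "d \<in> AM" "f x0 \<in> fst d"
    unfolding c_def d_def using B.chart_at M.chart_at by blast+
  let ?F = "loc c d" and ?y0 = "snd c x0"
  have ss: "smooth_gsection_on AB UNIV s" and st: "smooth_gsection_on AB UNIV t"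
    using s t by (simp_all add: sections_def)
  obtain W where W: "open W" "x0 \<in> W" and lift:
    "\<And>s. s \<in> sections AB BL \<Longrightarrow> \<exists>a. smooth_along_on W a \<and>
        (\<forall>x\<in>W. a x \<in> L (f x) \<and> relates (tangent_map AB AM f x) (a x) (s x) \<and> (s x = 0 \<longrightarrow> a x = 0))"
    by (rule lift_exists[of x0]) (rule that)
  obtain a1 where a1: "smooth_along_on W a1" "\<And>x. x \<in> W \<Longrightarrow> a1 x \<in> L (f x)"
    "\<And>x. x \<in> W \<Longrightarrow> relates (tangent_map AB AM f x) (a1 x) (s x)" using lift[OF s] by blast
  obtain a2 where a2: "smooth_along_on W a2" "\<And>x. x \<in> W \<Longrightarrow> a2 x \<in> L (f x)"
    "\<And>x. x \<in> W \<Longrightarrow> relates (tangent_map AB AM f x) (a2 x) (t x)" using lift[OF t] by blast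
  obtain k :: nat and Z g where fr: "isotropic_frame Z (snd d (f x0)) (Lrep d) {..<k} (\<lambda>i. sec_rep AM d (g i))"
    and g: "\<And>i. i < k \<Longrightarrow> g i \<in> sections AM L"
    by (rule Lrep_frame[OF d]) (rule that)
  let ?l = "\<lambda>i. sec_rep AM d (g i)"
  obtain T m where T: "open T" "snd d (f x0) \<in> T" "T \<subseteq> Z" and sm: "\<And>i. i \<in> {..<k} \<Longrightarrow> smooth_on T (m i)"
    and m: "\<And>z b. z \<in> T \<Longrightarrow> b \<in> Lrep d z \<Longrightarrow> b = (\<Sum>i\<in>{..<k}. (m i z \<bullet> gvec b) *\<^sub>R ?l i z)"
    by (rule frame_coordinates[OF fr]) (rule that)
  \<comment> \<open>On this neighbourhood the two lifts, both charts and the coordinate functionals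
    of the frame of \<open>L\<close> are available together.\<close>
  define W' where "W' = W \<inter> dom c d \<inter> f -` (fst d \<inter> snd d -` T)"
  have oW': "open W'"
    unfolding W'_def
    by (intro open_Int W open_dom c d open_vimage_f continuous_open_preimage[OF M.chart_continuous[OF d(1)] M.chart_open[OF d(1)] T(1)])
  have W'd: "W' \<subseteq> dom c d" and W'W: "W' \<subseteq> W" unfolding W'_def by blast+
  have W'c: "x \<in> fst c" "f x \<in> fst d" "snd d (f x) \<in> T" if "x \<in> W'" for x
    using that unfolding W'_def dom_def by blast+
  have x0W': "x0 \<in> W'" unfolding W'_def dom_def using W c d T by blast
  define S where "S = snd c ` W'"
  have oS: "open S" unfolding S_def by (rule B.image_open[OF c(1) oW']) (use W'c in blast)
  have y0S: "?y0 \<in> S" unfolding S_def using x0W' by blast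
  have F: "smooth_on S ?F" unfolding S_def by (rule smooth_on_subset[OF smooth_loc[OF c(1) d(1)]]) (use W'd in blast)
  have Fx: "?F (snd c x) = snd d (f x)" if "x \<in> W'" for x by (rule loc_apply[OF c(1) W'c(1)[OF that]])
  have FT: "?F ` S \<subseteq> T" unfolding S_def using Fx W'c(3) by auto
  let ?A = "\<lambda>a. along_rep AM f c d a"
  have sA: "smooth_on S (?A a)" if "smooth_along_on W a" for a
  proof (rule smooth_on_subset)
    show "smooth_on (snd c ` (dom c d \<inter> W)) (?A a)" using that c d unfolding smooth_along_on_def by blast
    show "S \<subseteq> snd c ` (dom c d \<inter> W)" unfolding S_def using W'd W'W by blast
  qed
  have relA: "relates (Dbl ?F y) (?A a y) (sec_rep AB c u y)"
    if "y \<in> S" "\<And>x. x \<in> W \<Longrightarrow> relates (tangent_map AB AM f x) (a x) (u x)" for y a u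
  proof -
    obtain x where x: "x \<in> W'" "y = snd c x" using \<open>y \<in> S\<close> unfolding S_def by blast
    have r: "relates (tangent_map AB AM f x) (a x) (u x)" using that(2) x(1) W'W by blast
    show ?thesis
      unfolding x(2) along_rep_at[OF c(1) W'c(1)[OF x(1)]] B.sec_rep_at[OF c(1) W'c(1)[OF x(1)]]
      by (rule relates_chart[OF c(1) d(1) subsetD[OF W'd x(1)] r])
  qed
  have expA: "?A a y = (\<Sum>i\<in>{..<k}. (m i (?F y) \<bullet> gvec (?A a y)) *\<^sub>R ?l i (?F y))"
    if "y \<in> S" "\<And>x. x \<in> W \<Longrightarrow> a x \<in> L (f x)" for y a
  proof -
    obtain x where x: "x \<in> W'" "y = snd c x" using \<open>y \<in> S\<close> unfolding S_def by blast
    have "a x \<in> L (f x)" using that(2) x(1) W'W by blast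
    then have "?A a y \<in> Lrep d (?F y)"
      unfolding x(2) along_rep_at[OF c(1) W'c(1)[OF x(1)]] Fx[OF x(1)] Lrep_at[OF d(1) W'c(2)[OF x(1)]] by blast
    moreover have "?F y \<in> T" using \<open>y \<in> S\<close> FT by blast
    ultimately show ?thesis by (intro m)
  qed
  have dc: "(\<lambda>y. m i (?F y) \<bullet> gvec (?A a y)) differentiable (at ?y0)"
    if "smooth_along_on W a" "i \<in> {..<k}" for a i
    by (rule smooth_on_differentiable[OF _ y0S], rule smooth_on_inner[OF oS])
       (intro smooth_on_compose[OF oS T(1) FT F sm[OF that(2)]]
          smooth_on_bounded_linear[OF oS bounded_linear_gvec sA[OF that(1)]])+
  have sg: "smooth_gsection_on AM UNIV (g i)" if "i \<in> {..<k}" for i using g[of i] that by (simp add: sections_def)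
  have dl: "?l i differentiable (at (?F ?y0))" if "i \<in> {..<k}" for i
    unfolding loc_apply[OF c] by (rule M.sec_rep_differentiable[OF sg[OF that] open_UNIV UNIV_I d])
  have lV: "?l i (?F ?y0) \<in> L (f x0)" if "i \<in> {..<k}" for i
  proof -
    have "?l i (?F ?y0) = g i (f x0)"
      unfolding loc_apply[OF c] M.sec_rep_at[OF d] using M.gtrans_self[OF d] by (simp add: d_def)
    then show ?thesis using g[of i] that by (simp add: sections_def)
  qed
  have cV: "coord_courant (?l i) (?l j) (?F ?y0) \<in> L (f x0)" if "i \<in> {..<k}" "j \<in> {..<k}" for i j
  proof -
    have "courant_bracket AM (g i) (g j) \<in> sections AM L"
      using dirac g[of i] g[of j] that unfolding dirac_structure_def by simp
    then have "courant_bracket AM (g i) (g j) (f x0) \<in> L (f x0)" by (simp add: sections_def)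
    then show ?thesis
      unfolding loc_apply[OF c] M.courant_bracket_coord_courant[OF sg[OF that(1)] sg[OF that(2)] open_UNIV UNIV_I] d_def .
  qed
  have BLx0: "BL x0 = pull (Dbl ?F ?y0) (L (f x0))"
    unfolding dirac_pullback_eq tangent_map_loc c_def d_def ..
  have br: "courant_bracket AB s t x0 = coord_courant (sec_rep AB c s) (sec_rep AB c t) ?y0"
    unfolding c_def by (rule B.courant_bracket_coord_courant[OF ss st open_UNIV UNIV_I])
  show ?thesis
  proof (rule maximal_isotropic_perp[OF BL_maximal_isotropic])
    fix b assume "b \<in> BL x0"
    then have b: "b \<in> pull (Dbl ?F ?y0) (L (f x0))" unfolding BLx0 .
    show "pairing (courant_bracket AB s t x0) b = 0"
      unfolding br
    proof (rule coord_courant_pull_isotropic[where ?a1.0 = "?A a1" and ?a2.0 = "?A a2" and I = "{..<k}" and l = ?l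
            and ?c1.0 = "\<lambda>i y. m i (?F y) \<bullet> gvec (?A a1 y)" and ?c2.0 = "\<lambda>i y. m i (?F y) \<bullet> gvec (?A a2 y)",
          OF oS y0S F _ _ _ _ _ _ _ _ _ L_isotropic _ _ b])
      show "sec_rep AB c s differentiable (at ?y0)" by (rule B.sec_rep_differentiable[OF ss open_UNIV UNIV_I c])
      show "sec_rep AB c t differentiable (at ?y0)" by (rule B.sec_rep_differentiable[OF st open_UNIV UNIV_I c])
    next
      fix y assume y: "y \<in> S"
      show "relates (Dbl ?F y) (?A a1 y) (sec_rep AB c s y)" by (rule relA[OF y a1(3)])
      show "relates (Dbl ?F y) (?A a2 y) (sec_rep AB c t y)" by (rule relA[OF y a2(3)])
      show "?A a1 y = (\<Sum>i\<in>{..<k}. (m i (?F y) \<bullet> gvec (?A a1 y)) *\<^sub>R ?l i (?F y))" by (rule expA[OF y a1(2)])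
      show "?A a2 y = (\<Sum>i\<in>{..<k}. (m i (?F y) \<bullet> gvec (?A a2 y)) *\<^sub>R ?l i (?F y))" by (rule expA[OF y a2(2)])
    next
      fix i assume i: "i \<in> {..<k}"
      show "(\<lambda>y. m i (?F y) \<bullet> gvec (?A a1 y)) differentiable (at ?y0)" by (rule dc[OF a1(1) i])
      show "(\<lambda>y. m i (?F y) \<bullet> gvec (?A a2 y)) differentiable (at ?y0)" by (rule dc[OF a2(1) i])
      show "?l i differentiable (at (?F ?y0))" by (rule dl[OF i])
      show "?l i (?F ?y0) \<in> L (f x0)" by (rule lV[OF i])
      fix j assume j: "j \<in> {..<k}"
      show "coord_courant (?l i) (?l j) (?F ?y0) \<in> L (f x0)" by (rule cV[OF i j])
    qed
  qed
qed

lemma dirac_structure_BL: "dirac_structure AB BL"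
  unfolding dirac_structure_def
proof (intro conjI allI ballI BL_subbundle BL_maximal_isotropic)
  fix s t assume st: "s \<in> sections AB BL" "t \<in> sections AB BL"
  have "smooth_gsection_on AB UNIV (courant_bracket AB s t)"
    by (rule B.smooth_courant_bracket) (use st in \<open>auto simp: sections_def\<close>)
  then show "courant_bracket AB s t \<in> sections AB BL"
    using BL_involutive_at[OF st] by (simp add: sections_def)
qed

section \<open>Glueing of lifts and equality of the foliations\<close>

lemma compactly_supported_mono:
  assumes "compactly_supported s" "\<And>x. s x = 0 \<Longrightarrow> t x = 0"
  shows "compactly_supported (t :: 'b \<Rightarrow> 'v::zero)"
proof -
  have "closure {x. t x \<noteq> 0} \<subseteq> closure {x. s x \<noteq> 0}" by (rule closure_mono) (use assms(2) in blast)
  then show ?thesis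
    using assms(1) compact_Int_closed[of "closure {x. s x \<noteq> 0}" "closure {x. t x \<noteq> 0}"]
    unfolding compactly_supported_def by (simp add: inf.absorb2)
qed

text \<open>For a fixed section, being a lift is an affine condition, so weighted means of local
  lifts with total weight 1 are lifts. Total weight 1 is arranged on the closed support only; off it
  the section is 0, and the combination vanishes together with all local lifts in it.\<close>

lemma global_lift:
  assumes s: "s \<in> sections AB BL" and K: "compactly_supported s"
  obtains a where "smooth_along_on UNIV a" "\<And>x. a x \<in> L (f x)"
    "\<And>x. relates (tangent_map AB AM f x) (a x) (s x)" "\<And>x. s x = 0 \<Longrightarrow> a x = 0"
proof -
  let ?K = "closure {x. s x \<noteq> 0}"
  let ?P = "\<lambda>x W \<phi> a. open W \<and> smooth_along_on W a \<and> (\<forall>x\<in>W. a x \<in> L (f x) \<and>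
      relates (tangent_map AB AM f x) (a x) (s x) \<and> (s x = 0 \<longrightarrow> a x = 0)) \<and>
      B.smooth_fun \<phi> \<and> (\<forall>x. 0 \<le> \<phi> x) \<and> 0 < \<phi> x \<and> open {x. 0 < \<phi> x} \<and> closure {x. \<phi> x \<noteq> 0} \<subseteq> W"
  have "\<exists>W \<phi> a. ?P x W \<phi> a" for x
  proof -
    obtain W where W: "open W" "x \<in> W" and lift:
      "\<And>s. s \<in> sections AB BL \<Longrightarrow> \<exists>a. smooth_along_on W a \<and>
        (\<forall>x\<in>W. a x \<in> L (f x) \<and> relates (tangent_map AB AM f x) (a x) (s x) \<and> (s x = 0 \<longrightarrow> a x = 0))"
      by (rule lift_exists[of x]) (rule that)
    obtain a where a: "smooth_along_on W a" "\<forall>x\<in>W. a x \<in> L (f x) \<and>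
        relates (tangent_map AB AM f x) (a x) (s x) \<and> (s x = 0 \<longrightarrow> a x = 0)" using lift[OF s] by blast
    obtain \<phi> :: "'b \<Rightarrow> real" where \<phi>: "B.smooth_fun \<phi>" "\<And>x. 0 \<le> \<phi> x" "0 < \<phi> x" "open {x. 0 < \<phi> x}"
      "closure {x. \<phi> x \<noteq> 0} \<subseteq> W" by (rule B.bump_function[OF W]) (rule that)
    show ?thesis by (intro exI[of _ W] exI[of _ \<phi>] exI[of _ a]) (use W(1) a \<phi> in simp)
  qed
  then obtain W \<phi> a where P: "?P z (W z) (\<phi> z) (a z)" for z by metis
  have W: "open (W z)" and sa: "smooth_along_on (W z) (a z)"
    and aL: "x \<in> W z \<Longrightarrow> a z x \<in> L (f x)" and ar: "x \<in> W z \<Longrightarrow> relates (tangent_map AB AM f x) (a z x) (s x)"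
    and a0: "x \<in> W z \<Longrightarrow> s x = 0 \<Longrightarrow> a z x = 0"
    and s\<phi>: "B.smooth_fun (\<phi> z)" and \<phi>nn: "0 \<le> \<phi> z x" and \<phi>z: "0 < \<phi> z z"
    and o\<phi>: "open {x. 0 < \<phi> z x}" and \<phi>W: "closure {x. \<phi> z x \<noteq> 0} \<subseteq> W z" for z x
    using P[of z] by simp_all
  have \<phi>W': "x \<in> W z" if "\<phi> z x \<noteq> 0" for x z
    using that \<phi>W[of z] closure_subset[of "{x. \<phi> z x \<noteq> 0}"] by blast
  have cK: "compact ?K" using K by (simp add: compactly_supported_def)
  have cov: "?K \<subseteq> (\<Union>z\<in>?K. {x. 0 < \<phi> z x})" using \<phi>z by blast
  obtain Z where Z: "Z \<subseteq> ?K" "finite Z" "?K \<subseteq> (\<Union>z\<in>Z. {x. 0 < \<phi> z x})"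
    by (rule compactE_image[OF cK _ cov]) (rule o\<phi>, rule that)
  \<comment> \<open>Where \<open>\<psi>\<close> vanishes all the nonnegative summands vanish, and
    with them all weights, so the value of \<open>inverse 0\<close> is immaterial.\<close>
  define \<psi> where "\<psi> = (\<lambda>x. \<Sum>z\<in>Z. \<phi> z x)"
  define w where "w = (\<lambda>z x. inverse (\<psi> x) * \<phi> z x)"
  define b where "b = (\<lambda>x. \<Sum>z\<in>Z. \<phi> z x *\<^sub>R a z x)"
  define a' where "a' = (\<lambda>x. inverse (\<psi> x) *\<^sub>R b x)"
  have a'w: "a' x = (\<Sum>z\<in>Z. w z x *\<^sub>R a z x)" for x
    by (simp add: a'_def b_def w_def scaleR_sum_right)
  have \<psi>pos: "\<psi> x > 0" if "z \<in> Z" "0 < \<phi> z x" for x z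
    unfolding \<psi>_def using that Z(2) \<phi>nn by (intro sum_pos2[of Z z]) auto
  have \<psi>K: "\<psi> x > 0" if x: "x \<in> ?K" for x
  proof -
    obtain z where "z \<in> Z" "0 < \<phi> z x" using Z(3) x by blast
    then show ?thesis by (rule \<psi>pos)
  qed
  have s\<psi>: "smooth_on (snd c ` fst c) (\<lambda>y. \<psi> (chart_inv c y))" if "c \<in> AB" for c
    unfolding \<psi>_def
    by (intro smooth_on_sum B.chart_image_open that) (use s\<phi> that in \<open>simp add: B.smooth_fun_def\<close>)
  have a'0: "a' x = 0" if "s x = 0" for x
  proof -
    have "\<phi> z x *\<^sub>R a z x = 0" for z using a0[of x z] \<phi>W'[of z x] that by (cases "\<phi> z x = 0") auto
    then have "b x = 0" unfolding b_def by (intro sum.neutral) blast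
    then show ?thesis by (simp add: a'_def)
  qed
  have Ks: "s x = 0" if "x \<notin> ?K" for x using that closure_subset[of "{x. s x \<noteq> 0}"] by blast
  have sa': "smooth_along_on UNIV a'"
  proof (rule smooth_along_onI[OF open_UNIV])
    fix x
    let ?c = "chart_at AB x" and ?d = "chart_at AM (f x)"
    note c = B.chart_at(1)[of x] and d = M.chart_at(1)[of "f x"]
    have dc: "dom ?c ?d \<subseteq> fst ?c" by (auto simp: dom_def)
    show "smooth_along_at a' x"
    proof (cases "x \<in> ?K")
      case True
      \<comment> \<open>The closed support is not open, so smoothness at its points is shown on this
        open neighbourhood, on which \<open>\<psi>\<close> is still positive.\<close>
      define V where "V = dom ?c ?d \<inter> (\<Union>z\<in>Z. {x. 0 < \<phi> z x})"
      have oV: "open V" unfolding V_def by (intro open_Int open_dom c d open_UN ballI o\<phi>)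
      have xV: "x \<in> V" and Vd: "V \<subseteq> dom ?c ?d" unfolding V_def using Z(3) True dom_chart_at by blast+
      have Vc: "snd ?c ` V \<subseteq> snd ?c ` fst ?c" using Vd dc by blast
      have oV': "open (snd ?c ` V)" by (rule B.image_open[OF c oV]) (use Vd dc in blast)
      have sb: "smooth_on (snd ?c ` V) (along_rep AM f ?c ?d b)"
      proof -
        have "smooth_on (snd ?c ` V) (along_rep AM f ?c ?d (\<lambda>x. \<phi> z x *\<^sub>R a z x))" for z
        proof (rule smooth_on_subset)
          show "smooth_on (snd ?c ` (dom ?c ?d \<inter> UNIV)) (along_rep AM f ?c ?d (\<lambda>x. \<phi> z x *\<^sub>R a z x))"
            using smooth_along_cutoff[OF s\<phi> sa W \<phi>W, of z] c d unfolding smooth_along_on_def by blast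
        qed (use Vd in blast)
        then show ?thesis
          unfolding b_def along_rep_sum[abs_def] by (intro smooth_on_sum oV')
      qed
      have "smooth_on (snd ?c ` V) (\<lambda>y. inverse (\<psi> (chart_inv ?c y)) *\<^sub>R along_rep AM f ?c ?d b y)"
      proof (intro smooth_on_scaleR[OF oV'] smooth_on_inverse[OF oV'] sb)
        show "smooth_on (snd ?c ` V) (\<lambda>y. \<psi> (chart_inv ?c y))" by (rule smooth_on_subset[OF s\<psi>[OF c] Vc])
        show "\<psi> (chart_inv ?c y) \<noteq> 0" if y: "y \<in> snd ?c ` V" for y
        proof -
          obtain v z where v: "y = snd ?c v" "v \<in> fst ?c" "z \<in> Z" "0 < \<phi> z v" using y dc unfolding V_def by blast
          then have "chart_inv ?c y = v" using c by simp
          then show ?thesis using \<psi>pos[OF v(3,4)] by simp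
        qed
      qed
      then have "smooth_on (snd ?c ` V) (along_rep AM f ?c ?d a')"
        unfolding a'_def along_rep_scaleR[abs_def] .
      then show ?thesis by (rule smooth_along_atI[OF c d oV xV Vd])
    next
      case False
      let ?V = "dom ?c ?d \<inter> - ?K"
      have oV: "open ?V" by (intro open_Int open_dom c d) auto
      have oV': "open (snd ?c ` ?V)" by (rule B.image_open[OF c oV]) (use dc in blast)
      have "smooth_on (snd ?c ` ?V) (along_rep AM f ?c ?d a')"
      proof (rule smooth_on_cong[OF oV' _ smooth_on_const[of _ 0]])
        fix y assume "y \<in> snd ?c ` ?V"
        then obtain v where v: "v \<in> ?V" "y = snd ?c v" by blast
        then have "a' v = 0" using Ks a'0 by blast
        moreover have "v \<in> fst ?c" using v dc by blast
        ultimately show "0 = along_rep AM f ?c ?d a' y"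
          unfolding v(2) using along_rep_at[OF c] by (simp add: linear_0[OF linear_gtrans])
      qed
      then show ?thesis using False dom_chart_at by (intro smooth_along_atI[OF c d oV]) blast+
    qed
  qed
  have a'L: "a' x \<in> L (f x)" for x
    unfolding a'w
  proof (intro subspace_sum L_subspace)
    fix z
    show "w z x *\<^sub>R a z x \<in> L (f x)"
    proof (cases "\<phi> z x = 0")
      case True then show ?thesis by (simp add: w_def subspace_0[OF L_subspace])
    next
      case False then show ?thesis by (intro subspace_scale L_subspace aL \<phi>W')
    qed
  qed
  have a'r: "relates (tangent_map AB AM f x) (a' x) (s x)" for x
  proof (cases "x \<in> ?K")
    case True
    \<comment> \<open>\<open>a z\<close> is known to be a lift only on \<open>W z\<close>; the
      indices whose bump function vanishes at \<open>x\<close> are discarded without changing the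
      sums.\<close>
    let ?Z = "{z \<in> Z. \<phi> z x \<noteq> 0}"
    have "(\<Sum>z\<in>Z. w z x) = 1"
      using \<psi>K[OF True] by (simp add: w_def sum_distrib_left[symmetric] \<psi>_def)
    moreover have "(\<Sum>z\<in>Z. w z x) = (\<Sum>z\<in>?Z. w z x)"
      using Z(2) by (intro sum.mono_neutral_right) (auto simp: w_def)
    ultimately have w1: "(\<Sum>z\<in>?Z. w z x) = 1" by simp
    have "a' x = (\<Sum>z\<in>?Z. w z x *\<^sub>R a z x)"
      unfolding a'w using Z(2) by (intro sum.mono_neutral_right) (auto simp: w_def)
    moreover have "relates (tangent_map AB AM f x) (\<Sum>z\<in>?Z. w z x *\<^sub>R a z x) (\<Sum>z\<in>?Z. w z x *\<^sub>R s x)"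
      by (rule relates_sum) (use ar \<phi>W' in blast)
    ultimately show ?thesis using w1 by (simp add: scaleR_sum_left[symmetric])
  next
    case False
    have "s x = 0" by (rule Ks[OF False])
    then show ?thesis using a'0[of x] by (simp add: relates_def)
  qed
  show thesis by (rule that[OF sa' a'L a'r a'0])
qed

lemma smooth_image_section:
  assumes "\<sigma> \<in> algebroid_pullback_sections AB AM f L"
  defines "s \<equiv> \<lambda>x. (snd (\<sigma> x), snd (fst (\<sigma> x)) o\<^sub>L tangent_map AB AM f x)"
  shows "s \<in> sections AB BL"
proof -
  have sa: "smooth_gsection_along AB AM f (fst \<circ> \<sigma>)" and sv: "smooth_vector_field_on AB UNIV (snd \<circ> \<sigma>)"
    and \<sigma>: "\<sigma> x \<in> algebroid_pullback AB AM f L x" for x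
    using assms(1) by (simp_all add: algebroid_pullback_sections_def)
  have \<sigma>L: "fst (\<sigma> x) \<in> L (f x)" and rel: "relates (tangent_map AB AM f x) (fst (\<sigma> x)) (s x)" for x
    using \<sigma>[of x] by (auto simp: algebroid_pullback_def s_def relates_def)
  have "s x \<in> BL x" for x unfolding BL_iff using \<sigma>L rel by blast
  moreover have "smooth_gsection_on AB UNIV s"
  proof (rule B.smooth_gsection_on_localI[OF open_UNIV])
    fix x
    let ?c = "chart_at AB x" and ?d = "chart_at AM (f x)"
    note c = B.chart_at(1)[of x] and d = M.chart_at(1)[of "f x"]
    let ?a = "along_rep AM f ?c ?d (fst \<circ> \<sigma>)"
    have dc: "dom ?c ?d \<subseteq> fst ?c" by (auto simp: dom_def)
    have oi: "open (snd ?c ` dom ?c ?d)" by (rule open_image_dom[OF c d])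
    have s1: "smooth_on (snd ?c ` dom ?c ?d) ?a"
      using sa c d unfolding smooth_gsection_along_iff smooth_along_on_def by simp
    have s2: "smooth_on (snd ?c ` dom ?c ?d) (vec_rep AB ?c (snd \<circ> \<sigma>))"
      by (rule smooth_on_subset[of "snd ?c ` (fst ?c \<inter> UNIV)"])
         (use sv c dc in \<open>auto simp: smooth_vector_field_on_def\<close>)
    have "smooth_on (snd ?c ` dom ?c ?d) (\<lambda>y. (vec_rep AB ?c (snd \<circ> \<sigma>) y, snd (?a y) o\<^sub>L Dbl (loc ?c ?d) y))"
      by (intro smooth_on_Pair oi s2 smooth_on_blinfun_compose smooth_on_snd[OF oi s1] smooth_on_Dbl[OF oi smooth_loc[OF c d]])
    then have "smooth_on (snd ?c ` dom ?c ?d) (sec_rep AB ?c s)"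
    proof (rule smooth_on_cong[OF oi, rotated])
      fix y assume "y \<in> snd ?c ` dom ?c ?d"
      then obtain q where q: "q \<in> dom ?c ?d" "y = snd ?c q" by blast
      have qc: "q \<in> fst ?c" using q dc by blast
      have S: "sec_rep AB ?c s y = gtrans (chart_at AB q) ?c q (s q)"
        unfolding q(2) by (rule B.sec_rep_at[OF c qc])
      have "snd (sec_rep AB ?c s y) = snd (?a y) o\<^sub>L Dbl (loc ?c ?d) y"
        using relates_chart[OF c d q(1) rel] unfolding S unfolding q(2) along_rep_at[OF c qc] by (simp add: relates_def)
      moreover have "fst (sec_rep AB ?c s y) = vec_rep AB ?c (snd \<circ> \<sigma>) y"
        unfolding S unfolding q(2) using c qc by (simp add: gtrans_def vec_rep_def vec_in_chart_def s_def)
      ultimately show "(vec_rep AB ?c (snd \<circ> \<sigma>) y, snd (?a y) o\<^sub>L Dbl (loc ?c ?d) y) = sec_rep AB ?c s y"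
        by (simp add: prod_eq_iff)
    qed
    then show "\<exists>c\<in>AB. \<exists>W. open W \<and> x \<in> W \<and> W \<subseteq> fst c \<and> smooth_on (snd c ` W) (sec_rep AB c s)"
      using c dc dom_chart_at open_dom[OF c d] by blast
  qed
  ultimately show ?thesis by (simp add: sections_def)
qed

text \<open>Both passages keep the vector field. A lift vanishes where the section of
  \<open>BL\<close> does, and the image vanishes where the section of \<open>f^!L\<close> does, so
  compactness of supports is preserved both ways.\<close>

lemma foliation_BL: "dirac_foliation AB BL = algebroid_pullback_foliation AB AM f L"
proof (intro set_eqI iffI)
  fix X assume "X \<in> dirac_foliation AB BL"
  then obtain s where s: "s \<in> sections AB BL" "compactly_supported s" and X: "X = fst \<circ> s"
    unfolding dirac_foliation_def by blast
  obtain a where a: "smooth_along_on UNIV a" "\<And>x. a x \<in> L (f x)"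
    "\<And>x. relates (tangent_map AB AM f x) (a x) (s x)" "\<And>x. s x = 0 \<Longrightarrow> a x = 0"
    by (rule global_lift[OF s]) (rule that)
  define \<sigma> where "\<sigma> = (\<lambda>x. (a x, fst (s x)))"
  have "\<sigma> \<in> algebroid_pullback_sections AB AM f L"
    using a s(1) unfolding algebroid_pullback_sections_def smooth_gsection_along_iff[symmetric]
    by (auto simp: \<sigma>_def o_def algebroid_pullback_def relates_def sections_def smooth_gsection_on_def)
  moreover have "compactly_supported \<sigma>"
    by (rule compactly_supported_mono[OF s(2)]) (simp add: \<sigma>_def a(4) zero_prod_def)
  moreover have "X = snd \<circ> \<sigma>" by (auto simp: X \<sigma>_def)
  ultimately show "X \<in> algebroid_pullback_foliation AB AM f L"
    unfolding algebroid_pullback_foliation_def by blast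
next
  fix X assume "X \<in> algebroid_pullback_foliation AB AM f L"
  then obtain \<sigma> where \<sigma>: "\<sigma> \<in> algebroid_pullback_sections AB AM f L" "compactly_supported \<sigma>" and X: "X = snd \<circ> \<sigma>"
    unfolding algebroid_pullback_foliation_def by blast
  define s where "s = (\<lambda>x. (snd (\<sigma> x), snd (fst (\<sigma> x)) o\<^sub>L tangent_map AB AM f x))"
  have "s \<in> sections AB BL" unfolding s_def by (rule smooth_image_section[OF \<sigma>(1)])
  moreover have "compactly_supported s"
    by (rule compactly_supported_mono[OF \<sigma>(2)]) (simp add: s_def zero_prod_def[symmetric])
  moreover have "X = fst \<circ> s" by (auto simp: X s_def)
  ultimately show "X \<in> dirac_foliation AB BL" unfolding dirac_foliation_def by blast
qed

end

theorem proposition4p3: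
  fixes AB :: "('b::{t2_space, second_countable_topology}, 'u::fd_euclidean) chart set"
    and AM :: "('m::{t2_space, second_countable_topology}, 'e::fd_euclidean) chart set"
    and f :: "'b \<Rightarrow> 'm"
    and L :: "'m \<Rightarrow> 'e gtangent set"
  assumes "smooth_atlas AB"
    and "smooth_atlas AM"
    and "smooth_map AB AM f"
    and "dirac_structure AM L"
    and "algebroid_pullback_smooth AB AM f L"
  shows "dirac_structure AB (dirac_pullback AB AM f L) \<and>
         dirac_foliation AB (dirac_pullback AB AM f L) = algebroid_pullback_foliation AB AM f L"
proof -
  obtain r where r: "\<And>x. dim (algebroid_pullback AB AM f L x) = r"
    using assms(5) unfolding algebroid_pullback_smooth_def by blast
  interpret dirac_map AB AM f L r
    by unfold_locales (use assms r in auto)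
  show ?thesis using dirac_structure_BL foliation_BL by blast
qed

end
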